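(* Let $S$ be the substitution monad on $[\mathcal H^{\mathrm{op}},\mathbf{Set}]$, i.e. the monad induced by the free-forgetful adjunction $\{s\}\text{-}\mathbf{GAT}\leftrightarrows[\mathcal H^{\mathrm{op}},\mathbf{Set}]$, with $SX$ described by inc-lists as in the context. For each $X\in[\mathcal H^{\mathrm{op}},\mathbf{Set}]$, the multiplication $\mu^S_X\colon S^2X\to SX$ has components $$S^2X(n)\to SX(n),\ (\alpha,(\beta,h,k))\mapsto(\beta\alpha,h\cup k)$$ and $$\mathrm{Tm}_{S^2X}(\alpha,(\beta,h,k))\to\mathrm{Tm}_{SX}(\beta\alpha,h\cup k),\ a\mapsto a.$$
   Context: \textbf{Expressions and judgements.} Fix a denumerable set $\mathrm{Var}$ of variables. Given an alphabet $\Xi$, the expressions over $\Xi$ are generated as follows: each $x\in\mathrm{Var}$ is an expression; if $n\geq 0$, $e_1,\dots,e_n$ are expressions and $w\in\Xi$, then $w(e_1,\dots,e_n)$ is an expression (written $w$ when $n=0$). $e'[e/x]$ denotes substitution of $e$ for $x$ in $e'$. A context is a (possibly empty) list $x_1:T_1,\dots,x_n:T_n$ of distinct variables $x_i$ and expressions $T_i$. A judgement is a string $\Gamma\vdash T\ \mathsf{type}$ (type judgement), $\Gamma\vdash t:T$ (term judgement), $\Gamma\vdash T=T'\ \mathsf{type}$ (type equality) or $\Gamma\vdash t=t':T$ (term equality), with $\Gamma$ a context and $t,t',T,T'$ expressions; its degree is one more than the length of $\Gamma$. The boundary of a judgement is a list of judgements: $\partial(\vdash T\ \mathsf{type})=()$;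 $\partial(\Gamma,x:T\vdash T'\ \mathsf{type})=(\Gamma\vdash T\ \mathsf{type})$; $\partial(\Gamma\vdash t:T)=(\Gamma\vdash T\ \mathsf{type})$; $\partial(\Gamma\vdash T=T'\ \mathsf{type})=(\Gamma\vdash T\ \mathsf{type},\ \Gamma\vdash T'\ \mathsf{type})$; $\partial(\Gamma\vdash t=t':T)=(\Gamma\vdash t:T,\ \Gamma\vdash t':T)$. \textbf{Deduction rules} (premises $\Longrightarrow$ conclusion; $\mathcal J$ stands for the right-hand side of any of the four judgement forms). \emph{Equality and $\alpha$ rules}: $\Gamma\vdash t:T\Longrightarrow\Gamma\vdash t=t:T$; $\Gamma\vdash t_1=t_2:T\Longrightarrow\Gamma\vdash t_2=t_1:T$; $\Gamma\vdash t_1=t_2:T$ and $\Gamma\vdash t_2=t_3:T\Longrightarrow\Gamma\vdash t_1=t_3:T$; $\Gamma\vdash T\ \mathsf{type}\Longrightarrow\Gamma\vdash T=T\ \mathsf{type}$; $\Gamma\vdash T_1=T_2\ \mathsf{type}\Longrightarrow\Gamma\vdash T_2=T_1\ \mathsf{type}$; $\Gamma\vdash T_1=T_2\ \mathsf{type}$ and $\Gamma\vdash T_2=T_3\ \mathsf{type}\Longrightarrow\Gamma\vdash T_1=T_3\ \mathsf{type}$; $\Gamma\vdash T_1=T_2\ \mathsf{type}$ and $\Gamma\vdash t:T_1\Longrightarrow\Gamma\vdash t:T_2$; $\Gamma\vdash T_1=T_2\ \mathsf{type}$ and $\Gamma\vdash t_1=t_2:T_1\Longrightarrow\Gamma\vdash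 t_1=t_2:T_2$; $\Gamma\vdash\mathcal J\Longrightarrow\sigma\cdot\Gamma\vdash\sigma\cdot\mathcal J$ for any permutation $\sigma\in\mathrm{Sym}(\mathrm{Var})$ acting on variables. \emph{Substitution} ($s$): $\Gamma\vdash t:T$ and $\Gamma,y:T,\Delta\vdash\mathcal J\Longrightarrow\Gamma,\Delta[t/y]\vdash\mathcal J[t/y]$; $\Gamma\vdash t_1=t_2:T$ and $\Gamma,y:T,\Delta\vdash T'\ \mathsf{type}\Longrightarrow\Gamma,\Delta[t_2/y]\vdash T'[t_1/y]=T'[t_2/y]\ \mathsf{type}$; $\Gamma\vdash t_1=t_2:T$ and $\Gamma,y:T,\Delta\vdash t':T'\Longrightarrow\Gamma,\Delta[t_2/y]\vdash t'[t_1/y]=t'[t_2/y]:T'[t_2/y]$. \textbf{$\{s\}$-GATs.} An $\{s\}$-GAT $\mathbb T$ consists of a collection $\Omega$ of type-constants, a collection $\Sigma$ of term-constants and a collection $\Lambda$ of basic judgements over $\Omega\amalg\Sigma$ such that: for each $A\in\Omega$ there is a unique judgement in $\Lambda$ of the form $x_1:T_1,\dots,x_{n-1}:T_{n-1}\vdash A(x_1,\dots,x_{n-1})\ \mathsf{type}$; for each $f\in\Sigma$ there is a unique judgement in $\Lambda$ of the form $x_1:T_1,\dots,x_{n-1}:T_{n-1}\vdash f(x_1,\dots,x_{n-1}):T$; all other elements of $\Lambda$ are type or term equality judgements; each element of $\Lambda$ lies in $\mathbb T^*$. Here $\mathbb T^*$, the collection of derived judgements, is the smallest collection closed under all the rules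 listed above and containing $\mathcal J\in\Lambda$ whenever it contains each judgement in $\partial(\mathcal J)$. An interpretation $\phi\colon\mathbb T\to\mathbb U$ is a function $\phi\colon\mathbb T^*\to\mathbb U^*$ preserving boundaries and preserving deduction: viewing each rule with $n$ premises (for each choice of parameters such as $\sigma$) as an $n$-ary partial function $r$ on judgements, $\phi(r(\mathcal J_1,\dots,\mathcal J_n))=r(\phi(\mathcal J_1),\dots,\phi(\mathcal J_n))$ whenever both sides are defined. On derived type judgements, $(x_1:S_1,\dots,x_{n-1}:S_{n-1}\vdash S_n\ \mathsf{type})\equiv(y_1:T_1,\dots,y_{m-1}:T_{m-1}\vdash T_m\ \mathsf{type})$ iff $n=m$ and for $1\le i\le n$ the judgement $x_1:S_1,\dots,x_{i-1}:S_{i-1}\vdash S_i=T_i[x_1/y_1,\dots,x_{i-1}/y_{i-1}]\ \mathsf{type}$ is derived. On derived term judgements, $(x_1:S_1,\dots,x_{n-1}:S_{n-1}\vdash s:S_n)\equiv(y_1:T_1,\dots,y_{m-1}:T_{m-1}\vdash t:T_m)$ iff their boundaries are $\equiv$ and $x_1:S_1,\dots,x_{n-1}:S_{n-1}\vdash s=t[x_1/y_1,\dots,x_{n-1}/y_{n-1}]:S_n$ is derived. $\{s\}\text{-}\mathbf{GAT}$ has $\{s\}$-GATs as objects and, as morphisms, interpretations modulo: $\phi\sim\phi'$ iff $\phi(\mathcal J)\equiv\phi'(\mathcal J)$ for each derived type or term judgement $\mathcal J$. \textbf{Type-and-term structures and the monad.} $[a,b]=\{a,\dots,b\}\subset\mathbb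 N$ and $[n]=[1,n]$. $\mathcal H$ is the category freely generated by the graph with objects $n$ and $n_t$ ($n\ge1$) and arrows $n\to n+1$ and $n\to n_t$. For $X\in[\mathcal H^{\mathrm{op}},\mathbf{Set}]$ the maps $X(n+1)\to X(n)$, $X(n_t)\to X(n)$ are written $\partial$; elements of $X(n)$ are type-elements, elements of $X(n_t)$ term-elements; for $A\in X(n)$, $\mathrm{Tm}_X(A)=\{a\in X(n_t):\partial a=A\}$. The forgetful functor $V\colon\{s\}\text{-}\mathbf{GAT}\to[\mathcal H^{\mathrm{op}},\mathbf{Set}]$ has $V\mathbb T(n)$ (resp. $V\mathbb T(n_t)$) the set of derived type (resp. term) judgements of degree $n$ modulo $\equiv$, boundaries induced by $\partial$, and $V\phi([\mathcal J])=[\phi(\mathcal J)]$. Its left adjoint $G$ sends $X$ to the free $\{s\}$-GAT $GX$ whose type- and term-constants are the type- and term-elements of $X$ and whose basic judgements are $\mathcal J_A=(x_1:A_1,x_2:A_2(x_1),\dots,x_{n-1}:A_{n-1}(x_1,\dots,x_{n-2})\vdash A(x_1,\dots,x_{n-1})\ \mathsf{type})$ for $A\in X(n)$, where $A_i=\partial^{n-i}A$, and, in the same context, $\mathcal J_a=(\dots\vdash a(x_1,\dots,x_{n-1}):A(x_1,\dots,x_{n-1}))$ for $a\in\mathrm{Tm}_X(A)$. The adjunction unit is $A\mapsto[\mathcal J_A]$, $a\mapsto[\mathcal J_a]$; the counit $\epsilon_{\mathbb T}\colon GV\mathbb T\to\mathbb T$ is given on basic judgements by $\mathcal J_{[\mathcal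 J]}\mapsto\mathcal J$. The monad is $S=VG$ with multiplication $\mu^S=V\epsilon G$. \textbf{Inc-lists and description of $SX$.} An inc-list of length $n$ is a strictly increasing function $\alpha\colon[0,n]\to\mathbb N$ with $\alpha(0)=0$; $\mathrm{Inc}(n)$ is the set of these. For $\alpha\in\mathrm{Inc}(n+1)$, $\partial\alpha\in\mathrm{Inc}(n)$ is its restriction to $[0,n]$. The presheaf $[\alpha]$ has $[\alpha](i)=\{i\}$ if $i\le\alpha(n)$ and $\emptyset$ otherwise, $[\alpha](i_t)=\{i_t\}$ if $i\le\alpha(n)$ and $i\notin\mathrm{Im}\,\alpha$ and $\emptyset$ otherwise, with the unique possible boundary maps. For $h\colon[\alpha]\to X$, $\partial h$ is its restriction to $[\partial\alpha]$. One has $SX(n)=\sum_{\alpha\in\mathrm{Inc}(n)}[\mathcal H^{\mathrm{op}},\mathbf{Set}]([\alpha],X)$, $\partial(\alpha,h)=(\partial\alpha,\partial h)$, $\mathrm{Tm}_{SX}(\alpha,h)=\mathrm{Tm}_X(h(\alpha(n)))$, under the following identification. Define $e_j$ recursively for $1\le j\le\alpha(n)$ by $e_j=x_m$ if $j=\alpha(m)$ and $e_j=h(j_t)(e_1,\dots,e_{j-1})$ if $j\notin\mathrm{Im}\,\alpha$; then $(\alpha,h)$ is the class of $x_1:T_1,\dots,x_{n-1}:T_{n-1}\vdash T_n\ \mathsf{type}$ with $T_i=h(\alpha(i))(e_1,\dots,e_{\alpha(i)-1})$, and $a\in\mathrm{Tm}_X(h(\alpha(n)))$ is the class of $x_1:T_1,\dots,x_{n-1}:T_{n-1}\vdash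 a(e_1,\dots,e_{\alpha(n)-1}):T_n$. \textbf{Elements of $S^2X$.} A type-element of $S^2X(n)$ is written $(\alpha,(\beta,h,k))$, where $\alpha\in\mathrm{Inc}(n)$ and the map $[\alpha]\to SX$ is determined by its value $(\beta\in\mathrm{Inc}(\alpha(n)),\,h\colon[\beta]\to X)\in SX(\alpha(n))$ at $\alpha(n)$ and its values $k(i)\in\mathrm{Tm}_{SX}(\partial^{\alpha(n)-i}(\beta,h))=\mathrm{Tm}_X(h(\beta(i)))$ at $i_t$ for $i\in[\alpha(n)]\setminus\mathrm{Im}\,\alpha$. One has $\mathrm{Tm}_{S^2X}(\alpha,(\beta,h,k))=\mathrm{Tm}_{SX}(\beta,h)=\mathrm{Tm}_X(h(\beta(\alpha(n))))$. The inc-list $\beta\alpha\in\mathrm{Inc}(n)$ is $(\beta\alpha)(i)=\beta(\alpha(i))$, and $h\cup k\colon[\beta\alpha]\to X$ is given by $(h\cup k)(i)=h(i)$ for $i\in[\beta\alpha(n)]$ and, for $i\in[\beta\alpha(n)]\setminus\mathrm{Im}\,\beta\alpha$, $(h\cup k)(i_t)=h(i_t)$ if $i\notin\mathrm{Im}\,\beta$ and $(h\cup k)(i_t)=k(j)$ if $i=\beta(j)$ with $j\notin\mathrm{Im}\,\alpha$. *)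

theory Defs
  imports "HOL-Library.FuncSet"
begin

section \<open>Expressions and judgements\<close>

text \<open>The denumerable set of variables is \<^typ>\<open>nat\<close>; the standard variables
  \<open>x\<^sub>1, x\<^sub>2, \<dots>\<close> are the numbers \<open>1, 2, \<dots>\<close>.\<close>

type_synonym var = nat

datatype (consts_exp: 'c) exp = Var var | App 'c "'c exp list"

primrec subst :: "(var \<Rightarrow> 'c exp) \<Rightarrow> 'c exp \<Rightarrow> 'c exp" where
  "subst \<rho> (Var x) = \<rho> x"
| "subst \<rho> (App w es) = App w (map (subst \<rho>) es)"

type_synonym 'c ctx = "(var \<times> 'c exp) list"

text \<open>\<open>HasType t T\<close> is \<open>t : T\<close> and \<open>TermEq t t' T\<close> is \<open>t = t' : T\<close>.\<close>

datatype (consts_rhs: 'c) rhs =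
  IsType "'c exp"
| HasType "'c exp" "'c exp"
| TypeEq "'c exp" "'c exp"
| TermEq "'c exp" "'c exp" "'c exp"

type_synonym 'c judg = "'c ctx \<times> 'c rhs"

definition judg_over :: "'c set \<Rightarrow> 'c judg \<Rightarrow> bool" where
  "judg_over \<Xi> J \<longleftrightarrow> distinct (map fst (fst J))
     \<and> (\<forall>(x, T) \<in> set (fst J). consts_exp T \<subseteq> \<Xi>) \<and> consts_rhs (snd J) \<subseteq> \<Xi>"

definition degree :: "'c judg \<Rightarrow> nat" where
  "degree J = Suc (length (fst J))"

datatype kind = TypeKind | TermKind | TypeEqKind | TermEqKind

fun kind_of :: "'c judg \<Rightarrow> kind" where
  "kind_of (\<Gamma>, IsType T) = TypeKind"
| "kind_of (\<Gamma>, HasType t T) = TermKind"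
| "kind_of (\<Gamma>, TypeEq T T') = TypeEqKind"
| "kind_of (\<Gamma>, TermEq t t' T) = TermEqKind"

fun boundary :: "'c judg \<Rightarrow> 'c judg list" where
  "boundary (\<Gamma>, IsType T) =
     (if \<Gamma> = [] then [] else [(butlast \<Gamma>, IsType (snd (last \<Gamma>)))])"
| "boundary (\<Gamma>, HasType t T) = [(\<Gamma>, IsType T)]"
| "boundary (\<Gamma>, TypeEq T T') = [(\<Gamma>, IsType T), (\<Gamma>, IsType T')]"
| "boundary (\<Gamma>, TermEq t t' T) = [(\<Gamma>, HasType t T), (\<Gamma>, HasType t' T)]"

definition subst_ctx :: "(var \<Rightarrow> 'c exp) \<Rightarrow> 'c ctx \<Rightarrow> 'c ctx" where
  "subst_ctx \<rho> \<Gamma> = map (\<lambda>(x, T). (x, subst \<rho> T)) \<Gamma>"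

primrec subst_rhs :: "(var \<Rightarrow> 'c exp) \<Rightarrow> 'c rhs \<Rightarrow> 'c rhs" where
  "subst_rhs \<rho> (IsType T) = IsType (subst \<rho> T)"
| "subst_rhs \<rho> (HasType t T) = HasType (subst \<rho> t) (subst \<rho> T)"
| "subst_rhs \<rho> (TypeEq T T') = TypeEq (subst \<rho> T) (subst \<rho> T')"
| "subst_rhs \<rho> (TermEq t t' T) = TermEq (subst \<rho> t) (subst \<rho> t') (subst \<rho> T)"

definition single :: "'c exp \<Rightarrow> var \<Rightarrow> var \<Rightarrow> 'c exp" where
  "single t y = Var(y := t)"

definition permute :: "(var \<Rightarrow> var) \<Rightarrow> 'c judg \<Rightarrow> 'c judg" where
  "permute \<sigma> J =
     (map (\<lambda>(x, T). (\<sigma> x, subst (Var \<circ> \<sigma>) T)) (fst J), subst_rhs (Var \<circ> \<sigma>) (snd J))"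


section \<open>Deduction rules and derived judgements\<close>

datatype rule_name =
  TmRefl | TmSym | TmTrans | TyRefl | TySym | TyTrans | TmConv | TmEqConv
| Perm "var \<Rightarrow> var" | Subst | SubstTyEq | SubstTmEq

text \<open>\<open>rule r Js J\<close> is the graph of the partial function \<open>r\<close> on lists of judgements:
  \<open>J\<close> is determined by \<open>r\<close> and \<open>Js\<close>.\<close>

inductive rule :: "rule_name \<Rightarrow> 'c judg list \<Rightarrow> 'c judg \<Rightarrow> bool" where
  "rule TmRefl [(\<Gamma>, HasType t T)] (\<Gamma>, TermEq t t T)"
| "rule TmSym [(\<Gamma>, TermEq t1 t2 T)] (\<Gamma>, TermEq t2 t1 T)"
| "rule TmTrans [(\<Gamma>, TermEq t1 t2 T), (\<Gamma>, TermEq t2 t3 T)] (\<Gamma>, TermEq t1 t3 T)"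
| "rule TyRefl [(\<Gamma>, IsType T)] (\<Gamma>, TypeEq T T)"
| "rule TySym [(\<Gamma>, TypeEq T1 T2)] (\<Gamma>, TypeEq T2 T1)"
| "rule TyTrans [(\<Gamma>, TypeEq T1 T2), (\<Gamma>, TypeEq T2 T3)] (\<Gamma>, TypeEq T1 T3)"
| "rule TmConv [(\<Gamma>, TypeEq T1 T2), (\<Gamma>, HasType t T1)] (\<Gamma>, HasType t T2)"
| "rule TmEqConv [(\<Gamma>, TypeEq T1 T2), (\<Gamma>, TermEq t1 t2 T1)] (\<Gamma>, TermEq t1 t2 T2)"
| "bij \<sigma> \<Longrightarrow> rule (Perm \<sigma>) [J] (permute \<sigma> J)"
| "rule Subst [(\<Gamma>, HasType t T), (\<Gamma> @ (y, T) # \<Delta>, R)]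
     (\<Gamma> @ subst_ctx (single t y) \<Delta>, subst_rhs (single t y) R)"
| "rule SubstTyEq [(\<Gamma>, TermEq t1 t2 T), (\<Gamma> @ (y, T) # \<Delta>, IsType T')]
     (\<Gamma> @ subst_ctx (single t2 y) \<Delta>,
      TypeEq (subst (single t1 y) T') (subst (single t2 y) T'))"
| "rule SubstTmEq [(\<Gamma>, TermEq t1 t2 T), (\<Gamma> @ (y, T) # \<Delta>, HasType t' T')]
     (\<Gamma> @ subst_ctx (single t2 y) \<Delta>,
      TermEq (subst (single t1 y) t') (subst (single t2 y) t') (subst (single t2 y) T'))"

inductive_set derivable :: "'c judg set \<Rightarrow> 'c judg set" for \<Lambda> :: "'c judg set" where
  basic: "J \<in> \<Lambda> \<Longrightarrow> \<forall>K \<in> set (boundary J). K \<in> derivable \<Lambda> \<Longrightarrow> J \<in> derivable \<Lambda>"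
| deduce: "\<forall>K \<in> set Js. K \<in> derivable \<Lambda> \<Longrightarrow> rule r Js J \<Longrightarrow> J \<in> derivable \<Lambda>"


section \<open>\<open>{s}\<close>-GATs and interpretations\<close>

record ('o, 's) gat =
  type_consts :: "'o set"
  term_consts :: "'s set"
  basic_judgs :: "('o + 's) judg set"

abbreviation derived :: "('o, 's) gat \<Rightarrow> ('o + 's) judg set" where
  "derived T \<equiv> derivable (basic_judgs T)"

definition introduces_type :: "'o \<Rightarrow> ('o + 's) judg \<Rightarrow> bool" where
  "introduces_type A J \<longleftrightarrow> (\<exists>\<Gamma>. J = (\<Gamma>, IsType (App (Inl A) (map (Var \<circ> fst) \<Gamma>))))"

definition introduces_term :: "'s \<Rightarrow> ('o + 's) judg \<Rightarrow> bool" where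
  "introduces_term f J \<longleftrightarrow> (\<exists>\<Gamma> T. J = (\<Gamma>, HasType (App (Inr f) (map (Var \<circ> fst) \<Gamma>)) T))"

definition is_gat :: "('o, 's) gat \<Rightarrow> bool" where
  "is_gat T \<longleftrightarrow>
     (\<forall>J \<in> basic_judgs T. judg_over (type_consts T <+> term_consts T) J)
   \<and> (\<forall>A \<in> type_consts T. \<exists>!J. J \<in> basic_judgs T \<and> introduces_type A J)
   \<and> (\<forall>f \<in> term_consts T. \<exists>!J. J \<in> basic_judgs T \<and> introduces_term f J)
   \<and> (\<forall>J \<in> basic_judgs T.
        (\<exists>A \<in> type_consts T. introduces_type A J) \<or> (\<exists>f \<in> term_consts T. introduces_term f J)
        \<or> kind_of J \<in> {TypeEqKind, TermEqKind})
   \<and> basic_judgs T \<subseteq> derived T"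

definition is_interp ::
    "('o, 's) gat \<Rightarrow> ('p, 'q) gat \<Rightarrow> (('o + 's) judg \<Rightarrow> ('p + 'q) judg) \<Rightarrow> bool" where
  "is_interp T U \<phi> \<longleftrightarrow> is_gat T \<and> is_gat U
   \<and> (\<forall>J \<in> derived T. \<phi> J \<in> derived U \<and> kind_of (\<phi> J) = kind_of J
                      \<and> boundary (\<phi> J) = map \<phi> (boundary J))
   \<and> (\<forall>r Js J K. set Js \<subseteq> derived T \<longrightarrow> rule r Js J \<longrightarrow> rule r (map \<phi> Js) K \<longrightarrow> \<phi> J = K)"

text \<open>\<open>rename \<Gamma> \<Delta> e\<close> is \<open>e[x\<^sub>1/y\<^sub>1, \<dots>, x\<^sub>k/y\<^sub>k]\<close>, where the \<open>x\<^sub>i\<close> are the variables of \<open>\<Gamma>\<close> and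
  the \<open>y\<^sub>i\<close> those of \<open>\<Delta>\<close>.\<close>

definition rename :: "'c ctx \<Rightarrow> 'c ctx \<Rightarrow> 'c exp \<Rightarrow> 'c exp" where
  "rename \<Gamma> \<Delta> = subst (\<lambda>v. case map_of (zip (map fst \<Delta>) (map fst \<Gamma>)) v of
                                None \<Rightarrow> Var v | Some x \<Rightarrow> Var x)"

definition type_equiv ::
    "('o, 's) gat \<Rightarrow> ('o + 's) ctx \<Rightarrow> ('o + 's) exp \<Rightarrow> ('o + 's) ctx \<Rightarrow> ('o + 's) exp \<Rightarrow> bool" where
  "type_equiv U \<Gamma> S \<Delta> T \<longleftrightarrow> length \<Gamma> = length \<Delta> \<and>
     (\<forall>i \<le> length \<Gamma>.
        (take i \<Gamma>, TypeEq ((map snd \<Gamma> @ [S]) ! i)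
                          (rename (take i \<Gamma>) (take i \<Delta>) ((map snd \<Delta> @ [T]) ! i))) \<in> derived U)"

fun judg_equiv :: "('o, 's) gat \<Rightarrow> ('o + 's) judg \<Rightarrow> ('o + 's) judg \<Rightarrow> bool" where
  "judg_equiv U (\<Gamma>, IsType S) (\<Delta>, IsType T) \<longleftrightarrow> type_equiv U \<Gamma> S \<Delta> T"
| "judg_equiv U (\<Gamma>, HasType s S) (\<Delta>, HasType t T) \<longleftrightarrow>
     type_equiv U \<Gamma> S \<Delta> T \<and> (\<Gamma>, TermEq s (rename \<Gamma> \<Delta> t) S) \<in> derived U"
| "judg_equiv U _ _ \<longleftrightarrow> False"

definition judg_class :: "('o, 's) gat \<Rightarrow> ('o + 's) judg \<Rightarrow> ('o + 's) judg set" where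
  "judg_class T J = {K \<in> derived T. judg_equiv T J K}"


section \<open>Type-and-term structures\<close>

text \<open>A presheaf \<open>X\<close> on \<open>\<H>\<close>: \<open>ty_el X n\<close> is \<open>X(n)\<close>, \<open>tm_el X n\<close> is \<open>X(n\<^sub>t)\<close>,
  \<open>bd_ty X n\<close> is \<open>X(n+1) \<rightarrow> X(n)\<close> and \<open>bd_tm X n\<close> is \<open>X(n\<^sub>t) \<rightarrow> X(n)\<close>, for \<open>n \<ge> 1\<close>.
  The unused index \<open>0\<close> carries empty sets. As \<open>\<H>\<close> is free on a graph there are no further
  conditions.\<close>

record ('a, 'b) psh =
  ty_el :: "nat \<Rightarrow> 'a set"
  tm_el :: "nat \<Rightarrow> 'b set"
  bd_ty :: "nat \<Rightarrow> 'a \<Rightarrow> 'a"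
  bd_tm :: "nat \<Rightarrow> 'b \<Rightarrow> 'a"

definition is_psh :: "('a, 'b) psh \<Rightarrow> bool" where
  "is_psh X \<longleftrightarrow> ty_el X 0 = {} \<and> tm_el X 0 = {}
   \<and> (\<forall>n \<ge> 1. \<forall>A \<in> ty_el X (Suc n). bd_ty X n A \<in> ty_el X n)
   \<and> (\<forall>n \<ge> 1. \<forall>a \<in> tm_el X n. bd_tm X n a \<in> ty_el X n)"

definition Tm :: "('a, 'b) psh \<Rightarrow> nat \<Rightarrow> 'a \<Rightarrow> 'b set" where
  "Tm X n A = {a \<in> tm_el X n. bd_tm X n a = A}"

record ('a, 'b, 'c, 'd) psh_mor =
  at_ty :: "nat \<Rightarrow> 'a \<Rightarrow> 'c"
  at_tm :: "nat \<Rightarrow> 'b \<Rightarrow> 'd"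

definition psh_hom :: "('a, 'b) psh \<Rightarrow> ('c, 'd) psh \<Rightarrow> ('a, 'b, 'c, 'd) psh_mor set" where
  "psh_hom X Y = {f.
     (\<forall>n. at_ty f n \<in> ty_el X n \<rightarrow>\<^sub>E ty_el Y n) \<and> (\<forall>n. at_tm f n \<in> tm_el X n \<rightarrow>\<^sub>E tm_el Y n)
   \<and> (\<forall>n \<ge> 1. \<forall>A \<in> ty_el X (Suc n). at_ty f n (bd_ty X n A) = bd_ty Y n (at_ty f (Suc n) A))
   \<and> (\<forall>n \<ge> 1. \<forall>a \<in> tm_el X n. at_ty f n (bd_tm X n a) = bd_tm Y n (at_tm f n a))}"

definition psh_restrict ::
    "('a, 'b, 'c, 'd) psh_mor \<Rightarrow> ('a, 'b) psh \<Rightarrow> ('a, 'b, 'c, 'd) psh_mor" where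
  "psh_restrict f P = \<lparr>at_ty = \<lambda>n. restrict (at_ty f n) (ty_el P n),
                       at_tm = \<lambda>n. restrict (at_tm f n) (tm_el P n)\<rparr>"

definition psh_comp :: "('a, 'b) psh \<Rightarrow> ('c, 'd, 'e, 'f) psh_mor \<Rightarrow> ('a, 'b, 'c, 'd) psh_mor
    \<Rightarrow> ('a, 'b, 'e, 'f) psh_mor" where
  "psh_comp P g f = psh_restrict \<lparr>at_ty = \<lambda>n. at_ty g n \<circ> at_ty f n,
                                  at_tm = \<lambda>n. at_tm g n \<circ> at_tm f n\<rparr> P"


section \<open>The free-forgetful adjunction and the monad \<open>S\<close>\<close>

definition class_map ::
    "('p, 'q) gat \<Rightarrow> (('o + 's) judg \<Rightarrow> ('p + 'q) judg) \<Rightarrow> ('o + 's) judg set \<Rightarrow> ('p + 'q) judg set" where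
  "class_map U f c = the_elem ((\<lambda>J. judg_class U (f J)) ` c)"

definition V :: "('o, 's) gat \<Rightarrow> (('o + 's) judg set, ('o + 's) judg set) psh" where
  "V T = \<lparr>ty_el = \<lambda>n. judg_class T ` {J \<in> derived T. kind_of J = TypeKind \<and> degree J = n},
          tm_el = \<lambda>n. judg_class T ` {J \<in> derived T. kind_of J = TermKind \<and> degree J = n},
          bd_ty = \<lambda>n. class_map T (\<lambda>J. hd (boundary J)),
          bd_tm = \<lambda>n. class_map T (\<lambda>J. hd (boundary J))\<rparr>"

definition V_map :: "('o, 's) gat \<Rightarrow> ('p, 'q) gat \<Rightarrow> (('o + 's) judg \<Rightarrow> ('p + 'q) judg) \<Rightarrow>
    (('o + 's) judg set, ('o + 's) judg set, ('p + 'q) judg set, ('p + 'q) judg set) psh_mor" where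
  "V_map T U \<phi> = psh_restrict \<lparr>at_ty = \<lambda>n. class_map U \<phi>, at_tm = \<lambda>n. class_map U \<phi>\<rparr> (V T)"

text \<open>For \<open>A \<in> X(n)\<close> and \<open>i \<le> n\<close>, \<open>iter_bd X n i A\<close> is \<open>\<partial>\<^bsup>n-i\<^esup>A \<in> X(i)\<close>.\<close>

primrec iter_bd :: "('a, 'b) psh \<Rightarrow> nat \<Rightarrow> nat \<Rightarrow> 'a \<Rightarrow> 'a" where
  "iter_bd X 0 i A = A"
| "iter_bd X (Suc n) i A = (if Suc n \<le> i then A else iter_bd X n i (bd_ty X n A))"

text \<open>The constants of the free GAT are tagged with their degree, since the sets \<open>X(n)\<close>
  for different \<open>n\<close> need not be disjoint.\<close>

type_synonym ('a, 'b) free_const = "(nat \<times> 'a) + (nat \<times> 'b)"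

definition gen_app :: "nat \<Rightarrow> 'a \<Rightarrow> ('a, 'b) free_const exp" where
  "gen_app n A = App (Inl (n, A)) (map Var [1..<n])"

definition gen_ctx :: "('a, 'b) psh \<Rightarrow> nat \<Rightarrow> 'a \<Rightarrow> ('a, 'b) free_const ctx" where
  "gen_ctx X n A = map (\<lambda>i. (i, gen_app i (iter_bd X n i A))) [1..<n]"

definition ty_judg :: "('a, 'b) psh \<Rightarrow> nat \<Rightarrow> 'a \<Rightarrow> ('a, 'b) free_const judg" where
  "ty_judg X n A = (gen_ctx X n A, IsType (gen_app n A))"

definition tm_judg :: "('a, 'b) psh \<Rightarrow> nat \<Rightarrow> 'b \<Rightarrow> ('a, 'b) free_const judg" where
  "tm_judg X n a = (gen_ctx X n (bd_tm X n a),
     HasType (App (Inr (n, a)) (map Var [1..<n])) (gen_app n (bd_tm X n a)))"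

definition G :: "('a, 'b) psh \<Rightarrow> (nat \<times> 'a, nat \<times> 'b) gat" where
  "G X = \<lparr>type_consts = {(n, A). A \<in> ty_el X n},
          term_consts = {(n, a). a \<in> tm_el X n},
          basic_judgs = {ty_judg X n A | n A. A \<in> ty_el X n} \<union> {tm_judg X n a | n a. a \<in> tm_el X n}\<rparr>"

text \<open>An interpretation representing the counit \<open>GVT \<rightarrow> T\<close>: the generator \<open>\<J>\<^bsub>c\<^esub>\<close> of a class
  \<open>c\<close> goes to a member of \<open>c\<close>. Morphisms of GATs are interpretations up to equivalence of values on
  type and term judgements, and by the adjunction this condition determines the morphism, so
  the choice of representative is immaterial after applying \<open>V\<close>.\<close>

definition is_counit :: "('o, 's) gat \<Rightarrow>
    ((('o + 's) judg set, ('o + 's) judg set) free_const judg \<Rightarrow> ('o + 's) judg) \<Rightarrow> bool" where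
  "is_counit T \<epsilon> \<longleftrightarrow> is_interp (G (V T)) T \<epsilon>
   \<and> (\<forall>n. \<forall>c \<in> ty_el (V T) n. \<epsilon> (ty_judg (V T) n c) \<in> c)
   \<and> (\<forall>n. \<forall>c \<in> tm_el (V T) n. \<epsilon> (tm_judg (V T) n c) \<in> c)"

definition counit :: "('o, 's) gat \<Rightarrow>
    (('o + 's) judg set, ('o + 's) judg set) free_const judg \<Rightarrow> ('o + 's) judg" where
  "counit T = (SOME \<epsilon>. is_counit T \<epsilon>)"

type_synonym ('a, 'b) S_el = "('a, 'b) free_const judg set"

definition S :: "('a, 'b) psh \<Rightarrow> (('a, 'b) S_el, ('a, 'b) S_el) psh" where
  "S X = V (G X)"

definition mu :: "('a, 'b) psh \<Rightarrow> ((('a, 'b) S_el, ('a, 'b) S_el) S_el,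
    (('a, 'b) S_el, ('a, 'b) S_el) S_el, ('a, 'b) S_el, ('a, 'b) S_el) psh_mor" where
  "mu X = V_map (G (V (G X))) (G X) (counit (G X))"


section \<open>Inc-lists\<close>

text \<open>Functions on \<open>[0,n]\<close> are made extensional, so that equality in \<open>Inc n\<close> is equality of
  inc-lists.\<close>

definition Inc :: "nat \<Rightarrow> (nat \<Rightarrow> nat) set" where
  "Inc n = {\<alpha> \<in> extensional {0..n}. \<alpha> 0 = 0 \<and> strict_mono_on {0..n} \<alpha>}"

definition inc_comp :: "nat \<Rightarrow> (nat \<Rightarrow> nat) \<Rightarrow> (nat \<Rightarrow> nat) \<Rightarrow> nat \<Rightarrow> nat" where
  "inc_comp n \<beta> \<alpha> = (\<lambda>i \<in> {0..n}. \<beta> (\<alpha> i))"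

text \<open>The presheaf \<open>[\<alpha>]\<close> for \<open>\<alpha> \<in> Inc n\<close>; both of its possible elements at index \<open>i\<close> are written
  \<open>i\<close>. Hence for \<open>h : [\<alpha>] \<rightarrow> X\<close> the value \<open>h(i)\<close> is \<open>at_ty h i i\<close> and \<open>h(i\<^sub>t)\<close> is \<open>at_tm h i i\<close>.\<close>

definition inc_psh :: "nat \<Rightarrow> (nat \<Rightarrow> nat) \<Rightarrow> (nat, nat) psh" where
  "inc_psh n \<alpha> = \<lparr>ty_el = \<lambda>i. if 1 \<le> i \<and> i \<le> \<alpha> n then {i} else {},
                  tm_el = \<lambda>i. if 1 \<le> i \<and> i \<le> \<alpha> n \<and> i \<notin> \<alpha> ` {0..n} then {i} else {},
                  bd_ty = \<lambda>i _. i,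
                  bd_tm = \<lambda>i _. i\<rparr>"

type_synonym ('a, 'b) inc_ty = "(nat \<Rightarrow> nat) \<times> (nat, nat, 'a, 'b) psh_mor"

text \<open>The description of \<open>SX\<close> by inc-lists. The term-elements are the pairs of a type-element
  \<open>(\<alpha>, h)\<close> and an element of its fibre \<open>Tm\<^sub>X(h(\<alpha>(n)))\<close>.\<close>

definition inc_S :: "('a, 'b) psh \<Rightarrow> (('a, 'b) inc_ty, ('a, 'b) inc_ty \<times> 'b) psh" where
  "inc_S X = \<lparr>
     ty_el = \<lambda>n. {(\<alpha>, h). 1 \<le> n \<and> \<alpha> \<in> Inc n \<and> h \<in> psh_hom (inc_psh n \<alpha>) X},
     tm_el = \<lambda>n. {((\<alpha>, h), a). 1 \<le> n \<and> \<alpha> \<in> Inc n \<and> h \<in> psh_hom (inc_psh n \<alpha>) X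
                                 \<and> a \<in> Tm X (\<alpha> n) (at_ty h (\<alpha> n) (\<alpha> n))},
     bd_ty = \<lambda>n (\<alpha>, h). (restrict \<alpha> {0..n}, psh_restrict h (inc_psh n (restrict \<alpha> {0..n}))),
     bd_tm = \<lambda>n. fst\<rparr>"

definition inc_S_map :: "('a, 'b) psh \<Rightarrow> ('a, 'b, 'c, 'd) psh_mor \<Rightarrow>
    (('a, 'b) inc_ty, ('a, 'b) inc_ty \<times> 'b, ('c, 'd) inc_ty, ('c, 'd) inc_ty \<times> 'd) psh_mor" where
  "inc_S_map X f = psh_restrict \<lparr>
     at_ty = \<lambda>n (\<alpha>, h). (\<alpha>, psh_comp (inc_psh n \<alpha>) f h),
     at_tm = \<lambda>n ((\<alpha>, h), a). ((\<alpha>, psh_comp (inc_psh n \<alpha>) f h), at_tm f (\<alpha> n) a)\<rparr> (inc_S X)"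

fun inc_exp :: "nat \<Rightarrow> (nat \<Rightarrow> nat) \<Rightarrow> (nat, nat, 'a, 'b) psh_mor \<Rightarrow> nat
    \<Rightarrow> ('a, 'b) free_const exp" where
  "inc_exp n \<alpha> h j =
     (if j \<in> \<alpha> ` {0..n} then Var (inv_into {0..n} \<alpha> j)
      else App (Inr (j, at_tm h j j)) (map (\<lambda>i. inc_exp n \<alpha> h i) [1..<j]))"

declare inc_exp.simps [simp del]

definition inc_type :: "nat \<Rightarrow> (nat \<Rightarrow> nat) \<Rightarrow> (nat, nat, 'a, 'b) psh_mor \<Rightarrow> nat
    \<Rightarrow> ('a, 'b) free_const exp" where
  "inc_type n \<alpha> h i = App (Inl (\<alpha> i, at_ty h (\<alpha> i) (\<alpha> i))) (map (inc_exp n \<alpha> h) [1..<\<alpha> i])"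

definition inc_ctx :: "nat \<Rightarrow> (nat \<Rightarrow> nat) \<Rightarrow> (nat, nat, 'a, 'b) psh_mor
    \<Rightarrow> ('a, 'b) free_const ctx" where
  "inc_ctx n \<alpha> h = map (\<lambda>i. (i, inc_type n \<alpha> h i)) [1..<n]"

text \<open>The identification of the inc-list description with \<open>SX = VGX\<close>.\<close>

definition ident :: "('a, 'b) psh \<Rightarrow>
    (('a, 'b) inc_ty, ('a, 'b) inc_ty \<times> 'b, ('a, 'b) S_el, ('a, 'b) S_el) psh_mor" where
  "ident X = psh_restrict \<lparr>
     at_ty = \<lambda>n (\<alpha>, h). judg_class (G X) (inc_ctx n \<alpha> h, IsType (inc_type n \<alpha> h n)),
     at_tm = \<lambda>n ((\<alpha>, h), a). judg_class (G X) (inc_ctx n \<alpha> h,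
       HasType (App (Inr (\<alpha> n, a)) (map (inc_exp n \<alpha> h) [1..<\<alpha> n])) (inc_type n \<alpha> h n))\<rparr> (inc_S X)"

text \<open>The induced identification of the iterated description with \<open>S\<^sup>2X = VGVGX\<close>: an element
  \<open>(\<alpha>, [\<alpha>] \<rightarrow> SX)\<close> is rewritten along \<^term>\<open>ident X\<close> in its second component and then \<^term>\<open>ident (S X)\<close>
  is applied.\<close>

definition ident2 :: "('a, 'b) psh \<Rightarrow>
    ((('a, 'b) inc_ty, ('a, 'b) inc_ty \<times> 'b) inc_ty,
     (('a, 'b) inc_ty, ('a, 'b) inc_ty \<times> 'b) inc_ty \<times> (('a, 'b) inc_ty \<times> 'b),
     (('a, 'b) S_el, ('a, 'b) S_el) S_el, (('a, 'b) S_el, ('a, 'b) S_el) S_el) psh_mor" where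
  "ident2 X = psh_comp (inc_S (inc_S X)) (ident (S X)) (inc_S_map (inc_S X) (ident X))"

text \<open>\<open>h \<union> k : [\<beta>\<alpha>] \<rightarrow> X\<close> for \<open>\<alpha> \<in> Inc n\<close> and \<open>\<beta> \<in> Inc (\<alpha> n)\<close>.\<close>

definition glue :: "nat \<Rightarrow> (nat \<Rightarrow> nat) \<Rightarrow> (nat \<Rightarrow> nat) \<Rightarrow> (nat, nat, 'a, 'b) psh_mor \<Rightarrow> (nat \<Rightarrow> 'b)
    \<Rightarrow> (nat, nat, 'a, 'b) psh_mor" where
  "glue n \<alpha> \<beta> h k = psh_restrict \<lparr>
     at_ty = \<lambda>i. at_ty h i,
     at_tm = \<lambda>i _. if i \<notin> \<beta> ` {0..\<alpha> n} then at_tm h i i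
                   else k (inv_into {0..\<alpha> n} \<beta> i)\<rparr> (inc_psh n (inc_comp n \<beta> \<alpha>))"

end

theory Submission
  imports Defs "HOL-Combinatorics.Transposition"
begin

text \<open>
  \<^bold>\<open>Classes are renaming classes.\<close> The free GAT \<open>GX\<close> has no equality axioms, and a rule whose
  conclusion is an equation yields a reflexivity as soon as its premises are reflexivities. So every
  derivable equation of \<open>GX\<close> is trivial, conversion does nothing, and the type and term judgements
  are generated by \<open>\<J>\<^sub>A\<close> and \<open>\<J>\<^sub>a\<close> under permutation of variables and substitution of a term
  (\<open>eqfree\<close>). Two of them are equivalent iff they differ by a renaming of the context variables, that
  is, iff they have the same normal form, obtained by writing each variable as its position in the
  context (\<open>nf\<close>, \<open>judg_class_eq\<close>).

  \<^bold>\<open>The counit is a translation.\<close> A constant of \<open>GVGX\<close> is a class \<open>c\<close> of judgements of \<open>GX\<close>, and the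
  expression on the right-hand side of the normal form of \<open>c\<close> has variables \<open>1, 2, \<dots>\<close>. Replacing each
  application of \<open>c\<close> by this expression, with the arguments substituted for the variables, defines a
  translation that commutes with substitution on the nose. It therefore preserves every rule, and it
  is a counit (\<open>is_counit_counit\<close>). The multiplication is defined by a chosen counit. All counits give
  the same map on classes: an interpretation commutes with permutation and substitution, and the
  normal form of a substituted judgement is computed from the normal forms of the two premises, so
  the values on generators determine all values up to renaming (\<open>interp_determined_by_generators\<close>).
  Hence \<open>\<mu>\<close> sends the class of a judgement to the class of its translation (\<open>mu_type\<close>, \<open>mu_term\<close>).

  \<^bold>\<open>The translation of an inc-list judgement.\<close> Let \<open>e\<^sub>j\<close>, \<open>f\<^sub>l\<close> and \<open>g\<^sub>l\<close> be the expressions recursively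
  attached to \<open>(\<alpha>, (\<beta>, h, k))\<close>, \<open>(\<beta>, h)\<close> and \<open>(\<beta>\<alpha>, h \<union> k)\<close>. The translation sends \<open>e\<^sub>j\<close> to the
  expression \<open>g\<close> with index \<open>\<beta>(j)\<close> (\<open>tr_body_inc_exp\<close>). If \<open>j = \<alpha>(m)\<close>, both are \<open>x\<^sub>m\<close>. Otherwise the head
  of \<open>e\<^sub>j\<close> is the class of \<open>k(j)\<close> applied to the \<open>f\<^sub>l\<close> with \<open>l < \<beta>(j)\<close>, and the translation replaces \<open>x\<^sub>i\<close> by
  the translation of \<open>e\<^sub>i\<close>, for \<open>i < j\<close>. Since \<open>f\<^sub>l = x\<^sub>i\<close> exactly when \<open>l = \<beta>(i)\<close>, this turns each \<open>f\<^sub>l\<close> into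
  \<open>g\<^sub>l\<close> (\<open>arg_subst_inc_exp\<close>), and \<open>k(j)\<close> applied to the \<open>g\<^sub>l\<close> is \<open>g\<close> at \<open>\<beta>(j)\<close> by the definition of
  \<open>h \<union> k\<close>. So the judgement of \<open>(\<alpha>, (\<beta>, h, k))\<close> translates literally to that of \<open>(\<beta>\<alpha>, h \<union> k)\<close>.
  For these judgements to represent classes they have to be derivable, which is shown by
  substituting the terms \<open>h(j\<^sub>t)\<close> one at a time into a generator (\<open>part_eqfree\<close>).
\<close>

section \<open>Substitution and free variables\<close>

primrec fv :: "'c exp \<Rightarrow> var set" where
  "fv (Var x) = {x}"
| "fv (App w es) = \<Union> (set (map fv es))"

primrec fv_rhs :: "'c rhs \<Rightarrow> var set" where
  "fv_rhs (IsType T) = fv T"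
| "fv_rhs (HasType t T) = fv t \<union> fv T"
| "fv_rhs (TypeEq T T') = fv T \<union> fv T'"
| "fv_rhs (TermEq t t' T) = fv t \<union> fv t' \<union> fv T"

lemma subst_cong: "(\<And>v. v \<in> fv e \<Longrightarrow> \<rho> v = \<tau> v) \<Longrightarrow> subst \<rho> e = subst \<tau> e"
  by (induction e) auto

lemma subst_subst: "subst \<rho> (subst \<tau> e) = subst (\<lambda>v. subst \<rho> (\<tau> v)) e"
  by (induction e) auto

lemma subst_ident: "(\<And>v. v \<in> fv e \<Longrightarrow> \<rho> v = Var v) \<Longrightarrow> subst \<rho> e = e"
  by (induction e) (auto intro: map_idI)

lemma fv_subst: "fv (subst \<rho> e) = (\<Union>v \<in> fv e. fv (\<rho> v))"
  by (induction e) auto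

lemma subst_rhs_cong: "(\<And>v. v \<in> fv_rhs R \<Longrightarrow> \<rho> v = \<tau> v) \<Longrightarrow> subst_rhs \<rho> R = subst_rhs \<tau> R"
  by (cases R) (auto intro!: subst_cong)

lemma subst_rhs_subst_rhs:
  "subst_rhs \<rho> (subst_rhs \<tau> R) = subst_rhs (\<lambda>v. subst \<rho> (\<tau> v)) R"
  by (cases R) (auto simp: subst_subst)

lemma fv_subst_rhs: "fv_rhs (subst_rhs \<rho> R) = (\<Union>v \<in> fv_rhs R. fv (\<rho> v))"
  by (cases R) (auto simp: fv_subst)

text \<open>The renaming rule acts by permutations of all variables, whereas renaming a context only prescribes
  the images of finitely many of them.\<close>

lemma finite_injection_extends_to_bij:
  assumes "finite A" "inj_on f A"
  shows "\<exists>\<sigma> :: 'a \<Rightarrow> 'a. bij \<sigma> \<and> (\<forall>x \<in> A. \<sigma> x = f x)"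
  using assms
proof (induction A rule: finite_induct)
  case empty
  then show ?case using bij_id by blast
next
  case (insert a A)
  then obtain \<sigma> where \<sigma>: "bij \<sigma>" "\<forall>x \<in> A. \<sigma> x = f x" by auto
  \<comment> \<open>Correcting \<open>\<sigma>\<close> at \<open>a\<close> does not disturb \<open>A\<close>, because \<open>\<sigma>\<close> sends no element of \<open>A\<close> to \<open>\<sigma> a\<close> or \<open>f a\<close>.\<close>
  let ?\<tau> = "transpose (\<sigma> a) (f a) \<circ> \<sigma>"
  have "bij ?\<tau>" using \<sigma>(1) by (simp add: bij_comp)
  moreover have "?\<tau> x = f x" if x: "x \<in> insert a A" for x
  proof (cases "x = a")
    case False
    then have "x \<in> A" using x by simp
    then have "\<sigma> x = f x" using \<sigma>(2) by simp
    moreover have "\<sigma> x \<noteq> \<sigma> a" using False bij_is_inj[OF \<sigma>(1)] by (simp add: inj_eq)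
    moreover have "f x \<noteq> f a" using \<open>x \<in> A\<close> False insert.prems by (auto simp: inj_on_def)
    ultimately show ?thesis by simp
  qed simp
  ultimately show ?case by blast
qed

section \<open>Iterated boundaries of generators\<close>

lemma iter_bd_iter_bd:
  "\<lbrakk>j \<le> i; i \<le> n\<rbrakk> \<Longrightarrow> iter_bd Y i j (iter_bd Y n i A) = iter_bd Y n j A"
proof (induction n arbitrary: A)
  case (Suc n)
  then show ?case by (cases "i = Suc n") auto
qed simp

lemma iter_bd_self [simp]: "iter_bd Y n n A = A"
  by (cases n) auto

lemma iter_bd_in:
  assumes "is_psh Y"
  shows "\<lbrakk>1 \<le> i; i \<le> n; A \<in> ty_el Y n\<rbrakk> \<Longrightarrow> iter_bd Y n i A \<in> ty_el Y i"
proof (induction n arbitrary: A)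
  case (Suc n)
  show ?case
  proof (cases "i = Suc n")
    case False
    then have "bd_ty Y n A \<in> ty_el Y n"
      using Suc.prems assms by (auto simp: is_psh_def)
    then show ?thesis using Suc False by simp
  qed (use Suc in simp)
qed simp

lemma bd_tm_in: "\<lbrakk>is_psh Y; a \<in> tm_el Y n\<rbrakk> \<Longrightarrow> bd_tm Y n a \<in> ty_el Y n"
  unfolding is_psh_def by (metis empty_iff less_one linorder_not_le)

lemma length_gen_ctx [simp]: "length (gen_ctx Y n A) = n - 1"
  by (simp add: gen_ctx_def)

lemma gen_ctx_nth:
  "i < n - 1 \<Longrightarrow> gen_ctx Y n A ! i = (Suc i, gen_app (Suc i) (iter_bd Y n (Suc i) A))"
  by (simp add: gen_ctx_def)

lemma gen_ctx_take:
  "i < n \<Longrightarrow> take i (gen_ctx Y n A) = gen_ctx Y (Suc i) (iter_bd Y n (Suc i) A)"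
  by (rule nth_equalityI) (auto simp: gen_ctx_nth iter_bd_iter_bd simp del: iter_bd.simps(2))

text \<open>Each prefix of the context of a generator is the context of another generator, which is how the
  boundaries of a generator are again derivable.\<close>

lemma gen_ctx_split:
  assumes "gen_ctx Y n A = \<Gamma> @ (x, T) # \<Delta>"
  defines "i \<equiv> Suc (length \<Gamma>)"
  shows "i < n" "(\<Gamma>, IsType T) = ty_judg Y i (iter_bd Y n i A)"
proof -
  have "length (gen_ctx Y n A) = length (\<Gamma> @ (x, T) # \<Delta>)" using assms by simp
  then show "i < n" by (simp add: i_def)
  then have "gen_ctx Y n A ! length \<Gamma> = (i, gen_app i (iter_bd Y n i A))"
    by (simp add: gen_ctx_nth i_def)
  moreover have "gen_ctx Y n A ! length \<Gamma> = (x, T)" using assms by simp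
  moreover have "take (length \<Gamma>) (gen_ctx Y n A) = \<Gamma>" using assms by simp
  ultimately show "(\<Gamma>, IsType T) = ty_judg Y i (iter_bd Y n i A)"
    using \<open>i < n\<close> by (simp add: ty_judg_def i_def gen_ctx_take[symmetric])
qed

section \<open>Equation-free derivations\<close>

text \<open>The type and term judgements of \<open>G Y\<close> that are derivable without passing through an equation. All
  type and term judgements turn out to be of this kind, and inductions over the three ways to form
  them are much shorter than inductions over all rules.\<close>

inductive_set eqfree :: "('a, 'b) psh \<Rightarrow> ('a, 'b) free_const judg set" for Y where
  ty: "A \<in> ty_el Y n \<Longrightarrow> ty_judg Y n A \<in> eqfree Y"
| tm: "a \<in> tm_el Y n \<Longrightarrow> tm_judg Y n a \<in> eqfree Y"
| perm: "bij \<sigma> \<Longrightarrow> J \<in> eqfree Y \<Longrightarrow> permute \<sigma> J \<in> eqfree Y"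
| subst: "\<lbrakk>(\<Gamma>, HasType t T) \<in> eqfree Y; (\<Gamma> @ (y, T) # \<Delta>, R) \<in> eqfree Y\<rbrakk>
    \<Longrightarrow> (\<Gamma> @ subst_ctx (single t y) \<Delta>, subst_rhs (single t y) R) \<in> eqfree Y"

lemma permute_simp:
  "permute \<sigma> (\<Gamma>, R) = (map (\<lambda>(x, T). (\<sigma> x, subst (Var \<circ> \<sigma>) T)) \<Gamma>, subst_rhs (Var \<circ> \<sigma>) R)"
  by (simp add: permute_def)

lemma eqfree_kind: "J \<in> eqfree Y \<Longrightarrow> (\<exists>T. snd J = IsType T) \<or> (\<exists>t T. snd J = HasType t T)"
  by (induction rule: eqfree.induct) (auto simp: ty_judg_def tm_judg_def permute_def)

text \<open>A substitution does not affect the context to the left of the substituted variable, and it acts on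
  every initial segment to its right separately. So the boundary of a type in the context stays
  derivable, and likewise the boundary of a term.\<close>

lemma eqfree_boundary_aux:
  assumes Y: "is_psh Y"
  shows "J \<in> eqfree Y \<Longrightarrow>
    (\<forall>\<Gamma> x T \<Delta>. fst J = \<Gamma> @ (x, T) # \<Delta> \<longrightarrow> (\<Gamma>, IsType T) \<in> eqfree Y)
    \<and> (\<forall>t T. snd J = HasType t T \<longrightarrow> (fst J, IsType T) \<in> eqfree Y)"
proof (induction rule: eqfree.induct)
  case (ty A n)
  then show ?case
    using gen_ctx_split[of Y n A] iter_bd_in[OF Y, of _ n A]
    by (fastforce simp: ty_judg_def[of Y n A] intro: eqfree.ty)
next
  case (tm a n)
  then have "bd_tm Y n a \<in> ty_el Y n" by (rule bd_tm_in[OF Y])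
  moreover from this have "(gen_ctx Y n (bd_tm Y n a), IsType (gen_app n (bd_tm Y n a))) \<in> eqfree Y"
    using eqfree.ty[of "bd_tm Y n a" Y n] by (simp add: ty_judg_def)
  ultimately show ?case
    using gen_ctx_split[of Y n "bd_tm Y n a"] iter_bd_in[OF Y, of _ n "bd_tm Y n a"]
    by (fastforce simp: tm_judg_def[of Y n a] intro: eqfree.ty)
next
  case (perm \<sigma> J)
  have "(\<Gamma>, IsType T) \<in> eqfree Y" if eq: "fst (permute \<sigma> J) = \<Gamma> @ (x, T) # \<Delta>" for \<Gamma> x T \<Delta>
  proof -
    obtain \<Gamma>' x' T' \<Delta>' where "fst J = \<Gamma>' @ (x', T') # \<Delta>'"
      and *: "\<Gamma> = map (\<lambda>(x, T). (\<sigma> x, subst (Var \<circ> \<sigma>) T)) \<Gamma>'" "T = subst (Var \<circ> \<sigma>) T'"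
      using eq by (auto simp: permute_def map_eq_append_conv map_eq_Cons_conv)
    then have "(\<Gamma>', IsType T') \<in> eqfree Y" using perm.IH by blast
    then have "permute \<sigma> (\<Gamma>', IsType T') \<in> eqfree Y" using perm.hyps by (blast intro: eqfree.perm)
    then show ?thesis by (simp add: permute_simp *)
  qed
  moreover have "(fst (permute \<sigma> J), IsType T) \<in> eqfree Y"
    if R: "snd (permute \<sigma> J) = HasType t T" for t T
  proof -
    obtain t' T' where "snd J = HasType t' T'" and *: "T = subst (Var \<circ> \<sigma>) T'"
      using R by (cases "snd J") (auto simp: permute_def)
    then have "permute \<sigma> (fst J, IsType T') \<in> eqfree Y"
      using perm.hyps perm.IH by (blast intro: eqfree.perm)
    then show ?thesis by (simp add: permute_def *)
  qed
  ultimately show ?case by blast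
next
  case (subst \<Gamma> t T y \<Delta> R)
  have "(\<Gamma>', IsType T') \<in> eqfree Y" if eq: "\<Gamma> @ subst_ctx (single t y) \<Delta> = \<Gamma>' @ (x, T') # \<Delta>'" for \<Gamma>' x T' \<Delta>'
  proof -
    from eq consider us where "\<Gamma> = \<Gamma>' @ us" "us @ subst_ctx (single t y) \<Delta> = (x, T') # \<Delta>'"
      | us where "\<Gamma> @ us = \<Gamma>'" "subst_ctx (single t y) \<Delta> = us @ (x, T') # \<Delta>'"
      by (auto simp: append_eq_append_conv2)
    then show ?thesis
    proof cases
      case 1
      show ?thesis
      proof (cases us)
        case Nil
        then obtain T'' \<Delta>'' where "\<Delta> = (x, T'') # \<Delta>''" "T' = Defs.subst (single t y) T''"
          using 1 by (auto simp: subst_ctx_def map_eq_Cons_conv)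
        moreover from this have "(\<Gamma> @ [(y, T)], IsType T'') \<in> eqfree Y"
          using subst.IH(2) by (auto dest: spec[of _ "\<Gamma> @ [(y, T)]"])
        then have "(\<Gamma> @ subst_ctx (single t y) [], subst_rhs (single t y) (IsType T'')) \<in> eqfree Y"
          by (rule eqfree.subst[OF subst.hyps(1)])
        ultimately show ?thesis using 1 Nil by (simp add: subst_ctx_def)
      next
        case (Cons u us')
        then show ?thesis using 1 subst.IH(1) by auto
      qed
    next
      case 2
      then obtain \<Delta>1 T'' \<Delta>2 where *: "\<Delta> = \<Delta>1 @ (x, T'') # \<Delta>2" "us = subst_ctx (single t y) \<Delta>1"
        "T' = Defs.subst (single t y) T''"
        by (auto simp: subst_ctx_def map_eq_append_conv map_eq_Cons_conv)
      then have "(\<Gamma> @ (y, T) # \<Delta>1, IsType T'') \<in> eqfree Y"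
        using subst.IH(2) by (auto dest: spec[of _ "\<Gamma> @ (y, T) # \<Delta>1"])
      then have "(\<Gamma> @ subst_ctx (single t y) \<Delta>1, subst_rhs (single t y) (IsType T'')) \<in> eqfree Y"
        by (rule eqfree.subst[OF subst.hyps(1)])
      then show ?thesis using 2 * by simp
    qed
  qed
  moreover have "(\<Gamma> @ subst_ctx (single t y) \<Delta>, IsType T') \<in> eqfree Y"
    if R: "subst_rhs (single t y) R = HasType t' T'" for t' T'
  proof -
    obtain t'' T'' where "R = HasType t'' T''" and *: "T' = Defs.subst (single t y) T''"
      using R by (cases R) auto
    then have "(\<Gamma> @ (y, T) # \<Delta>, IsType T'') \<in> eqfree Y" using subst.IH(2) by simp
    from eqfree.subst[OF subst.hyps(1) this] show ?thesis by (simp add: *)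
  qed
  ultimately show ?case by auto
qed

lemma eqfree_prefix:
  "\<lbrakk>is_psh Y; (\<Gamma> @ (x, T) # \<Delta>, R) \<in> eqfree Y\<rbrakk> \<Longrightarrow> (\<Gamma>, IsType T) \<in> eqfree Y"
  using eqfree_boundary_aux by fastforce

lemma eqfree_type_of_term:
  "\<lbrakk>is_psh Y; (\<Gamma>, HasType t T) \<in> eqfree Y\<rbrakk> \<Longrightarrow> (\<Gamma>, IsType T) \<in> eqfree Y"
  using eqfree_boundary_aux by fastforce

lemma eqfree_take:
  assumes "is_psh Y" "(\<Gamma>, R) \<in> eqfree Y" "i < length \<Gamma>"
  shows "(take i \<Gamma>, IsType (snd (\<Gamma> ! i))) \<in> eqfree Y"
  using eqfree_prefix[OF assms(1), of "take i \<Gamma>" "fst (\<Gamma> ! i)" "snd (\<Gamma> ! i)" "drop (Suc i) \<Gamma>" R] assms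
  by (simp add: Cons_nth_drop_Suc)

lemma fst_subst_ctx [simp]: "map fst (subst_ctx \<rho> \<Gamma>) = map fst \<Gamma>"
  by (simp add: subst_ctx_def case_prod_beta comp_def)

lemma map_fst_gen_ctx [simp]: "map fst (gen_ctx Y n A) = [1..<n]"
  by (simp add: gen_ctx_def comp_def)

lemma eqfree_scoped:
  "J \<in> eqfree Y \<Longrightarrow> distinct (map fst (fst J)) \<and> fv_rhs (snd J) \<subseteq> set (map fst (fst J))"
proof (induction rule: eqfree.induct)
  case (ty A n)
  show ?case by (auto simp only: ty_judg_def fst_conv snd_conv map_fst_gen_ctx) (auto simp: gen_app_def)
next
  case (tm a n)
  show ?case by (auto simp only: tm_judg_def fst_conv snd_conv map_fst_gen_ctx) (auto simp: gen_app_def)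
next
  case (perm \<sigma> J)
  have eq: "map fst (fst (permute \<sigma> J)) = map \<sigma> (map fst (fst J))"
    by (simp add: permute_def case_prod_beta comp_def)
  have "inj \<sigma>" using perm.hyps by (simp add: bij_is_inj)
  then show ?case unfolding eq using perm.IH
    by (auto simp: permute_def distinct_map fv_subst_rhs simp del: map_map dest: inj_on_subset)
next
  case (subst \<Gamma> t T y \<Delta> R)
  then show ?case
    by (simp add: fv_subst_rhs single_def) (auto split: if_splits)
qed

lemma scoped_rhs: "(\<Gamma>, R) \<in> eqfree Y \<Longrightarrow> fv_rhs R \<subseteq> set (map fst \<Gamma>)"
  using eqfree_scoped by fastforce

lemma scoped_distinct: "(\<Gamma>, R) \<in> eqfree Y \<Longrightarrow> distinct (map fst \<Gamma>)"
  using eqfree_scoped by fastforce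

lemma scoped_ctx:
  assumes "is_psh Y" "(\<Gamma>, R) \<in> eqfree Y" "i < length \<Gamma>"
  shows "fv (snd (\<Gamma> ! i)) \<subseteq> set (map fst (take i \<Gamma>))"
  using scoped_rhs[OF eqfree_take[OF assms]] by simp

lemma scoped_ctx_all:
  assumes "is_psh Y" "(\<Gamma>, R) \<in> eqfree Y" "(x, T) \<in> set \<Gamma>"
  shows "fv T \<subseteq> set (map fst \<Gamma>)"
proof -
  obtain i where "i < length \<Gamma>" "\<Gamma> ! i = (x, T)" using assms(3) by (meson in_set_conv_nth)
  then show ?thesis using scoped_ctx[OF assms(1,2), of i] set_take_subset[of i \<Gamma>] by fastforce
qed

lemma type_generators_derived:
  assumes Y: "is_psh Y"
  shows "A \<in> ty_el Y n \<Longrightarrow> ty_judg Y n A \<in> derived (G Y)"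
proof (induction n arbitrary: A)
  case 0
  then show ?case using Y by (simp add: is_psh_def)
next
  case (Suc n)
  have "K \<in> derived (G Y)" if "K \<in> set (boundary (ty_judg Y (Suc n) A))" for K
  proof -
    have ne: "n \<noteq> 0" and K: "K = (butlast (gen_ctx Y (Suc n) A), IsType (snd (last (gen_ctx Y (Suc n) A))))"
      using that by (auto simp: ty_judg_def gen_ctx_def split: if_splits)
    then obtain m where m: "n = Suc m" using not0_implies_Suc by blast
    have bd: "bd_ty Y n A \<in> ty_el Y n" using Y Suc.prems ne by (auto simp: is_psh_def)
    have "K = ty_judg Y n (bd_ty Y n A)"
      using ne unfolding K by (simp add: ty_judg_def gen_ctx_def last_map)
    then show ?thesis using Suc.IH[OF bd] by simp
  qed
  moreover have "ty_judg Y (Suc n) A \<in> basic_judgs (G Y)" using Suc.prems by (auto simp: G_def)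
  ultimately show ?case by (blast intro: derivable.basic)
qed

lemma term_generators_derived:
  assumes Y: "is_psh Y" and a: "a \<in> tm_el Y n"
  shows "tm_judg Y n a \<in> derived (G Y)"
proof (rule derivable.basic)
  show "tm_judg Y n a \<in> basic_judgs (G Y)" using a by (auto simp: G_def)
  show "\<forall>K \<in> set (boundary (tm_judg Y n a)). K \<in> derived (G Y)"
    using type_generators_derived[OF Y bd_tm_in[OF Y a]] by (simp add: tm_judg_def ty_judg_def)
qed

lemma eqfree_derived:
  assumes Y: "is_psh Y"
  shows "J \<in> eqfree Y \<Longrightarrow> J \<in> derived (G Y)"
proof (induction rule: eqfree.induct)
  case (perm \<sigma> J)
  have "rule (Perm \<sigma>) [J] (permute \<sigma> J)" using perm.hyps(1) by (rule rule.intros(9))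
  then show ?case using perm.IH by (intro derivable.deduce[of "[J]"]) simp_all
next
  case (subst \<Gamma> t T y \<Delta> R)
  then show ?case
    using derivable.deduce[OF _ rule.intros(10)] by fastforce
qed (use Y in \<open>auto intro: type_generators_derived term_generators_derived\<close>)

text \<open>A judgement over \<open>D\<close>, where an equation counts as its left-hand side provided that it is trivial.\<close>

fun reflexive_over :: "'c judg set \<Rightarrow> 'c judg \<Rightarrow> bool" where
  "reflexive_over D (\<Gamma>, IsType T) \<longleftrightarrow> (\<Gamma>, IsType T) \<in> D"
| "reflexive_over D (\<Gamma>, HasType t T) \<longleftrightarrow> (\<Gamma>, HasType t T) \<in> D"
| "reflexive_over D (\<Gamma>, TypeEq T T') \<longleftrightarrow> T = T' \<and> (\<Gamma>, IsType T) \<in> D"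
| "reflexive_over D (\<Gamma>, TermEq t t' T) \<longleftrightarrow> t = t' \<and> (\<Gamma>, HasType t T) \<in> D"

text \<open>The key fact about free GATs: no nontrivial equation is derivable. The substitution rules for
  equations start from \<open>t\<^sub>1 = t\<^sub>2\<close> with \<open>t\<^sub>1\<close> and \<open>t\<^sub>2\<close> identical, so that their conclusions are reflexive too.\<close>

lemma derived_reflexive_over:
  assumes Y: "is_psh Y"
  shows "J \<in> derived (G Y) \<Longrightarrow> reflexive_over (eqfree Y) J"
proof (induction rule: derivable.induct)
  case (basic J)
  then consider n A where "J = ty_judg Y n A" "A \<in> ty_el Y n" | n a where "J = tm_judg Y n a" "a \<in> tm_el Y n"
    by (auto simp: G_def)
  then show ?case
  proof cases
    case 1
    then show ?thesis using eqfree.ty[of A Y n] by (simp add: ty_judg_def)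
  next
    case 2
    then show ?thesis using eqfree.tm[of a Y n] by (simp add: tm_judg_def)
  qed
next
  case (deduce Js r J)
  have IH: "\<forall>K \<in> set Js. reflexive_over (eqfree Y) K" using deduce by simp
  show ?case using deduce(2) IH
  proof cases
    case (9 \<sigma> K)
    then have K: "reflexive_over (eqfree Y) K" using IH by simp
    obtain \<Gamma> R where "K = (\<Gamma>, R)" by (cases K)
    then show ?thesis
      using K eqfree.perm[OF 9(4), of "(\<Gamma>, IsType _)"] eqfree.perm[OF 9(4), of "(\<Gamma>, HasType _ _)"] 9(3)
      by (cases R) (auto simp: permute_simp)
  next
    case (10 \<Gamma> t T y \<Delta> R)
    then have K: "(\<Gamma>, HasType t T) \<in> eqfree Y" "reflexive_over (eqfree Y) (\<Gamma> @ (y, T) # \<Delta>, R)"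
      using IH by auto
    then show ?thesis
      using eqfree.subst[OF K(1), of y \<Delta>, where R = "IsType _"]
        eqfree.subst[OF K(1), of y \<Delta>, where R = "HasType _ _"] 10(3)
      by (cases R) auto
  next
    case (11 \<Gamma> t1 t2 T y \<Delta> T')
    then show ?thesis using IH eqfree.subst[of \<Gamma> t1 T Y y \<Delta> "IsType T'"] by auto
  next
    case (12 \<Gamma> t1 t2 T y \<Delta> t' T')
    then show ?thesis using IH eqfree.subst[of \<Gamma> t1 T Y y \<Delta> "HasType t' T'"] by auto
  qed auto
qed

lemma derived_type_iff: "is_psh Y \<Longrightarrow> (\<Gamma>, IsType T) \<in> derived (G Y) \<longleftrightarrow> (\<Gamma>, IsType T) \<in> eqfree Y"
  using derived_reflexive_over eqfree_derived by fastforce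

lemma derived_term_iff: "is_psh Y \<Longrightarrow> (\<Gamma>, HasType t T) \<in> derived (G Y) \<longleftrightarrow> (\<Gamma>, HasType t T) \<in> eqfree Y"
  using derived_reflexive_over eqfree_derived by fastforce

lemma derived_type_eq_iff:
  assumes "is_psh Y"
  shows "(\<Gamma>, TypeEq T T') \<in> derived (G Y) \<longleftrightarrow> T = T' \<and> (\<Gamma>, IsType T) \<in> eqfree Y"
proof
  assume "(\<Gamma>, TypeEq T T') \<in> derived (G Y)"
  from derived_reflexive_over[OF assms this] show "T = T' \<and> (\<Gamma>, IsType T) \<in> eqfree Y" by auto
next
  assume "T = T' \<and> (\<Gamma>, IsType T) \<in> eqfree Y"
  then have "T' = T" "(\<Gamma>, IsType T) \<in> derived (G Y)" by (blast, blast intro: eqfree_derived[OF assms])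
  then show "(\<Gamma>, TypeEq T T') \<in> derived (G Y)"
    using derivable.deduce[OF _ rule.intros(4)[of \<Gamma> T]] by simp
qed

lemma derived_term_eq_iff:
  assumes "is_psh Y"
  shows "(\<Gamma>, TermEq t t' T) \<in> derived (G Y) \<longleftrightarrow> t = t' \<and> (\<Gamma>, HasType t T) \<in> eqfree Y"
proof
  assume "(\<Gamma>, TermEq t t' T) \<in> derived (G Y)"
  from derived_reflexive_over[OF assms this] show "t = t' \<and> (\<Gamma>, HasType t T) \<in> eqfree Y" by auto
next
  assume "t = t' \<and> (\<Gamma>, HasType t T) \<in> eqfree Y"
  then have "t' = t" "(\<Gamma>, HasType t T) \<in> derived (G Y)" by (blast, blast intro: eqfree_derived[OF assms])
  then show "(\<Gamma>, TermEq t t' T) \<in> derived (G Y)"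
    using derivable.deduce[OF _ rule.intros(1)[of \<Gamma> t T]] by simp
qed

section \<open>Normal forms of judgements\<close>

text \<open>Positions count from 1, so that the normal form lives on the standard variables \<open>1, 2, \<dots>\<close>.\<close>

definition posn :: "var list \<Rightarrow> var \<Rightarrow> nat" where
  "posn xs v = Suc (length (takeWhile (\<lambda>x. x \<noteq> v) xs))"

lemma posn_nth: "\<lbrakk>distinct xs; i < length xs\<rbrakk> \<Longrightarrow> posn xs (xs ! i) = Suc i"
proof -
  assume "distinct xs" "i < length xs"
  then have "takeWhile (\<lambda>x. x \<noteq> xs ! i) xs = take i xs"
    by (intro takeWhile_eq_take_P_nth) (auto simp: nth_eq_iff_index_eq)
  then show ?thesis using \<open>i < length xs\<close> by (simp add: posn_def)
qed

lemma posn_append: "v \<in> set xs \<Longrightarrow> posn (xs @ ys) v = posn xs v"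
  unfolding posn_def by (subst takeWhile_append1[of v]) auto

lemma nth_posn: "v \<in> set xs \<Longrightarrow> posn xs v - 1 < length xs \<and> xs ! (posn xs v - 1) = v"
  unfolding posn_def using nth_length_takeWhile[of "\<lambda>x. x \<noteq> v" xs]
  by (induction xs) auto

lemma posn_ge_1: "1 \<le> posn xs v"
  by (simp add: posn_def)

lemma Suc_posn_minus [simp]: "Suc (posn xs v - Suc 0) = posn xs v"
  by (simp add: posn_def)

lemma posn_le: "v \<in> set xs \<Longrightarrow> posn xs v \<le> length xs"
  using nth_posn[of v xs] posn_ge_1[of xs v] by linarith

lemma posn_inj_on: "inj_on (posn xs) (set xs)"
  by (rule inj_onI) (metis nth_posn)

lemma posn_upt: "v \<in> {1..<n} \<Longrightarrow> posn [1..<n] v = v"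
  using posn_nth[of "[1..<n]" "v - 1"] by (cases v) (auto simp del: upt_Suc)

lemma posn_map: "inj \<sigma> \<Longrightarrow> posn (map \<sigma> xs) (\<sigma> v) = posn xs v"
  by (simp add: posn_def takeWhile_map comp_def inj_eq)

abbreviation std :: "'c ctx \<Rightarrow> 'c exp \<Rightarrow> 'c exp" where
  "std \<Gamma> \<equiv> subst (Var \<circ> posn (map fst \<Gamma>))"

text \<open>The list of types of the context and the right-hand side, with variables replaced by positions;
  the names of the context variables are forgotten.\<close>

definition nf :: "'c judg \<Rightarrow> 'c exp list \<times> 'c rhs" where
  "nf J = (map (std (fst J) \<circ> snd) (fst J), subst_rhs (Var \<circ> posn (map fst (fst J))) (snd J))"

fun of_nf :: "'c exp list \<times> 'c rhs \<Rightarrow> 'c judg" where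
  "of_nf (Ts, R) = (zip [1..<Suc (length Ts)] Ts, R)"

lemma nf_simp: "nf (\<Gamma>, R) = (map (std \<Gamma> \<circ> snd) \<Gamma>, subst_rhs (Var \<circ> posn (map fst \<Gamma>)) R)"
  by (simp add: nf_def)

lemma nf_permute:
  assumes "bij \<sigma>"
  shows "nf (permute \<sigma> J) = nf J"
proof -
  have eq: "map fst (fst (permute \<sigma> J)) = map \<sigma> (map fst (fst J))"
    by (simp add: permute_def case_prod_beta comp_def)
  show ?thesis unfolding nf_def eq
    using posn_map[OF bij_is_inj[OF assms], of "map fst (fst J)"]
    by (simp add: permute_def case_prod_beta comp_def subst_subst subst_rhs_subst_rhs)
qed

text \<open>The standard representative is obtained by the renaming rule, and is hence derivable.\<close>

lemma of_nf_nf: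
  assumes "is_psh Y" "J \<in> eqfree Y"
  shows "\<exists>\<sigma>. bij \<sigma> \<and> of_nf (nf J) = permute \<sigma> J"
proof -
  obtain \<Gamma> R where J: "J = (\<Gamma>, R)" by (cases J)
  let ?xs = "map fst \<Gamma>"
  obtain \<sigma> where \<sigma>: "bij \<sigma>" "\<forall>x \<in> set ?xs. \<sigma> x = posn ?xs x"
    using finite_injection_extends_to_bij[OF _ posn_inj_on[of ?xs]] by auto
  have d: "distinct ?xs" using scoped_distinct assms(2) J by blast
  have T: "subst (Var \<circ> \<sigma>) (snd (\<Gamma> ! i)) = std \<Gamma> (snd (\<Gamma> ! i))" if "i < length \<Gamma>" for i
    using scoped_ctx_all[OF assms(1) assms(2)[unfolded J], of "fst (\<Gamma> ! i)" "snd (\<Gamma> ! i)"] \<sigma>(2) that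
    by (intro subst_cong) auto
  have R: "subst_rhs (Var \<circ> \<sigma>) R = subst_rhs (Var \<circ> posn ?xs) R"
    using scoped_rhs assms(2) \<sigma>(2) unfolding J by (intro subst_rhs_cong) fastforce
  have x: "\<sigma> (fst (\<Gamma> ! i)) = Suc i" if "i < length \<Gamma>" for i
    using \<sigma>(2) posn_nth[OF d, of i] that by simp
  have "zip [1..<Suc (length \<Gamma>)] (map (std \<Gamma> \<circ> snd) \<Gamma>) = map (\<lambda>(x, T). (\<sigma> x, subst (Var \<circ> \<sigma>) T)) \<Gamma>"
    by (rule nth_equalityI) (simp_all add: x T case_prod_beta del: upt_Suc)
  then have "of_nf (nf J) = permute \<sigma> J"
    unfolding J by (simp add: nf_simp permute_simp R)
  then show ?thesis using \<sigma>(1) by blast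
qed

lemma of_nf_nf_eqfree: "\<lbrakk>is_psh Y; J \<in> eqfree Y\<rbrakk> \<Longrightarrow> of_nf (nf J) \<in> eqfree Y"
  using of_nf_nf eqfree.perm by metis

lemma nf_of_nf_nf: "\<lbrakk>is_psh Y; J \<in> eqfree Y\<rbrakk> \<Longrightarrow> nf (of_nf (nf J)) = nf J"
  using of_nf_nf nf_permute by metis

lemma std_rename:
  assumes "length \<Gamma> = length \<Delta>" "distinct (map fst \<Gamma>)" "distinct (map fst \<Delta>)" "fv T \<subseteq> set (map fst \<Delta>)"
  shows "std \<Gamma> (rename \<Gamma> \<Delta> T) = std \<Delta> T"
    and "rename \<Gamma> \<Delta> T = subst (\<lambda>p. Var (map fst \<Gamma> ! (p - 1))) (std \<Delta> T)"
proof -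
  have *: "map_of (zip (map fst \<Delta>) (map fst \<Gamma>)) v = Some (map fst \<Gamma> ! (posn (map fst \<Delta>) v - 1))"
    and le: "posn (map fst \<Delta>) v - 1 < length \<Gamma>"
    if "v \<in> fv T" for v
  proof -
    have v: "v \<in> set (map fst \<Delta>)" using assms(4) that by blast
    show "posn (map fst \<Delta>) v - 1 < length \<Gamma>" using nth_posn[OF v] assms(1) by simp
    then show "map_of (zip (map fst \<Delta>) (map fst \<Gamma>)) v = Some (map fst \<Gamma> ! (posn (map fst \<Delta>) v - 1))"
      using nth_posn[OF v] map_of_zip_nth[of "map fst \<Delta>" "map fst \<Gamma>" "posn (map fst \<Delta>) v - 1"] assms(1,3)
      by (simp del: nth_map map_of_eq_Some_iff)
  qed
  show "std \<Gamma> (rename \<Gamma> \<Delta> T) = std \<Delta> T"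
    unfolding rename_def subst_subst
    using posn_nth[OF assms(2)] le posn_ge_1[of "map fst \<Delta>"] by (intro subst_cong) (auto simp: * )
  show "rename \<Gamma> \<Delta> T = subst (\<lambda>p. Var (map fst \<Gamma> ! (p - 1))) (std \<Delta> T)"
    unfolding rename_def subst_subst by (intro subst_cong) (auto simp: * )
qed

lemma subst_std:
  assumes "fv T \<subseteq> set (map fst \<Delta>)"
  shows "subst (\<lambda>p. Var (map fst \<Delta> ! (p - 1))) (std \<Delta> T) = T"
  unfolding subst_subst using nth_posn assms by (intro subst_ident) (auto simp del: set_map nth_map)

text \<open>Renaming along positions can be undone, which turns the asymmetric equation with \<open>rename\<close> into
  an equality of normal forms.\<close>

lemma eq_rename_iff:
  assumes "length \<Gamma> = length \<Delta>" "distinct (map fst \<Gamma>)" "distinct (map fst \<Delta>)"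
    and "fv T \<subseteq> set (map fst \<Delta>)" "fv U \<subseteq> set (map fst \<Gamma>)"
  shows "U = rename \<Gamma> \<Delta> T \<longleftrightarrow> std \<Gamma> U = std \<Delta> T"
  using std_rename[OF assms(1-4)] subst_std[OF assms(5)] by metis

lemma std_take:
  assumes "fv T \<subseteq> set (map fst (take i \<Gamma>))"
  shows "std (take i \<Gamma>) T = std \<Gamma> T"
proof (rule subst_cong)
  fix v assume "v \<in> fv T"
  then have "v \<in> set (map fst (take i \<Gamma>))" using assms by blast
  from posn_append[OF this, of "map fst (drop i \<Gamma>)"]
  show "(Var \<circ> posn (map fst (take i \<Gamma>))) v = (Var \<circ> posn (map fst \<Gamma>)) v"
    by (simp flip: map_append)
qed

lemma type_equiv_iff:
  assumes Y: "is_psh Y" and J: "(\<Gamma>, IsType U) \<in> eqfree Y" and K: "(\<Delta>, IsType T) \<in> eqfree Y"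
  shows "type_equiv (G Y) \<Gamma> U \<Delta> T \<longleftrightarrow> nf (\<Gamma>, IsType U) = nf (\<Delta>, IsType T)"
proof (cases "length \<Gamma> = length \<Delta>")
  case True
  let ?S = "\<lambda>i. (map snd \<Gamma> @ [U]) ! i" and ?T = "\<lambda>i. (map snd \<Delta> @ [T]) ! i"
  have U: "(take i \<Gamma>, IsType (?S i)) \<in> eqfree Y" if "i \<le> length \<Gamma>" for i
    using eqfree_take[OF Y J, of i] J that by (auto simp: nth_append)
  have T: "(take i \<Delta>, IsType (?T i)) \<in> eqfree Y" if "i \<le> length \<Gamma>" for i
    using eqfree_take[OF Y K, of i] K that True by (auto simp: nth_append)
  have "(take i \<Gamma>, TypeEq (?S i) (rename (take i \<Gamma>) (take i \<Delta>) (?T i))) \<in> derived (G Y)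
      \<longleftrightarrow> std \<Gamma> (?S i) = std \<Delta> (?T i)" (is "?L \<longleftrightarrow> ?R") if i: "i \<le> length \<Gamma>" for i
  proof -
    have "?L \<longleftrightarrow> ?S i = rename (take i \<Gamma>) (take i \<Delta>) (?T i)"
      using U[OF i] by (auto simp: derived_type_eq_iff[OF Y])
    also have "\<dots> \<longleftrightarrow> std (take i \<Gamma>) (?S i) = std (take i \<Delta>) (?T i)"
      using scoped_rhs[OF U[OF i]] scoped_rhs[OF T[OF i]] scoped_distinct[OF U[OF i]] scoped_distinct[OF T[OF i]] True
      by (intro eq_rename_iff) auto
    also have "\<dots> \<longleftrightarrow> ?R"
      using std_take[of "?S i" i \<Gamma>] std_take[of "?T i" i \<Delta>] scoped_rhs[OF U[OF i]] scoped_rhs[OF T[OF i]]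
      by simp
    finally show ?thesis .
  qed
  then have "type_equiv (G Y) \<Gamma> U \<Delta> T \<longleftrightarrow> (\<forall>i \<le> length \<Gamma>. std \<Gamma> (?S i) = std \<Delta> (?T i))"
    using True by (auto simp: type_equiv_def)
  also have "\<dots> \<longleftrightarrow> map (std \<Gamma>) (map snd \<Gamma> @ [U]) = map (std \<Delta>) (map snd \<Delta> @ [T])"
    unfolding list_eq_iff_nth_eq using True by (auto simp: less_Suc_eq_le simp del: map_append)
  also have "\<dots> \<longleftrightarrow> nf (\<Gamma>, IsType U) = nf (\<Delta>, IsType T)" by (simp add: nf_simp)
  finally show ?thesis .
next
  case False
  then show ?thesis by (auto simp: type_equiv_def nf_simp dest: map_eq_imp_length_eq)
qed

lemma judg_equiv_iff:
  assumes Y: "is_psh Y" and J: "J \<in> eqfree Y" and K: "K \<in> eqfree Y"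
  shows "judg_equiv (G Y) J K \<longleftrightarrow> nf J = nf K"
proof -
  obtain \<Gamma> R where JR: "J = (\<Gamma>, R)" by (cases J)
  obtain \<Delta> Q where KQ: "K = (\<Delta>, Q)" by (cases K)
  consider U T where "R = IsType U" "Q = IsType T" | s U t T where "R = HasType s U" "Q = HasType t T"
    | U t T where "R = IsType U" "Q = HasType t T" | s U T where "R = HasType s U" "Q = IsType T"
    using eqfree_kind[OF J] eqfree_kind[OF K] JR KQ by fastforce
  then show ?thesis
  proof cases
    case 1
    then show ?thesis using type_equiv_iff[OF Y] J K JR KQ by simp
  next
    case 2
    note J' = J[unfolded JR 2] and K' = K[unfolded KQ 2]
    note J'' = eqfree_type_of_term[OF Y J'] and K'' = eqfree_type_of_term[OF Y K']
    have "(\<Gamma>, TermEq s (rename \<Gamma> \<Delta> t) U) \<in> derived (G Y) \<longleftrightarrow> std \<Gamma> s = std \<Delta> t"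
      if "length \<Gamma> = length \<Delta>"
      using eq_rename_iff[of \<Gamma> \<Delta> t s] scoped_rhs[OF J'] scoped_rhs[OF K'] scoped_distinct[OF J']
        scoped_distinct[OF K'] that J' by (simp add: derived_term_eq_iff[OF Y])
    moreover have "type_equiv (G Y) \<Gamma> U \<Delta> T \<Longrightarrow> length \<Gamma> = length \<Delta>" by (simp add: type_equiv_def)
    ultimately have "judg_equiv (G Y) J K \<longleftrightarrow> nf (\<Gamma>, IsType U) = nf (\<Delta>, IsType T) \<and> std \<Gamma> s = std \<Delta> t"
      unfolding JR KQ 2 using type_equiv_iff[OF Y J'' K''] by auto
    then show ?thesis unfolding JR KQ 2 by (auto simp: nf_simp)
  qed (auto simp: JR KQ nf_simp)
qed

text \<open>With all equations trivial, equivalence of judgements is equality of normal forms.\<close>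

lemma judg_class_eq:
  assumes Y: "is_psh Y" and J: "J \<in> eqfree Y"
  shows "judg_class (G Y) J = {K \<in> eqfree Y. nf K = nf J}"
proof -
  have "K \<in> derived (G Y) \<and> judg_equiv (G Y) J K \<longleftrightarrow> K \<in> eqfree Y \<and> nf K = nf J" for K
  proof (cases "K \<in> eqfree Y")
    case True
    then show ?thesis using judg_equiv_iff[OF Y J True] eqfree_derived[OF Y True] by auto
  next
    case False
    obtain \<Gamma> R where JR: "J = (\<Gamma>, R)" by (cases J)
    obtain \<Delta> Q where KQ: "K = (\<Delta>, Q)" by (cases K)
    have "\<not> judg_equiv (G Y) J K" if "K \<in> derived (G Y)"
      using False derived_reflexive_over[OF Y that] eqfree_kind[OF J] unfolding JR KQ
      by (cases Q) auto
    with False show ?thesis by blast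
  qed
  then show ?thesis unfolding judg_class_def by blast
qed

lemma judg_class_eq_iff:
  assumes "is_psh Y" "J \<in> eqfree Y" "K \<in> eqfree Y"
  shows "judg_class (G Y) J = judg_class (G Y) K \<longleftrightarrow> nf J = nf K"
proof
  assume "judg_class (G Y) J = judg_class (G Y) K"
  moreover have "J \<in> judg_class (G Y) J" using assms(1,2) by (simp add: judg_class_eq)
  ultimately have "J \<in> judg_class (G Y) K" by simp
  then show "nf J = nf K" using assms(1,3) by (simp add: judg_class_eq)
qed (use assms in \<open>simp add: judg_class_eq\<close>)

text \<open>Maps on classes are defined through arbitrary members; they can be evaluated at a given member once
  they depend on the normal form only.\<close>

lemma the_elem_judg_class_image:
  assumes "is_psh Y" "J \<in> eqfree Y" "\<And>K. \<lbrakk>K \<in> eqfree Y; nf K = nf J\<rbrakk> \<Longrightarrow> f K = f J"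
  shows "the_elem (f ` judg_class (G Y) J) = f J"
proof -
  have "f ` judg_class (G Y) J = {f J}"
    unfolding judg_class_eq[OF assms(1,2)] using assms(2,3) by blast
  then show ?thesis by simp
qed

text \<open>The boundary of a type or term judgement, on the level of normal forms. An equation
  has two boundary judgements, and its value is arbitrary.\<close>

fun last_type :: "'c exp list \<times> 'c rhs \<Rightarrow> 'c exp list \<times> 'c rhs" where
  "last_type (Ts, IsType T) = (butlast Ts, IsType (last Ts))"
| "last_type (Ts, HasType t T) = (Ts, IsType T)"
| "last_type (Ts, R) = undefined"

lemma boundary_eqfree:
  assumes Y: "is_psh Y" and J: "J \<in> eqfree Y" and n: "kind_of J = TypeKind \<Longrightarrow> fst J \<noteq> []"
  shows "hd (boundary J) \<in> eqfree Y" "nf (hd (boundary J)) = last_type (nf J)"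
proof -
  obtain \<Gamma> R where JR: "J = (\<Gamma>, R)" by (cases J)
  consider T where "R = IsType T" | t T where "R = HasType t T"
    using eqfree_kind[OF J] JR by auto
  then have "hd (boundary J) \<in> eqfree Y \<and> nf (hd (boundary J)) = last_type (nf J)"
  proof cases
    case 1
    then have "\<Gamma> \<noteq> []" using n JR by simp
    then obtain \<Delta> x U where \<Gamma>: "\<Gamma> = \<Delta> @ [(x, U)]" by (metis rev_exhaust surj_pair)
    note J' = J[unfolded JR \<Gamma>]
    have "(\<Delta>, IsType U) \<in> eqfree Y" using eqfree_prefix[OF Y J'] .
    moreover have "std \<Delta> W = std \<Gamma> W" if "fv W \<subseteq> set (map fst \<Delta>)" for W
      using std_take[of W "length \<Delta>" \<Gamma>] that \<Gamma> by simp
    moreover have "fv U \<subseteq> set (map fst \<Delta>)" using scoped_rhs[OF \<open>(\<Delta>, IsType U) \<in> eqfree Y\<close>] by simp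
    moreover have "fv (snd p) \<subseteq> set (map fst \<Delta>)" if "p \<in> set \<Delta>" for p
      using scoped_ctx_all[OF Y \<open>(\<Delta>, IsType U) \<in> eqfree Y\<close>, of "fst p" "snd p"] that by simp
    ultimately show ?thesis unfolding JR 1 by (simp add: nf_simp \<Gamma>)
  next
    case 2
    then show ?thesis using eqfree_type_of_term[OF Y] J JR by (auto simp: nf_simp)
  qed
  then show "hd (boundary J) \<in> eqfree Y" "nf (hd (boundary J)) = last_type (nf J)" by auto
qed

lemma class_map_boundary:
  assumes Y: "is_psh Y" and J: "J \<in> eqfree Y" and n: "kind_of J = TypeKind \<Longrightarrow> fst J \<noteq> []"
  shows "class_map (G Y) (\<lambda>K. hd (boundary K)) (judg_class (G Y) J) = judg_class (G Y) (hd (boundary J))"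
  unfolding class_map_def
proof (rule the_elem_judg_class_image[OF Y J])
  fix K assume K: "K \<in> eqfree Y" "nf K = nf J"
  have "kind_of K = TypeKind \<Longrightarrow> kind_of J = TypeKind" "fst K = [] \<Longrightarrow> fst J = []"
    using K(2) eqfree_kind[OF J] by (cases J; cases K; auto simp: nf_simp elim!: kind_of.elims)+
  then have "kind_of K = TypeKind \<Longrightarrow> fst K \<noteq> []" using n by blast
  then show "judg_class (G Y) (hd (boundary K)) = judg_class (G Y) (hd (boundary J))"
    using boundary_eqfree[OF Y J n] boundary_eqfree[OF Y K(1)] K(2) judg_class_eq_iff[OF Y] by simp
qed

lemma V_G_ty: "is_psh Y \<Longrightarrow> ty_el (V (G Y)) n = {judg_class (G Y) (\<Gamma>, IsType T) | \<Gamma> T. (\<Gamma>, IsType T) \<in> eqfree Y \<and> Suc (length \<Gamma>) = n}"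
  by (auto simp: V_def image_def degree_def derived_type_iff[symmetric] elim!: kind_of.elims) force+

lemma V_G_tm: "is_psh Y \<Longrightarrow> tm_el (V (G Y)) n = {judg_class (G Y) (\<Gamma>, HasType t T) | \<Gamma> t T. (\<Gamma>, HasType t T) \<in> eqfree Y \<and> Suc (length \<Gamma>) = n}"
  by (auto simp: V_def image_def degree_def derived_term_iff[symmetric] elim!: kind_of.elims) force+

lemma bd_ty_V:
  assumes "is_psh Y" "(\<Gamma> @ [(x, U)], IsType T) \<in> eqfree Y"
  shows "bd_ty (V (G Y)) n (judg_class (G Y) (\<Gamma> @ [(x, U)], IsType T)) = judg_class (G Y) (\<Gamma>, IsType U)"
  using class_map_boundary[OF assms] by (simp add: V_def)

lemma bd_tm_V:
  assumes "is_psh Y" "(\<Gamma>, HasType t T) \<in> eqfree Y"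
  shows "bd_tm (V (G Y)) n (judg_class (G Y) (\<Gamma>, HasType t T)) = judg_class (G Y) (\<Gamma>, IsType T)"
  using class_map_boundary[OF assms] by (simp add: V_def)

lemma is_psh_V:
  assumes Y: "is_psh Y"
  shows "is_psh (V (G Y))"
  unfolding is_psh_def
proof (intro conjI allI impI ballI)
  show "ty_el (V (G Y)) 0 = {}" "tm_el (V (G Y)) 0 = {}" by (auto simp: V_G_ty[OF Y] V_G_tm[OF Y])
next
  fix n :: nat and A assume "1 \<le> n" "A \<in> ty_el (V (G Y)) (Suc n)"
  then obtain \<Gamma> T where A: "A = judg_class (G Y) (\<Gamma>, IsType T)" "(\<Gamma>, IsType T) \<in> eqfree Y" "length \<Gamma> = n"
    by (auto simp: V_G_ty[OF Y])
  with \<open>1 \<le> n\<close> obtain \<Delta> x U where "\<Gamma> = \<Delta> @ [(x, U)]" by (cases \<Gamma> rule: rev_cases) auto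
  then show "bd_ty (V (G Y)) n A \<in> ty_el (V (G Y)) n"
    using A bd_ty_V[OF Y, of \<Delta> x U T n] eqfree_prefix[OF Y, of \<Delta> x U "[]" "IsType T"] by (auto simp: V_G_ty[OF Y])
next
  fix n :: nat and a assume "1 \<le> n" "a \<in> tm_el (V (G Y)) n"
  then obtain \<Gamma> t T where A: "a = judg_class (G Y) (\<Gamma>, HasType t T)" "(\<Gamma>, HasType t T) \<in> eqfree Y" "Suc (length \<Gamma>) = n"
    by (auto simp: V_G_tm[OF Y])
  then show "bd_tm (V (G Y)) n a \<in> ty_el (V (G Y)) n"
    using bd_tm_V[OF Y A(2)] eqfree_type_of_term[OF Y A(2)] by (auto simp: V_G_ty[OF Y])
qed

section \<open>Interpretations given by translating constants\<close>

text \<open>The substitution of the \<open>i\<close>th argument for the variable \<open>i\<close>. Other variables go to a closed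
  expression: then translation commutes with substitution for all expressions, and not just for
  those in which every constant has the right number of arguments.\<close>

definition arg_subst :: "'d exp list \<Rightarrow> var \<Rightarrow> 'd exp" where
  "arg_subst es i = (if 1 \<le> i \<and> i \<le> length es then es ! (i - 1) else App undefined [])"

text \<open>The translation along \<open>D\<close> replaces a constant \<open>w\<close> by the expression \<open>D w\<close> in the variables \<open>1, 2, \<dots>\<close>.\<close>

primrec tr :: "('c \<Rightarrow> 'd exp) \<Rightarrow> 'c exp \<Rightarrow> 'd exp" where
  "tr D (Var x) = Var x"
| "tr D (App w es) = subst (arg_subst (map (tr D) es)) (D w)"

primrec tr_rhs :: "('c \<Rightarrow> 'd exp) \<Rightarrow> 'c rhs \<Rightarrow> 'd rhs" where
  "tr_rhs D (IsType T) = IsType (tr D T)"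
| "tr_rhs D (HasType t T) = HasType (tr D t) (tr D T)"
| "tr_rhs D (TypeEq T T') = TypeEq (tr D T) (tr D T')"
| "tr_rhs D (TermEq t t' T) = TermEq (tr D t) (tr D t') (tr D T)"

definition tr_ctx :: "('c \<Rightarrow> 'd exp) \<Rightarrow> 'c ctx \<Rightarrow> 'd ctx" where
  "tr_ctx D \<Gamma> = map (\<lambda>(x, T). (x, tr D T)) \<Gamma>"

definition tr_judg :: "('c \<Rightarrow> 'd exp) \<Rightarrow> 'c judg \<Rightarrow> 'd judg" where
  "tr_judg D J = (tr_ctx D (fst J), tr_rhs D (snd J))"

lemma tr_judg_simp [simp]: "tr_judg D (\<Gamma>, R) = (tr_ctx D \<Gamma>, tr_rhs D R)"
  by (simp add: tr_judg_def)

lemma tr_ctx_simps [simp]: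
  "tr_ctx D [] = []" "tr_ctx D ((x, T) # \<Gamma>) = (x, tr D T) # tr_ctx D \<Gamma>"
  "tr_ctx D (\<Gamma> @ \<Delta>) = tr_ctx D \<Gamma> @ tr_ctx D \<Delta>" "length (tr_ctx D \<Gamma>) = length \<Gamma>"
  by (simp_all add: tr_ctx_def)

lemma map_fst_tr_ctx [simp]: "map fst (tr_ctx D \<Gamma>) = map fst \<Gamma>"
  by (simp add: tr_ctx_def case_prod_beta comp_def)

text \<open>Substituting into the arguments of \<open>w\<close> and then plugging them into \<open>D w\<close> is an associativity of
  substitution; the closed default of \<open>arg_subst\<close> is unaffected.\<close>

lemma tr_subst: "tr D (subst \<rho> e) = subst (tr D \<circ> \<rho>) (tr D e)"
proof (induction e)
  case (App w es)
  have "arg_subst (map (tr D) (map (subst \<rho>) es)) v = subst (tr D \<circ> \<rho>) (arg_subst (map (tr D) es) v)" for v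
    using App.IH by (auto simp: arg_subst_def comp_def)
  then have "arg_subst (map (tr D) (map (subst \<rho>) es)) = (\<lambda>v. subst (tr D \<circ> \<rho>) (arg_subst (map (tr D) es) v))"
    by blast
  then show ?case by (simp only: subst.simps tr.simps subst_subst)
qed simp

lemma tr_rhs_subst_rhs: "tr_rhs D (subst_rhs \<rho> R) = subst_rhs (tr D \<circ> \<rho>) (tr_rhs D R)"
  by (cases R) (auto simp: tr_subst)

lemma tr_ctx_subst_ctx: "tr_ctx D (subst_ctx \<rho> \<Gamma>) = subst_ctx (tr D \<circ> \<rho>) (tr_ctx D \<Gamma>)"
  by (auto simp: tr_ctx_def subst_ctx_def tr_subst)

lemma tr_comp_single [simp]: "tr D \<circ> single t y = single (tr D t) y"
  by (auto simp: single_def)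

lemma tr_comp_Var [simp]: "tr D \<circ> (Var \<circ> \<sigma>) = Var \<circ> \<sigma>"
  by auto

lemma tr_judg_permute: "tr_judg D (permute \<sigma> J) = permute \<sigma> (tr_judg D J)"
  by (auto simp: tr_judg_def permute_def tr_ctx_def tr_rhs_subst_rhs tr_subst)

text \<open>Translation leaves context variables alone and commutes with substitution, and every rule is
  stated by means of these two.\<close>

lemma rule_tr_judg: "rule r Js J \<Longrightarrow> rule r (map (tr_judg D) Js) (tr_judg D J)"
proof (induction rule: rule.induct)
  case (9 \<sigma> J)
  then show ?case by (simp add: tr_judg_permute rule.intros)
next
  case (10 \<Gamma> t T y \<Delta> R)
  then show ?case by (simp add: tr_ctx_subst_ctx tr_rhs_subst_rhs rule.intros)
next
  case (11 \<Gamma> t1 t2 T y \<Delta> T')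
  then show ?case by (simp add: tr_ctx_subst_ctx tr_subst rule.intros)
next
  case (12 \<Gamma> t1 t2 T y \<Delta> t' T')
  then show ?case by (simp add: tr_ctx_subst_ctx tr_subst rule.intros)
qed (simp_all add: rule.intros)

lemma rule_functional: "rule r Js J \<Longrightarrow> rule r Js K \<Longrightarrow> J = K"
  by (induction rule: rule.induct) (auto elim: rule.cases)

lemma kind_of_tr_judg: "kind_of (tr_judg D J) = kind_of J"
  by (cases J rule: kind_of.cases) auto

lemma boundary_tr_judg: "boundary (tr_judg D J) = map (tr_judg D) (boundary J)"
proof (cases J rule: boundary.cases)
  case (1 \<Gamma> T)
  then show ?thesis by (cases \<Gamma> rule: rev_cases) auto
qed auto

lemma tr_judg_derivable:
  assumes "\<And>J. J \<in> \<Lambda> \<Longrightarrow> tr_judg D J \<in> derivable \<Lambda>'"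
  shows "J \<in> derivable \<Lambda> \<Longrightarrow> tr_judg D J \<in> derivable \<Lambda>'"
proof (induction rule: derivable.induct)
  case (deduce Js r J)
  then show ?case by (intro derivable.deduce[OF _ rule_tr_judg[OF deduce(2)]]) auto
qed (use assms in simp)

lemma is_interp_tr_judg:
  assumes "is_gat T" "is_gat U" "\<And>J. J \<in> basic_judgs T \<Longrightarrow> tr_judg D J \<in> derived U"
  shows "is_interp T U (tr_judg D)"
  unfolding is_interp_def
proof (intro conjI ballI allI impI)
  show "tr_judg D J \<in> derived U" if "J \<in> derived T" for J
    using tr_judg_derivable[OF assms(3) that] .
  show "tr_judg D J = K" if "rule r Js J" "rule r (map (tr_judg D) Js) K" for r Js J K
    using rule_functional[OF rule_tr_judg[OF that(1)] that(2)] .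
qed (simp_all add: assms(1,2) kind_of_tr_judg boundary_tr_judg)

text \<open>In particular, translation preserves equality of normal forms.\<close>

lemma nf_tr_judg: "nf (tr_judg D J) = (case nf J of (Ts, R) \<Rightarrow> (map (tr D) Ts, tr_rhs D R))"
  by (simp add: nf_def tr_judg_def tr_rhs_subst_rhs[symmetric])
    (simp add: tr_ctx_def case_prod_beta tr_subst tr_rhs_subst_rhs)

lemma is_gat_G:
  assumes Y: "is_psh Y"
  shows "is_gat (G Y)"
  unfolding is_gat_def
proof (intro conjI ballI)
  fix J assume "J \<in> basic_judgs (G Y)"
  then consider n A where "J = ty_judg Y n A" "A \<in> ty_el Y n" | n a where "J = tm_judg Y n a" "a \<in> tm_el Y n"
    by (auto simp: G_def)
  note basic_cases = this
  have ctx: "consts_exp T \<subseteq> type_consts (G Y) <+> term_consts (G Y)"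
    if "A \<in> ty_el Y n" "(x, T) \<in> set (gen_ctx Y n A)" for A n x T
    using that iter_bd_in[OF Y] by (auto simp: gen_ctx_def gen_app_def G_def)
  show "judg_over (type_consts (G Y) <+> term_consts (G Y)) J"
    using basic_cases
  proof cases
    case 1
    then show ?thesis using ctx[of A n]
      by (auto simp: judg_over_def ty_judg_def simp del: set_map) (auto simp: G_def gen_app_def)
  next
    case 2
    note bd = bd_tm_in[OF Y 2(2)]
    then show ?thesis using 2 ctx[OF bd]
      by (auto simp: judg_over_def tm_judg_def simp del: set_map) (auto simp: G_def gen_app_def)
  qed
  show "(\<exists>A \<in> type_consts (G Y). introduces_type A J) \<or> (\<exists>f \<in> term_consts (G Y). introduces_term f J)
      \<or> kind_of J \<in> {TypeEqKind, TermEqKind}"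
    using basic_cases
  proof cases
    case 1
    then have "introduces_type (n, A) J"
      by (auto simp: introduces_type_def ty_judg_def gen_app_def simp flip: map_map)
    then show ?thesis using 1 by (force simp: G_def)
  next
    case 2
    then have "introduces_term (n, a) J"
      by (auto simp: introduces_term_def tm_judg_def simp flip: map_map)
    then show ?thesis using 2 by (force simp: G_def)
  qed
next
  fix A assume "A \<in> type_consts (G Y)"
  then obtain n B where A: "A = (n, B)" "B \<in> ty_el Y n" by (auto simp: G_def)
  show "\<exists>!J. J \<in> basic_judgs (G Y) \<and> introduces_type A J"
  proof (rule ex1I)
    show "ty_judg Y n B \<in> basic_judgs (G Y) \<and> introduces_type A (ty_judg Y n B)"
      using A by (auto simp: G_def introduces_type_def ty_judg_def gen_app_def simp flip: map_map)
    show "J = ty_judg Y n B" if "J \<in> basic_judgs (G Y) \<and> introduces_type A J" for J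
      using that A by (auto simp: G_def introduces_type_def ty_judg_def tm_judg_def gen_app_def)
  qed
next
  fix f assume "f \<in> term_consts (G Y)"
  then obtain n a where a: "f = (n, a)" "a \<in> tm_el Y n" by (auto simp: G_def)
  show "\<exists>!J. J \<in> basic_judgs (G Y) \<and> introduces_term f J"
  proof (rule ex1I)
    show "tm_judg Y n a \<in> basic_judgs (G Y) \<and> introduces_term f (tm_judg Y n a)"
      using a by (auto simp: G_def introduces_term_def tm_judg_def simp flip: map_map)
    show "J = tm_judg Y n a" if "J \<in> basic_judgs (G Y) \<and> introduces_term f J" for J
      using that a by (auto simp: G_def introduces_term_def ty_judg_def tm_judg_def)
  qed
next
  show "basic_judgs (G Y) \<subseteq> derived (G Y)"
    using type_generators_derived[OF Y] term_generators_derived[OF Y] by (auto simp: G_def)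
qed

section \<open>Interpretations of free GATs are determined by generators\<close>

text \<open>The effect of a substitution for the variable in position \<open>m + 1\<close> on positions: later positions move
  down by one. The term \<open>u\<close> lives over the first \<open>m\<close> positions, which do not move.\<close>

definition shift_subst :: "nat \<Rightarrow> 'c exp \<Rightarrow> var \<Rightarrow> 'c exp" where
  "shift_subst m u i = (if i \<le> m then Var i else if i = Suc m then u else Var (i - 1))"

fun nf_subst :: "nat \<Rightarrow> 'c exp \<Rightarrow> 'c exp list \<times> 'c rhs \<Rightarrow> 'c exp list \<times> 'c rhs" where
  "nf_subst m u (Ts, R) =
     (map (subst (shift_subst m u)) (take m Ts @ drop (Suc m) Ts), subst_rhs (shift_subst m u) R)"

text \<open>The normal form of a substituted judgement depends on the two premises only through their normal
  forms. This is what lets an argument about normal forms pass the substitution rule.\<close>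

lemma nf_of_subst:
  assumes Y: "is_psh Y" and t: "(\<Gamma>, HasType t T) \<in> eqfree Y" and J: "(\<Gamma> @ (y, T) # \<Delta>, R) \<in> eqfree Y"
  shows "nf (\<Gamma> @ subst_ctx (single t y) \<Delta>, subst_rhs (single t y) R)
       = nf_subst (length \<Gamma>) (std \<Gamma> t) (nf (\<Gamma> @ (y, T) # \<Delta>, R))"
proof -
  let ?\<Delta> = "subst_ctx (single t y) \<Delta>" and ?\<theta> = "shift_subst (length \<Gamma>) (std \<Gamma> t)"
  let ?old = "posn (map fst (\<Gamma> @ (y, T) # \<Delta>))" and ?new = "posn (map fst (\<Gamma> @ ?\<Delta>))"
  have d: "distinct (map fst \<Gamma> @ y # map fst \<Delta>)" using scoped_distinct[OF J] by simp
  then have d': "distinct (map fst \<Gamma> @ map fst \<Delta>)" by simp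
  have pointwise: "subst (Var \<circ> ?new) (single t y v) = subst ?\<theta> ((Var \<circ> ?old) v)"
    if "v \<in> set (map fst (\<Gamma> @ (y, T) # \<Delta>))" for v
  proof -
    \<comment> \<open>The positions of \<open>v\<close> before and after removing \<open>y\<close> from the context are compared.\<close>
    from that consider "v \<in> set (map fst \<Gamma>)" | "v = y" | "v \<in> set (map fst \<Delta>)" by auto
    then show ?thesis
    proof cases
      case 1
      then have "v \<noteq> y" using d by auto
      moreover have "?new v = posn (map fst \<Gamma>) v" "?old v = posn (map fst \<Gamma>) v"
        using posn_append[OF 1] by simp_all
      moreover have "posn (map fst \<Gamma>) v \<le> length \<Gamma>" using posn_le[OF 1] by simp
      ultimately show ?thesis by (simp add: single_def shift_subst_def)
    next
      case 2
      have "?old y = Suc (length \<Gamma>)" using posn_nth[OF d, of "length \<Gamma>"] nth_append_length[of "map fst \<Gamma>" y "map fst \<Delta>"] by simp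
      moreover have "subst (Var \<circ> ?new) t = std \<Gamma> t"
        using scoped_rhs[OF t] posn_append[of _ "map fst \<Gamma>" "map fst ?\<Delta>"]
        by (intro subst_cong) (simp add: subset_iff)
      ultimately show ?thesis using 2 by (simp add: single_def shift_subst_def)
    next
      case 3
      then obtain i where i: "i < length \<Delta>" "v = map fst \<Delta> ! i" by (metis in_set_conv_nth length_map)
      have "v \<noteq> y" using 3 d by auto
      moreover have "?old v = Suc (Suc (length \<Gamma> + i))"
        using posn_nth[OF d, of "Suc (length \<Gamma> + i)"] i by (simp add: nth_append)
      moreover have "?new v = Suc (length \<Gamma> + i)"
        using posn_nth[OF d', of "length \<Gamma> + i"] i by (simp add: nth_append)
      ultimately show ?thesis by (simp add: single_def shift_subst_def)
    qed
  qed
  have e: "subst (Var \<circ> ?new) (subst (single t y) e) = subst ?\<theta> (subst (Var \<circ> ?old) e)"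
    if "fv e \<subseteq> set (map fst (\<Gamma> @ (y, T) # \<Delta>))" for e
    unfolding subst_subst using that pointwise by (intro subst_cong) blast
  have "subst_rhs (Var \<circ> ?new) (subst_rhs (single t y) R) = subst_rhs ?\<theta> (subst_rhs (Var \<circ> ?old) R)"
    unfolding subst_rhs_subst_rhs using scoped_rhs[OF J] pointwise by (intro subst_rhs_cong) blast
  moreover have "subst (Var \<circ> ?new) (snd p) = subst ?\<theta> (subst (Var \<circ> ?old) (snd p))" if p: "p \<in> set \<Gamma>" for p
  proof -
    have "fv (snd p) \<subseteq> set (map fst \<Gamma>)" using scoped_ctx_all[OF Y t, of "fst p" "snd p"] p by simp
    moreover from this have "subst (single t y) (snd p) = snd p"
      using d by (intro subst_ident) (auto simp: single_def)
    ultimately show ?thesis using e[of "snd p"] by auto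
  qed
  moreover have "subst (Var \<circ> ?new) (subst (single t y) (snd p)) = subst ?\<theta> (subst (Var \<circ> ?old) (snd p))"
    if "p \<in> set \<Delta>" for p
    using scoped_ctx_all[OF Y J, of "fst p" "snd p"] that by (intro e) auto
  ultimately show ?thesis by (simp add: nf_simp) (simp add: subst_ctx_def case_prod_beta)
qed

lemma interp_eqfree:
  assumes "is_psh Y" "is_psh Z" "is_interp (G Y) (G Z) \<phi>" "J \<in> eqfree Y"
  shows "\<phi> J \<in> eqfree Z" "kind_of (\<phi> J) = kind_of J"
proof -
  have *: "\<phi> J \<in> derived (G Z)" "kind_of (\<phi> J) = kind_of J"
    using assms(3) eqfree_derived[OF assms(1,4)] unfolding is_interp_def by blast+
  then show "kind_of (\<phi> J) = kind_of J" by simp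
  have "kind_of J = TypeKind \<or> kind_of J = TermKind" using eqfree_kind[OF assms(4)] by (cases J) auto
  then show "\<phi> J \<in> eqfree Z"
    using * derived_reflexive_over[OF assms(2) *(1)] by (cases "\<phi> J" rule: kind_of.cases) auto
qed

lemma interp_boundary:
  assumes "is_psh Y" "is_interp (G Y) (G Z) \<phi>" "J \<in> eqfree Y"
  shows "boundary (\<phi> J) = map \<phi> (boundary J)"
  using assms(2) eqfree_derived[OF assms(1,3)] unfolding is_interp_def by blast

lemma kind_of_TypeKind: "kind_of J = TypeKind \<Longrightarrow> \<exists>\<Gamma> T. J = (\<Gamma>, IsType T)"
  by (cases J rule: kind_of.cases) auto

lemma kind_of_TermKind: "kind_of J = TermKind \<Longrightarrow> \<exists>\<Gamma> t T. J = (\<Gamma>, HasType t T)"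
  by (cases J rule: kind_of.cases) auto

text \<open>An interpretation need not preserve the names of variables, and it is a function of judgements
  rather than of contexts. But it preserves boundaries, so its value on a judgement in an extended
  context extends its value on the boundary.\<close>

lemma interp_ctx_extension_type:
  assumes Y: "is_psh Y" and Z: "is_psh Z" and \<phi>: "is_interp (G Y) (G Z) \<phi>"
    and \<Gamma>: "\<phi> (\<Gamma>, IsType T) = (\<Gamma>', IsType T')"
  shows "(\<Gamma> @ (y, T) # \<Delta>, IsType W) \<in> eqfree Y \<Longrightarrow>
    \<exists>y' \<Delta>' W'. \<phi> (\<Gamma> @ (y, T) # \<Delta>, IsType W) = (\<Gamma>' @ (y', T') # \<Delta>', IsType W')"
proof (induction \<Delta> arbitrary: W rule: rev_induct)
  case Nil
  obtain \<Theta> W' where *: "\<phi> (\<Gamma> @ [(y, T)], IsType W) = (\<Theta>, IsType W')"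
    using interp_eqfree(2)[OF Y Z \<phi> Nil] kind_of_TypeKind by fastforce
  have "boundary (\<Theta>, IsType W') = [(\<Gamma>', IsType T')]"
    using interp_boundary[OF Y \<phi> Nil] * \<Gamma> by simp
  then have "\<Theta> \<noteq> []" "butlast \<Theta> = \<Gamma>'" "snd (last \<Theta>) = T'" by (auto split: if_splits)
  then have "\<Theta> = \<Gamma>' @ [(fst (last \<Theta>), T')]" by (metis append_butlast_last_id prod.collapse)
  then show ?case using * by auto
next
  case (snoc p \<Delta>)
  obtain z W1 where p: "p = (z, W1)" by (cases p)
  have prems: "((\<Gamma> @ (y, T) # \<Delta>) @ [(z, W1)], IsType W) \<in> eqfree Y" using snoc.prems p by simp
  then have "(\<Gamma> @ (y, T) # \<Delta>, IsType W1) \<in> eqfree Y" using eqfree_prefix[OF Y] by blast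
  then obtain y' \<Delta>' W' where IH: "\<phi> (\<Gamma> @ (y, T) # \<Delta>, IsType W1) = (\<Gamma>' @ (y', T') # \<Delta>', IsType W')"
    using snoc.IH by blast
  obtain \<Theta> W'' where *: "\<phi> ((\<Gamma> @ (y, T) # \<Delta>) @ [(z, W1)], IsType W) = (\<Theta>, IsType W'')"
    using interp_eqfree(2)[OF Y Z \<phi> prems] kind_of_TypeKind by fastforce
  have "boundary (\<Theta>, IsType W'') = [(\<Gamma>' @ (y', T') # \<Delta>', IsType W')]"
    using interp_boundary[OF Y \<phi> prems] * IH by (simp add: butlast_append)
  then have "\<Theta> \<noteq> []" "butlast \<Theta> = \<Gamma>' @ (y', T') # \<Delta>'" by (auto split: if_splits)
  then have "\<Theta> = \<Gamma>' @ (y', T') # (\<Delta>' @ [last \<Theta>])" by (metis append_butlast_last_id append.assoc append_Cons)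
  then show ?case using * p by auto
qed

lemma interp_ctx_extension:
  assumes Y: "is_psh Y" and Z: "is_psh Z" and \<phi>: "is_interp (G Y) (G Z) \<phi>"
    and \<Gamma>: "\<phi> (\<Gamma>, IsType T) = (\<Gamma>', IsType T')"
    and J: "(\<Gamma> @ (y, T) # \<Delta>, R) \<in> eqfree Y"
  shows "\<exists>y' \<Delta>' R'. \<phi> (\<Gamma> @ (y, T) # \<Delta>, R) = (\<Gamma>' @ (y', T') # \<Delta>', R')"
proof -
  consider W where "R = IsType W" | w W where "R = HasType w W" using eqfree_kind[OF J] by auto
  then show ?thesis
  proof cases
    case 1
    then show ?thesis using interp_ctx_extension_type[OF Y Z \<phi> \<Gamma>] J by blast
  next
    case 2
    have "(\<Gamma> @ (y, T) # \<Delta>, IsType W) \<in> eqfree Y" using J 2 eqfree_type_of_term[OF Y] by blast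
    then obtain y' \<Delta>' W' where *: "\<phi> (\<Gamma> @ (y, T) # \<Delta>, IsType W) = (\<Gamma>' @ (y', T') # \<Delta>', IsType W')"
      using interp_ctx_extension_type[OF Y Z \<phi> \<Gamma>] by blast
    obtain \<Theta> w'' W'' where **: "\<phi> (\<Gamma> @ (y, T) # \<Delta>, R) = (\<Theta>, HasType w'' W'')"
      using interp_eqfree(2)[OF Y Z \<phi> J] 2 kind_of_TermKind by fastforce
    have "boundary (\<Theta>, HasType w'' W'') = [(\<Gamma>' @ (y', T') # \<Delta>', IsType W')]"
      using interp_boundary[OF Y \<phi> J] * ** 2 by simp
    then show ?thesis using ** by auto
  qed
qed

text \<open>An interpretation commutes with the substitution rule: by the preceding lemma, the images of the two
  premises share the context and the type that the rule requires them to share.\<close>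

lemma interp_subst:
  assumes Y: "is_psh Y" and Z: "is_psh Z" and \<phi>: "is_interp (G Y) (G Z) \<phi>"
    and t: "(\<Gamma>, HasType t T) \<in> eqfree Y" and J: "(\<Gamma> @ (y, T) # \<Delta>, R) \<in> eqfree Y"
    and t': "\<phi> (\<Gamma>, HasType t T) = (\<Gamma>', HasType t' T')"
  shows "nf (\<phi> (\<Gamma> @ subst_ctx (single t y) \<Delta>, subst_rhs (single t y) R))
       = nf_subst (length \<Gamma>') (std \<Gamma>' t') (nf (\<phi> (\<Gamma> @ (y, T) # \<Delta>, R)))"
proof -
  have "\<phi> (\<Gamma>, IsType T) = (\<Gamma>', IsType T')"
    using interp_boundary[OF Y \<phi> t] t' by simp
  from interp_ctx_extension[OF Y Z \<phi> this J] obtain y' \<Delta>' R'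
    where J': "\<phi> (\<Gamma> @ (y, T) # \<Delta>, R) = (\<Gamma>' @ (y', T') # \<Delta>', R')" by blast
  have "set [(\<Gamma>, HasType t T), (\<Gamma> @ (y, T) # \<Delta>, R)] \<subseteq> derived (G Y)"
    using eqfree_derived[OF Y] t J by simp
  moreover have "rule Subst (map \<phi> [(\<Gamma>, HasType t T), (\<Gamma> @ (y, T) # \<Delta>, R)])
      (\<Gamma>' @ subst_ctx (single t' y') \<Delta>', subst_rhs (single t' y') R')"
    using rule.intros(10) by (simp add: t' J')
  ultimately have "\<phi> (\<Gamma> @ subst_ctx (single t y) \<Delta>, subst_rhs (single t y) R)
      = (\<Gamma>' @ subst_ctx (single t' y') \<Delta>', subst_rhs (single t' y') R')"
    using \<phi> rule.intros(10)[of \<Gamma> t T y \<Delta> R] unfolding is_interp_def by blast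
  moreover have "(\<Gamma>', HasType t' T') \<in> eqfree Z" "(\<Gamma>' @ (y', T') # \<Delta>', R') \<in> eqfree Z"
    using interp_eqfree(1)[OF Y Z \<phi> t] interp_eqfree(1)[OF Y Z \<phi> J] t' J' by simp_all
  ultimately show ?thesis using nf_of_subst[OF Z] J' by simp
qed

text \<open>The uniqueness half of the universal property of the free GAT.\<close>

lemma interp_determined_by_generators:
  assumes Y: "is_psh Y" and Z: "is_psh Z"
    and \<phi>: "is_interp (G Y) (G Z) \<phi>" and \<psi>: "is_interp (G Y) (G Z) \<psi>"
    and ty: "\<And>n A. A \<in> ty_el Y n \<Longrightarrow> nf (\<phi> (ty_judg Y n A)) = nf (\<psi> (ty_judg Y n A))"
    and tm: "\<And>n a. a \<in> tm_el Y n \<Longrightarrow> nf (\<phi> (tm_judg Y n a)) = nf (\<psi> (tm_judg Y n a))"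
  shows "J \<in> eqfree Y \<Longrightarrow> nf (\<phi> J) = nf (\<psi> J)"
proof (induction rule: eqfree.induct)
  case (perm \<sigma> J)
  have "\<chi> (permute \<sigma> J) = permute \<sigma> (\<chi> J)" if "is_interp (G Y) (G Z) \<chi>" for \<chi>
  proof -
    have "set [J] \<subseteq> derived (G Y)" using eqfree_derived[OF Y perm.hyps(2)] by simp
    moreover have "rule (Perm \<sigma>) (map \<chi> [J]) (permute \<sigma> (\<chi> J))" using rule.intros(9)[OF perm.hyps(1)] by simp
    ultimately show ?thesis
      using that rule.intros(9)[OF perm.hyps(1)] unfolding is_interp_def by blast
  qed
  then show ?case using \<phi> \<psi> perm.IH nf_permute[OF perm.hyps(1)] by metis
next
  case (subst \<Gamma> t T y \<Delta> R)
  obtain \<Gamma>1 t1 T1 where 1: "\<phi> (\<Gamma>, HasType t T) = (\<Gamma>1, HasType t1 T1)"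
    using interp_eqfree(2)[OF Y Z \<phi> subst.hyps(1)] kind_of_TermKind by fastforce
  obtain \<Gamma>2 t2 T2 where 2: "\<psi> (\<Gamma>, HasType t T) = (\<Gamma>2, HasType t2 T2)"
    using interp_eqfree(2)[OF Y Z \<psi> subst.hyps(1)] kind_of_TermKind by fastforce
  have "length \<Gamma>1 = length \<Gamma>2" "std \<Gamma>1 t1 = std \<Gamma>2 t2"
    using subst.IH(1) 1 2 by (auto simp: nf_simp dest: map_eq_imp_length_eq)
  then show ?case
    using interp_subst[OF Y Z \<phi> subst.hyps 1] interp_subst[OF Y Z \<psi> subst.hyps 2] subst.IH(2) by simp
qed (use ty tm in auto)

section \<open>The counit\<close>

definition class_nf :: "'c judg set \<Rightarrow> 'c exp list \<times> 'c rhs" where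
  "class_nf c = the_elem (nf ` c)"

fun type_of_rhs :: "'c rhs \<Rightarrow> 'c exp" where
  "type_of_rhs (IsType T) = T"
| "type_of_rhs (HasType t T) = T"
| "type_of_rhs (TypeEq T T') = T"
| "type_of_rhs (TermEq t t' T) = T"

fun term_of_rhs :: "'c rhs \<Rightarrow> 'c exp" where
  "term_of_rhs (HasType t T) = t"
| "term_of_rhs R = type_of_rhs R"

text \<open>The expression represented by a class, read off from its normal form. Translating along it is the
  counit: a constant of \<open>G (V T)\<close> is unfolded to the judgement of \<open>T\<close> that it names.\<close>

fun body :: "('c judg set, 'c judg set) free_const \<Rightarrow> 'c exp" where
  "body (Inl (n, c)) = type_of_rhs (snd (class_nf c))"
| "body (Inr (n, c)) = term_of_rhs (snd (class_nf c))"

lemma class_nf_judg_class: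
  assumes "is_psh Y" "J \<in> eqfree Y"
  shows "class_nf (judg_class (G Y) J) = nf J"
  unfolding class_nf_def by (rule the_elem_judg_class_image[OF assms])

lemma iter_bd_V:
  assumes Y: "is_psh Y"
  shows "\<lbrakk>(\<Gamma>, IsType T) \<in> eqfree Y; i \<le> length \<Gamma>\<rbrakk> \<Longrightarrow>
    iter_bd (V (G Y)) (Suc (length \<Gamma>)) (Suc i) (judg_class (G Y) (\<Gamma>, IsType T))
      = judg_class (G Y) (take i \<Gamma>, IsType ((map snd \<Gamma> @ [T]) ! i))"
proof (induction \<Gamma> arbitrary: T rule: rev_induct)
  case (snoc p \<Gamma>)
  obtain x W where p: "p = (x, W)" by (cases p)
  have W: "(\<Gamma>, IsType W) \<in> eqfree Y" using snoc.prems(1) eqfree_prefix[OF Y, of \<Gamma> x W "[]"] p by simp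
  have J: "(\<Gamma> @ [(x, W)], IsType T) \<in> eqfree Y" using snoc.prems(1) p by simp
  show ?case
  proof (cases "i = length (\<Gamma> @ [p])")
    case False
    then have i: "i \<le> length \<Gamma>" using snoc.prems(2) by simp
    have "iter_bd (V (G Y)) (Suc (length (\<Gamma> @ [p]))) (Suc i) (judg_class (G Y) (\<Gamma> @ [p], IsType T))
        = iter_bd (V (G Y)) (Suc (length \<Gamma>)) (Suc i) (judg_class (G Y) (\<Gamma>, IsType W))"
      using bd_ty_V[OF Y J] i by (simp add: p)
    also have "\<dots> = judg_class (G Y) (take i \<Gamma>, IsType ((map snd \<Gamma> @ [W]) ! i))"
      using snoc.IH[OF W i] .
    finally show ?thesis using i by (auto simp: p nth_append)
  qed (simp add: nth_append)
qed simp

lemma fv_std: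
  assumes "fv T \<subseteq> set (map fst \<Gamma>)"
  shows "fv (std \<Gamma> T) \<subseteq> {1..length \<Gamma>}"
  using assms posn_le[of _ "map fst \<Gamma>"] posn_ge_1[of "map fst \<Gamma>"] by (fastforce simp: fv_subst)

lemma arg_subst_standard:
  assumes "fv e \<subseteq> {1..n}"
  shows "subst (arg_subst (map Var [1..<Suc n])) e = e"
  using assms by (intro subst_ident) (auto simp: arg_subst_def simp del: upt_Suc)

lemma tr_body_gen_app:
  assumes Y: "is_psh Y" and J: "(\<Gamma>, IsType T) \<in> eqfree Y"
  shows "tr body (gen_app (Suc (length \<Gamma>)) (judg_class (G Y) (\<Gamma>, IsType T))) = std \<Gamma> T"
proof -
  have "fv (std \<Gamma> T) \<subseteq> {1..length \<Gamma>}" using scoped_rhs[OF J] by (intro fv_std) simp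
  then show ?thesis
    unfolding gen_app_def using arg_subst_standard[of "std \<Gamma> T" "length \<Gamma>"]
    by (simp add: class_nf_judg_class[OF Y J] nf_simp comp_def del: upt_Suc)
qed

lemma tr_body_gen_ctx:
  assumes Y: "is_psh Y" and J: "(\<Gamma>, IsType T) \<in> eqfree Y"
  shows "tr_ctx body (gen_ctx (V (G Y)) (Suc (length \<Gamma>)) (judg_class (G Y) (\<Gamma>, IsType T)))
       = zip [1..<Suc (length \<Gamma>)] (map (std \<Gamma> \<circ> snd) \<Gamma>)"
proof (rule nth_equalityI, goal_cases)
  case (2 i)
  then have i: "i < length \<Gamma>" by simp
  have "(take i \<Gamma>, IsType (snd (\<Gamma> ! i))) \<in> eqfree Y" using eqfree_take[OF Y J i] .
  from tr_body_gen_app[OF Y this] i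
  have "tr body (gen_app (Suc i) (iter_bd (V (G Y)) (Suc (length \<Gamma>)) (Suc i) (judg_class (G Y) (\<Gamma>, IsType T))))
      = std (take i \<Gamma>) (snd (\<Gamma> ! i))"
    using iter_bd_V[OF Y J, of i] by (simp add: nth_append del: iter_bd.simps)
  also have "\<dots> = std \<Gamma> (snd (\<Gamma> ! i))" using scoped_ctx[OF Y J i] by (rule std_take)
  finally show ?case using i by (simp add: tr_ctx_def gen_ctx_nth del: upt_Suc iter_bd.simps)
qed (simp del: upt_Suc)

text \<open>A generator applies its constant to the standard variables in order, hence is translated to the
  standard representative of the class.\<close>

lemma tr_body_ty_judg:
  assumes Y: "is_psh Y" and c: "c \<in> ty_el (V (G Y)) n"
  shows "tr_judg body (ty_judg (V (G Y)) n c) \<in> c"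
    and "nf (tr_judg body (ty_judg (V (G Y)) n c)) = class_nf c"
proof -
  obtain \<Gamma> T where J: "(\<Gamma>, IsType T) \<in> eqfree Y" and c: "c = judg_class (G Y) (\<Gamma>, IsType T)"
    and n: "n = Suc (length \<Gamma>)"
    using c V_G_ty[OF Y] by auto
  have *: "tr_judg body (ty_judg (V (G Y)) n c) = of_nf (nf (\<Gamma>, IsType T))"
    unfolding ty_judg_def n c by (simp add: nf_simp tr_body_gen_ctx[OF Y J] tr_body_gen_app[OF Y J] del: upt_Suc)
  show "tr_judg body (ty_judg (V (G Y)) n c) \<in> c"
    unfolding * unfolding c judg_class_eq[OF Y J]
    using of_nf_nf_eqfree[OF Y J] nf_of_nf_nf[OF Y J] by blast
  show "nf (tr_judg body (ty_judg (V (G Y)) n c)) = class_nf c"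
    unfolding * unfolding c class_nf_judg_class[OF Y J] using nf_of_nf_nf[OF Y J] .
qed

lemma tr_body_tm_judg:
  assumes Y: "is_psh Y" and c: "c \<in> tm_el (V (G Y)) n"
  shows "tr_judg body (tm_judg (V (G Y)) n c) \<in> c"
    and "nf (tr_judg body (tm_judg (V (G Y)) n c)) = class_nf c"
proof -
  obtain \<Gamma> t T where J: "(\<Gamma>, HasType t T) \<in> eqfree Y" and c: "c = judg_class (G Y) (\<Gamma>, HasType t T)"
    and n: "n = Suc (length \<Gamma>)"
    using c V_G_tm[OF Y] by auto
  note T = eqfree_type_of_term[OF Y J]
  have "fv (std \<Gamma> t) \<subseteq> {1..length \<Gamma>}" using scoped_rhs[OF J] by (intro fv_std) simp
  then have "tr body (App (Inr (n, c)) (map Var [1..<n])) = std \<Gamma> t"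
    using arg_subst_standard[of "std \<Gamma> t" "length \<Gamma>"] unfolding n c
    by (simp add: class_nf_judg_class[OF Y J] nf_simp comp_def del: upt_Suc)
  then have *: "tr_judg body (tm_judg (V (G Y)) n c) = of_nf (nf (\<Gamma>, HasType t T))"
    unfolding tm_judg_def n c
    by (simp add: nf_simp bd_tm_V[OF Y J] tr_body_gen_ctx[OF Y T] tr_body_gen_app[OF Y T] del: upt_Suc tr.simps)
  show "tr_judg body (tm_judg (V (G Y)) n c) \<in> c"
    unfolding * unfolding c judg_class_eq[OF Y J]
    using of_nf_nf_eqfree[OF Y J] nf_of_nf_nf[OF Y J] by blast
  show "nf (tr_judg body (tm_judg (V (G Y)) n c)) = class_nf c"
    unfolding * unfolding c class_nf_judg_class[OF Y J] using nf_of_nf_nf[OF Y J] .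
qed

lemma class_nf_member:
  assumes Y: "is_psh Y" and c: "c \<in> ty_el (V (G Y)) n \<or> c \<in> tm_el (V (G Y)) n" and K: "K \<in> c"
  shows "nf K = class_nf c" "K \<in> eqfree Y"
proof -
  obtain J where "J \<in> eqfree Y" "c = judg_class (G Y) J" using c V_G_ty[OF Y] V_G_tm[OF Y] by auto
  then show "nf K = class_nf c" "K \<in> eqfree Y"
    using K class_nf_judg_class[OF Y] judg_class_eq[OF Y] by auto
qed

lemma is_interp_body:
  assumes Y: "is_psh Y"
  shows "is_interp (G (V (G Y))) (G Y) (tr_judg body)"
proof (rule is_interp_tr_judg[OF is_gat_G[OF is_psh_V[OF Y]] is_gat_G[OF Y]])
  fix J assume "J \<in> basic_judgs (G (V (G Y)))"
  then consider n c where "J = ty_judg (V (G Y)) n c" "c \<in> ty_el (V (G Y)) n"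
    | n c where "J = tm_judg (V (G Y)) n c" "c \<in> tm_el (V (G Y)) n"
    by (auto simp: G_def[of "V (G Y)"])
  then show "tr_judg body J \<in> derived (G Y)"
  proof cases
    case 1
    then show ?thesis
      using tr_body_ty_judg(1)[OF Y 1(2)] class_nf_member(2)[OF Y] eqfree_derived[OF Y] by blast
  next
    case 2
    then show ?thesis
      using tr_body_tm_judg(1)[OF Y 2(2)] class_nf_member(2)[OF Y] eqfree_derived[OF Y] by blast
  qed
qed

text \<open>The translation shows that the description of the counit is satisfiable, so that the chosen
  interpretation does satisfy it.\<close>

lemma is_counit_counit:
  assumes Y: "is_psh Y"
  shows "is_counit (G Y) (counit (G Y))"
proof -
  have "is_counit (G Y) (tr_judg body)"
    using is_interp_body[OF Y] tr_body_ty_judg(1)[OF Y] tr_body_tm_judg(1)[OF Y] by (simp add: is_counit_def)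
  then show ?thesis unfolding counit_def by (rule someI[of "is_counit (G Y)"])
qed

lemma nf_counit:
  assumes Y: "is_psh Y" and J: "J \<in> eqfree (V (G Y))"
  shows "nf (counit (G Y) J) = nf (tr_judg body J)"
proof (rule interp_determined_by_generators[OF is_psh_V[OF Y] Y _ is_interp_body[OF Y] _ _ J])
  note C = is_counit_counit[OF Y, unfolded is_counit_def]
  show "is_interp (G (V (G Y))) (G Y) (counit (G Y))" using C by blast
  show "nf (counit (G Y) (ty_judg (V (G Y)) n A)) = nf (tr_judg body (ty_judg (V (G Y)) n A))"
    if "A \<in> ty_el (V (G Y)) n" for n A
    using that C class_nf_member(1)[OF Y] tr_body_ty_judg(2)[OF Y] by metis
  show "nf (counit (G Y) (tm_judg (V (G Y)) n a)) = nf (tr_judg body (tm_judg (V (G Y)) n a))"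
    if "a \<in> tm_el (V (G Y)) n" for n a
    using that C class_nf_member(1)[OF Y] tr_body_tm_judg(2)[OF Y] by metis
qed

text \<open>The chosen counit and the translation agree up to normal form, and the translation respects
  normal forms; so the class of the value is that of the translation.\<close>

lemma class_map_counit:
  assumes Y: "is_psh Y" and J: "J \<in> eqfree (V (G Y))"
  shows "class_map (G Y) (counit (G Y)) (judg_class (G (V (G Y))) J) = judg_class (G Y) (tr_judg body J)"
proof -
  have interp: "is_interp (G (V (G Y))) (G Y) (counit (G Y))"
    using is_counit_counit[OF Y] by (simp add: is_counit_def)
  have tr: "tr_judg body K \<in> eqfree Y" if "K \<in> eqfree (V (G Y))" for K
    using interp_eqfree(1)[OF is_psh_V[OF Y] Y is_interp_body[OF Y] that] .
  have *: "judg_class (G Y) (counit (G Y) K) = judg_class (G Y) (tr_judg body K)" if "K \<in> eqfree (V (G Y))" for K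
    using judg_class_eq_iff[OF Y] interp_eqfree(1)[OF is_psh_V[OF Y] Y interp that] tr[OF that] nf_counit[OF Y that]
    by blast
  have "judg_class (G Y) (counit (G Y) K) = judg_class (G Y) (counit (G Y) J)"
    if "K \<in> eqfree (V (G Y))" "nf K = nf J" for K
    using that J * tr judg_class_eq_iff[OF Y] nf_tr_judg by metis
  then show ?thesis
    unfolding class_map_def using the_elem_judg_class_image[OF is_psh_V[OF Y] J] *[OF J] by metis
qed

lemma mu_type:
  assumes X: "is_psh X" and J: "(\<Gamma>, IsType T) \<in> eqfree (V (G X))" and n: "n = Suc (length \<Gamma>)"
  shows "at_ty (mu X) n (judg_class (G (V (G X))) (\<Gamma>, IsType T)) = judg_class (G X) (tr_judg body (\<Gamma>, IsType T))"
proof -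
  have "judg_class (G (V (G X))) (\<Gamma>, IsType T) \<in> ty_el (V (G (V (G X)))) n"
    using J n by (auto simp: V_G_ty[OF is_psh_V[OF X]])
  then show ?thesis using class_map_counit[OF X J] by (simp add: mu_def V_map_def psh_restrict_def)
qed

lemma mu_term:
  assumes X: "is_psh X" and J: "(\<Gamma>, HasType t T) \<in> eqfree (V (G X))" and n: "n = Suc (length \<Gamma>)"
  shows "at_tm (mu X) n (judg_class (G (V (G X))) (\<Gamma>, HasType t T)) = judg_class (G X) (tr_judg body (\<Gamma>, HasType t T))"
proof -
  have "judg_class (G (V (G X))) (\<Gamma>, HasType t T) \<in> tm_el (V (G (V (G X)))) n"
    using J n by (auto simp: V_G_tm[OF is_psh_V[OF X]])
  then show ?thesis using class_map_counit[OF X J] by (simp add: mu_def V_map_def psh_restrict_def)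
qed

section \<open>Judgements of inc-lists\<close>

text \<open>The expressions \<open>e\<^sub>j\<close> before the final renaming: the variable in position \<open>j \<in> M\<close> keeps the name \<open>j\<close>,
  and the positions outside \<open>M\<close> are filled with the terms \<open>t j\<close>. For an inc-list, \<open>M\<close> consists of
  the values \<open>\<alpha>(m)\<close> with \<open>1 \<le> m < n\<close>.
  Keeping the original names makes the substitution of one more term a literal equality.\<close>

fun part_exp :: "nat set \<Rightarrow> (nat \<Rightarrow> 'b) \<Rightarrow> nat \<Rightarrow> ('a, 'b) free_const exp" where
  "part_exp M t j =
     (if j \<in> M then Var j else App (Inr (j, t j)) (map (\<lambda>i. part_exp M t i) [1..<j]))"

declare part_exp.simps [simp del]

definition part_type :: "nat set \<Rightarrow> (nat \<Rightarrow> 'a) \<Rightarrow> (nat \<Rightarrow> 'b) \<Rightarrow> nat \<Rightarrow> ('a, 'b) free_const exp" where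
  "part_type M A t i = App (Inl (i, A i)) (map (part_exp M t) [1..<i])"

definition part_ctx :: "nat set \<Rightarrow> (nat \<Rightarrow> 'a) \<Rightarrow> (nat \<Rightarrow> 'b) \<Rightarrow> nat \<Rightarrow> ('a, 'b) free_const ctx" where
  "part_ctx M A t n = map (\<lambda>i. (i, part_type M A t i)) (filter (\<lambda>i. i \<in> M) [1..<n])"

lemma part_exp_insert: "i < j \<Longrightarrow> part_exp (insert j M) t i = part_exp M t i"
proof (induction i rule: less_induct)
  case (less i)
  then show ?case by (subst (1 2) part_exp.simps) auto
qed

lemma part_type_insert: "i \<le> j \<Longrightarrow> part_type (insert j M) A t i = part_type M A t i"
  by (auto simp: part_type_def part_exp_insert)

lemma subst_part_exp:
  assumes "j \<notin> M"
  shows "subst (single (part_exp M t j) j) (part_exp (insert j M) t i) = part_exp M t i"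
proof (induction i rule: less_induct)
  case (less i)
  consider "i = j" | "i \<noteq> j" "i \<in> M" | "i \<noteq> j" "i \<notin> M" by blast
  then show ?case
  proof cases
    case 1
    then show ?thesis by (subst part_exp.simps[of "insert j M"]) (simp add: single_def)
  next
    case 3
    then show ?thesis using less by (simp add: part_exp.simps[of _ _ i])
  qed (simp_all add: part_exp.simps[of _ _ i] single_def)
qed

lemma subst_part_type:
  assumes "j \<notin> M"
  shows "subst (single (part_exp M t j) j) (part_type (insert j M) A t i) = part_type M A t i"
  by (simp add: part_type_def subst_part_exp[OF assms])

lemma part_ctx_insert:
  assumes "j \<in> {1..<n}" "j \<notin> M"
  obtains \<Delta> where "part_ctx (insert j M) A t n = part_ctx M A t j @ (j, part_type M A t j) # \<Delta>"
    and "part_ctx M A t n = part_ctx M A t j @ subst_ctx (single (part_exp M t j) j) \<Delta>"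
proof -
  let ?\<Delta> = "map (\<lambda>i. (i, part_type (insert j M) A t i)) (filter (\<lambda>i. i \<in> M) [Suc j..<n])"
  have upt: "[1..<n] = [1..<j] @ j # [Suc j..<n]"
    using assms(1) upt_add_eq_append[of 1 j "n - j"] by (simp add: upt_conv_Cons)
  have "filter (\<lambda>i. i \<in> insert j M) [1..<j] = filter (\<lambda>i. i \<in> M) [1..<j]"
    "filter (\<lambda>i. i \<in> insert j M) [Suc j..<n] = filter (\<lambda>i. i \<in> M) [Suc j..<n]"
    by (auto intro!: filter_cong)
  then have "part_ctx (insert j M) A t n = part_ctx M A t j @ (j, part_type M A t j) # ?\<Delta>"
    unfolding part_ctx_def upt by (auto simp: part_type_insert)
  moreover have "part_ctx M A t n = part_ctx M A t j @ subst_ctx (single (part_exp M t j) j) ?\<Delta>"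
    unfolding part_ctx_def upt using assms(2) by (simp add: subst_ctx_def subst_part_type)
  ultimately show thesis by (rule that)
qed

lemma map_part_exp_all:
  "\<lbrakk>{1..<n} \<subseteq> M; i \<le> n\<rbrakk> \<Longrightarrow> map (part_exp M t) [1..<i] = map Var [1..<i]"
  by (auto simp: part_exp.simps)

text \<open>If \<open>M\<close> contains all positions, this is the generator at \<open>A n\<close>. Otherwise, for a position \<open>j\<close> outside
  \<open>M\<close>, the judgement arises by substituting the term judgement of \<open>t j\<close> into the judgement for
  \<open>insert j M\<close>. Both have fewer missing positions: the first one ends at \<open>j\<close> and so does not miss \<open>j\<close>.\<close>

lemma part_eqfree:
  assumes Y: "is_psh Y"
  shows "\<lbrakk>1 \<le> n; A n \<in> ty_el Y n; \<And>i. \<lbrakk>1 \<le> i; i < n\<rbrakk> \<Longrightarrow> bd_ty Y i (A (Suc i)) = A i;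
      \<And>i. \<lbrakk>1 \<le> i; i < n; i \<notin> M\<rbrakk> \<Longrightarrow> t i \<in> Tm Y i (A i)\<rbrakk>
    \<Longrightarrow> (part_ctx M A t n, IsType (part_type M A t n)) \<in> eqfree Y
      \<and> (\<forall>a \<in> Tm Y n (A n). (part_ctx M A t n,
            HasType (App (Inr (n, a)) (map (part_exp M t) [1..<n])) (part_type M A t n)) \<in> eqfree Y)"
proof (induction "card ({1..<n} - M)" arbitrary: n M rule: less_induct)
  case less
  note A = less.prems(2,3) and t = less.prems(4)
  have iter: "i \<le> m \<Longrightarrow> 1 \<le> i \<Longrightarrow> m \<le> n \<Longrightarrow> iter_bd Y m i (A m) = A i" for i m
  proof (induction m)
    case (Suc m)
    then show ?case using A(2)[of m] by (cases "i = Suc m") auto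
  qed simp
  show ?case
  proof (cases "{1..<n} \<subseteq> M")
    case True
    have type: "part_type M A t i = gen_app i (A i)" if "i \<le> n" for i
      unfolding part_type_def gen_app_def map_part_exp_all[OF True that] by (rule refl)
    have "filter (\<lambda>i. i \<in> M) [1..<n] = [1..<n]" using True by (auto simp: filter_id_conv)
    then have ctx: "part_ctx M A t n = gen_ctx Y n (A n)"
      unfolding part_ctx_def gen_ctx_def using type iter[of _ n] by (intro map_cong) simp_all
    have "(part_ctx M A t n, HasType (App (Inr (n, a)) (map (part_exp M t) [1..<n])) (part_type M A t n)) \<in> eqfree Y"
      if "a \<in> Tm Y n (A n)" for a
    proof -
      have "a \<in> tm_el Y n" "bd_tm Y n a = A n" using that by (simp_all add: Tm_def)
      then show ?thesis
        using eqfree.tm[of a Y n] by (simp only: ctx type tm_judg_def map_part_exp_all[OF True] order_refl)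
    qed
    then show ?thesis
      using eqfree.ty[OF A(1)] by (simp add: ty_judg_def ctx type)
  next
    case False
    then obtain j where j: "j \<in> {1..<n}" "j \<notin> M" by blast
    have Aj: "A j \<in> ty_el Y j" using iter_bd_in[OF Y, of j n "A n"] iter[of j n] A(1) j by simp
    have smaller: "card B < card ({1..<n} - M)" if "B \<subseteq> {1..<n} - M - {j}" for B
    proof -
      have "card B \<le> card ({1..<n} - M - {j})" using that by (intro card_mono) auto
      also have "\<dots> < card ({1..<n} - M)" using j by (intro card_Diff1_less) auto
      finally show ?thesis .
    qed
    have card: "card ({1..<j} - M) < card ({1..<n} - M)" using j(1) by (intro smaller) auto
    have "\<forall>a \<in> Tm Y j (A j). (part_ctx M A t j,
        HasType (App (Inr (j, a)) (map (part_exp M t) [1..<j])) (part_type M A t j)) \<in> eqfree Y"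
      by (rule conjunct2[OF less.hyps[OF card _ Aj]]) (use j A(2) t in simp_all)
    moreover have "t j \<in> Tm Y j (A j)" using t j by simp
    ultimately have "(part_ctx M A t j, HasType (App (Inr (j, t j)) (map (part_exp M t) [1..<j])) (part_type M A t j)) \<in> eqfree Y"
      by blast
    then have tj: "(part_ctx M A t j, HasType (part_exp M t j) (part_type M A t j)) \<in> eqfree Y"
      using j(2) by (subst part_exp.simps) simp
    obtain \<Delta> where \<Delta>: "part_ctx (insert j M) A t n = part_ctx M A t j @ (j, part_type M A t j) # \<Delta>"
      "part_ctx M A t n = part_ctx M A t j @ subst_ctx (single (part_exp M t j) j) \<Delta>"
      by (rule part_ctx_insert[OF j])
    have "card ({1..<n} - insert j M) < card ({1..<n} - M)" by (intro smaller) auto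
    note IH' = less.hyps[OF this less.prems(1) A(1)]
    have IH: "(part_ctx (insert j M) A t n, IsType (part_type (insert j M) A t n)) \<in> eqfree Y"
      "\<And>a. a \<in> Tm Y n (A n) \<Longrightarrow> (part_ctx (insert j M) A t n,
          HasType (App (Inr (n, a)) (map (part_exp (insert j M) t) [1..<n])) (part_type (insert j M) A t n)) \<in> eqfree Y"
      using IH' A(2) t by blast+
    have "(part_ctx M A t n, IsType (part_type M A t n)) \<in> eqfree Y"
      using eqfree.subst[OF tj IH(1)[unfolded \<Delta>(1)]] by (simp add: \<Delta>(2) subst_part_type[OF j(2)])
    moreover have "(part_ctx M A t n, HasType (App (Inr (n, a)) (map (part_exp M t) [1..<n])) (part_type M A t n)) \<in> eqfree Y"
      if "a \<in> Tm Y n (A n)" for a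
      using eqfree.subst[OF tj IH(2)[OF that, unfolded \<Delta>(1)]]
      by (simp add: \<Delta>(2) subst_part_type[OF j(2)] subst_part_exp[OF j(2)] comp_def)
    ultimately show ?thesis by blast
  qed
qed

lemma Inc_less: "\<lbrakk>\<alpha> \<in> Inc n; i < j; j \<le> n\<rbrakk> \<Longrightarrow> \<alpha> i < \<alpha> j"
  by (auto simp: Inc_def strict_mono_on_def)

lemma Inc_le: "\<lbrakk>\<alpha> \<in> Inc n; i \<le> j; j \<le> n\<rbrakk> \<Longrightarrow> \<alpha> i \<le> \<alpha> j"
  using Inc_less[of \<alpha> n i j] by (cases "i = j") auto

lemma Inc_0: "\<alpha> \<in> Inc n \<Longrightarrow> \<alpha> 0 = 0"
  by (simp add: Inc_def)

lemma Inc_pos: "\<lbrakk>\<alpha> \<in> Inc n; 1 \<le> i; i \<le> n\<rbrakk> \<Longrightarrow> 1 \<le> \<alpha> i"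
  using Inc_less[of \<alpha> n 0 i] by (simp add: Inc_0)

lemma Inc_inj: "\<alpha> \<in> Inc n \<Longrightarrow> inj_on \<alpha> {0..n}"
  by (simp add: Inc_def strict_mono_on_imp_inj_on)

lemma Inc_reflect_less: "\<lbrakk>\<alpha> \<in> Inc n; i \<le> n; \<alpha> i < \<alpha> j\<rbrakk> \<Longrightarrow> i < j"
  using Inc_le[of \<alpha> n j i] by (cases "i < j") auto

lemma Inc_inv: "\<lbrakk>\<alpha> \<in> Inc n; i \<le> n\<rbrakk> \<Longrightarrow> inv_into {0..n} \<alpha> (\<alpha> i) = i"
  using inv_into_f_f[OF Inc_inj, of \<alpha> n i] by simp

text \<open>The presheaf \<open>[\<alpha>]\<close> has at most one element at each index, so a morphism out of it is a family of
  elements subject to the boundary conditions.\<close>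

lemma inc_homD:
  assumes "h \<in> psh_hom (inc_psh n \<alpha>) Y"
  shows "\<lbrakk>1 \<le> i; i \<le> \<alpha> n\<rbrakk> \<Longrightarrow> at_ty h i i \<in> ty_el Y i"
    and "\<lbrakk>1 \<le> i; i < \<alpha> n\<rbrakk> \<Longrightarrow> bd_ty Y i (at_ty h (Suc i) (Suc i)) = at_ty h i i"
    and "\<lbrakk>1 \<le> i; i \<le> \<alpha> n; i \<notin> \<alpha> ` {0..n}\<rbrakk> \<Longrightarrow> at_tm h i i \<in> Tm Y i (at_ty h i i)"
proof -
  show "at_ty h i i \<in> ty_el Y i" if "1 \<le> i" "i \<le> \<alpha> n"
  proof -
    have "at_ty h i \<in> ty_el (inc_psh n \<alpha>) i \<rightarrow>\<^sub>E ty_el Y i" using assms by (simp add: psh_hom_def)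
    moreover have "i \<in> ty_el (inc_psh n \<alpha>) i" using that by (simp add: inc_psh_def)
    ultimately show ?thesis by blast
  qed
  show "bd_ty Y i (at_ty h (Suc i) (Suc i)) = at_ty h i i" if "1 \<le> i" "i < \<alpha> n"
  proof -
    have "Suc i \<in> ty_el (inc_psh n \<alpha>) (Suc i)" using that by (simp add: inc_psh_def)
    then have "at_ty h i (bd_ty (inc_psh n \<alpha>) i (Suc i)) = bd_ty Y i (at_ty h (Suc i) (Suc i))"
      using assms that(1) unfolding psh_hom_def by blast
    then show ?thesis by (simp add: inc_psh_def)
  qed
  show "at_tm h i i \<in> Tm Y i (at_ty h i i)" if "1 \<le> i" "i \<le> \<alpha> n" "i \<notin> \<alpha> ` {0..n}"
  proof -
    have i: "i \<in> tm_el (inc_psh n \<alpha>) i" using that by (simp add: inc_psh_def)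
    have "at_tm h i \<in> tm_el (inc_psh n \<alpha>) i \<rightarrow>\<^sub>E tm_el Y i" using assms by (simp add: psh_hom_def)
    then have "at_tm h i i \<in> tm_el Y i" using i by blast
    moreover have "at_ty h i (bd_tm (inc_psh n \<alpha>) i i) = bd_tm Y i (at_tm h i i)"
      using assms that(1) i unfolding psh_hom_def by blast
    ultimately show ?thesis by (simp add: Tm_def inc_psh_def)
  qed
qed

lemma inc_homI:
  assumes "\<And>i. \<lbrakk>1 \<le> i; i \<le> \<alpha> n\<rbrakk> \<Longrightarrow> at_ty h i i \<in> ty_el Y i"
    and "\<And>i. \<lbrakk>1 \<le> i; i < \<alpha> n\<rbrakk> \<Longrightarrow> bd_ty Y i (at_ty h (Suc i) (Suc i)) = at_ty h i i"
    and "\<And>i. \<lbrakk>1 \<le> i; i \<le> \<alpha> n; i \<notin> \<alpha> ` {0..n}\<rbrakk> \<Longrightarrow> at_tm h i i \<in> Tm Y i (at_ty h i i)"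
  shows "psh_restrict h (inc_psh n \<alpha>) \<in> psh_hom (inc_psh n \<alpha>) Y"
  using assms by (auto simp: psh_hom_def psh_restrict_def inc_psh_def Tm_def)

lemma psh_restrict_at:
  "\<lbrakk>1 \<le> i; i \<le> \<alpha> n\<rbrakk> \<Longrightarrow> at_ty (psh_restrict h (inc_psh n \<alpha>)) i i = at_ty h i i"
  "\<lbrakk>1 \<le> i; i \<le> \<alpha> n; i \<notin> \<alpha> ` {0..n}\<rbrakk> \<Longrightarrow> at_tm (psh_restrict h (inc_psh n \<alpha>)) i i = at_tm h i i"
  by (simp_all add: psh_restrict_def inc_psh_def)

lemma psh_restrict_ident:
  assumes "h \<in> psh_hom P Y"
  shows "psh_restrict h P = h"
proof -
  have "at_ty h n \<in> extensional (ty_el P n)" "at_tm h n \<in> extensional (tm_el P n)" for n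
    using assms by (auto simp: psh_hom_def PiE_def)
  then show ?thesis by (simp add: psh_restrict_def extensional_restrict)
qed

lemma psh_restrict_restrict:
  assumes "\<And>n. ty_el P n \<subseteq> ty_el Q n" "\<And>n. tm_el P n \<subseteq> tm_el Q n"
  shows "psh_restrict (psh_restrict h Q) P = psh_restrict h P"
  using assms by (simp add: psh_restrict_def Int_absorb1)

text \<open>The variable \<open>\<alpha>(m)\<close> is renamed to \<open>m\<close> in the judgement of \<open>part_eqfree\<close>, for \<open>1 \<le> m < n\<close>.\<close>

lemma inc_judg_eqfree:
  assumes Y: "is_psh Y" and n: "1 \<le> n" and \<alpha>: "\<alpha> \<in> Inc n" and h: "h \<in> psh_hom (inc_psh n \<alpha>) Y"
  shows "(inc_ctx n \<alpha> h, IsType (inc_type n \<alpha> h n)) \<in> eqfree Y"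
    and "a \<in> Tm Y (\<alpha> n) (at_ty h (\<alpha> n) (\<alpha> n)) \<Longrightarrow>
      (inc_ctx n \<alpha> h, HasType (App (Inr (\<alpha> n, a)) (map (inc_exp n \<alpha> h) [1..<\<alpha> n])) (inc_type n \<alpha> h n)) \<in> eqfree Y"
proof -
  \<comment> \<open>The value \<open>\<alpha>(n)\<close> is the position of the judgement itself and not of a variable of its context.\<close>
  define M where "M = \<alpha> ` {1..<n}"
  define A where "A = (\<lambda>i. at_ty h i i)"
  define t where "t = (\<lambda>i. at_tm h i i)"
  have image: "j \<in> \<alpha> ` {0..n} \<longleftrightarrow> j \<in> M" if "1 \<le> j" "j < \<alpha> n" for j
  proof
    assume "j \<in> \<alpha> ` {0..n}"
    then obtain m where m: "j = \<alpha> m" "m \<le> n" by auto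
    then have "m \<noteq> 0" "m \<noteq> n" using that Inc_0[OF \<alpha>] by (metis not_one_le_zero, metis less_irrefl)
    then show "j \<in> M" using m by (auto simp: M_def)
  qed (auto simp: M_def)
  have base: "(part_ctx M A t (\<alpha> n), IsType (part_type M A t (\<alpha> n))) \<in> eqfree Y"
    "\<And>a. a \<in> Tm Y (\<alpha> n) (A (\<alpha> n)) \<Longrightarrow> (part_ctx M A t (\<alpha> n),
       HasType (App (Inr (\<alpha> n, a)) (map (part_exp M t) [1..<\<alpha> n])) (part_type M A t (\<alpha> n))) \<in> eqfree Y"
    using part_eqfree[OF Y, of "\<alpha> n" A M t] Inc_pos[OF \<alpha> n] inc_homD[OF h] image
    by (auto simp: A_def t_def)
  have "inj_on (inv_into {0..n} \<alpha>) M" unfolding M_def by (rule inj_on_inv_into) auto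
  then obtain \<sigma> :: "nat \<Rightarrow> nat" where \<sigma>: "bij \<sigma>" "\<forall>x \<in> M. \<sigma> x = inv_into {0..n} \<alpha> x"
    using finite_injection_extends_to_bij[of M "inv_into {0..n} \<alpha>"] by (auto simp: M_def)
  have e: "inc_exp n \<alpha> h j = subst (Var \<circ> \<sigma>) (part_exp M t j)" if "1 \<le> j" "j < \<alpha> n" for j
    using that
  proof (induction j rule: less_induct)
    case (less j)
    then show ?case
      using image[OF less.prems] \<sigma>(2)
      by (subst inc_exp.simps, subst part_exp.simps) (auto simp: t_def comp_def)
  qed
  have type: "inc_type n \<alpha> h i = subst (Var \<circ> \<sigma>) (part_type M A t (\<alpha> i))" if "i \<le> n" for i
    using e Inc_le[OF \<alpha> that] by (auto simp: inc_type_def part_type_def A_def)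
  have "filter (\<lambda>i. i \<in> M) [1..<\<alpha> n] = map \<alpha> [1..<n]"
  proof (rule sorted_distinct_set_unique)
    show "sorted (map \<alpha> [1..<n])" "distinct (map \<alpha> [1..<n])"
      using Inc_le[OF \<alpha>] inj_on_subset[OF Inc_inj[OF \<alpha>]]
      by (auto simp: sorted_iff_nth_mono distinct_map subset_iff)
    show "set (filter (\<lambda>i. i \<in> M) [1..<\<alpha> n]) = set (map \<alpha> [1..<n])"
      using Inc_pos[OF \<alpha>] Inc_less[OF \<alpha>] by (fastforce simp: M_def)
  qed (auto simp: sorted_wrt_filter)
  then have ctx: "inc_ctx n \<alpha> h = map (\<lambda>(x, T). (\<sigma> x, subst (Var \<circ> \<sigma>) T)) (part_ctx M A t (\<alpha> n))"
    using \<sigma>(2) Inc_inv[OF \<alpha>] type by (auto simp: inc_ctx_def part_ctx_def M_def)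
  show "(inc_ctx n \<alpha> h, IsType (inc_type n \<alpha> h n)) \<in> eqfree Y"
    using eqfree.perm[OF \<sigma>(1) base(1)] by (simp add: permute_simp ctx type)
  show "(inc_ctx n \<alpha> h, HasType (App (Inr (\<alpha> n, a)) (map (inc_exp n \<alpha> h) [1..<\<alpha> n])) (inc_type n \<alpha> h n)) \<in> eqfree Y"
    if "a \<in> Tm Y (\<alpha> n) (at_ty h (\<alpha> n) (\<alpha> n))"
  proof -
    have "map (inc_exp n \<alpha> h) [1..<\<alpha> n] = map (subst (Var \<circ> \<sigma>)) (map (part_exp M t) [1..<\<alpha> n])"
      using e by auto
    then show ?thesis
      using eqfree.perm[OF \<sigma>(1) base(2)[of a]] that
      by (simp add: permute_simp ctx type A_def del: map_map map_eq_conv One_nat_def)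
  qed
qed

text \<open>The expression \<open>e\<^sub>i\<close> is built from data at indices up to \<open>i\<close>, so truncating the inc-list beyond \<open>i\<close> does
  not change it.\<close>

lemma inc_exp_restrict:
  assumes \<beta>: "\<beta> \<in> Inc m" and j: "j \<le> m" and i: "i \<le> \<beta> j"
  defines "\<beta>j \<equiv> restrict \<beta> {0..j}"
  shows "inc_exp j \<beta>j (psh_restrict h (inc_psh j \<beta>j)) i = inc_exp m \<beta> h i"
  using i
proof (induction i rule: less_induct)
  case (less i)
  have image: "\<beta>j ` {0..j} = \<beta> ` {0..j}" by (simp add: \<beta>j_def)
  have \<beta>j: "\<beta>j \<in> Inc j" using \<beta> j by (auto simp: Inc_def \<beta>j_def strict_mono_on_def)
  show ?case
  proof (cases "i \<in> \<beta> ` {0..j}")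
    case True
    then obtain l where l: "l \<le> j" "i = \<beta> l" by auto
    then have "inv_into {0..j} \<beta>j i = l" using Inc_inv[OF \<beta>j l(1)] by (simp add: \<beta>j_def)
    moreover have "inv_into {0..m} \<beta> i = l" using Inc_inv[OF \<beta>, of l] l j by simp
    moreover have "i \<in> \<beta> ` {0..m}" using l j by auto
    ultimately show ?thesis using True image by (simp add: inc_exp.simps)
  next
    case False
    have "i \<notin> \<beta> ` {0..m}"
    proof
      assume "i \<in> \<beta> ` {0..m}"
      then obtain l where l: "l \<le> m" "i = \<beta> l" by auto
      then have "j < l" using False by (auto intro: ccontr)
      then show False using Inc_less[OF \<beta> _ l(1)] less.prems l(2) by fastforce
    qed
    moreover have "1 \<le> i" using False Inc_0[OF \<beta>] by (cases i) force+
    moreover have "\<beta>j j = \<beta> j" by (simp add: \<beta>j_def)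
    ultimately show ?thesis
      using False image less psh_restrict_at(2)[of i \<beta>j j h]
      by (subst (1 2) inc_exp.simps) auto
  qed
qed

lemma inc_type_restrict:
  assumes \<beta>: "\<beta> \<in> Inc m" and i: "1 \<le> i" "i \<le> j" and j: "j \<le> m"
  defines "\<beta>j \<equiv> restrict \<beta> {0..j}"
  shows "inc_type j \<beta>j (psh_restrict h (inc_psh j \<beta>j)) i = inc_type m \<beta> h i"
proof -
  have eq: "\<beta>j i = \<beta> i" "\<beta>j j = \<beta> j" using i by (simp_all add: \<beta>j_def)
  have le: "\<beta> i \<le> \<beta> j" using Inc_le[OF \<beta> i(2) j] .
  have "at_ty (psh_restrict h (inc_psh j \<beta>j)) (\<beta> i) (\<beta> i) = at_ty h (\<beta> i) (\<beta> i)"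
    using psh_restrict_at(1)[of "\<beta> i" \<beta>j j h] Inc_pos[OF \<beta>, of i] i j le eq by simp
  then show ?thesis
    using inc_exp_restrict[OF \<beta> j, of _ h] le
    unfolding inc_type_def eq by (auto simp: \<beta>j_def)
qed

section \<open>The identification is a morphism of presheaves\<close>

lemma Inc_restrict: "\<lbrakk>\<beta> \<in> Inc m; j \<le> m\<rbrakk> \<Longrightarrow> restrict \<beta> {0..j} \<in> Inc j"
  by (auto simp: Inc_def strict_mono_on_def)

lemma Inc_comp:
  assumes "\<alpha> \<in> Inc n" "\<beta> \<in> Inc (\<alpha> n)"
  shows "inc_comp n \<beta> \<alpha> \<in> Inc n"
  using Inc_0[OF assms(1)] Inc_0[OF assms(2)] Inc_less[OF assms(1)] Inc_le[OF assms(1)] Inc_less[OF assms(2)]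
  by (auto simp: Inc_def inc_comp_def strict_mono_on_def)

lemma inc_S_ty_iff:
  "(\<alpha>, h) \<in> ty_el (inc_S X) n \<longleftrightarrow> 1 \<le> n \<and> \<alpha> \<in> Inc n \<and> h \<in> psh_hom (inc_psh n \<alpha>) X"
  by (simp add: inc_S_def)

lemma inc_S_tm_iff:
  "((\<alpha>, h), a) \<in> tm_el (inc_S X) n \<longleftrightarrow>
     (\<alpha>, h) \<in> ty_el (inc_S X) n \<and> a \<in> Tm X (\<alpha> n) (at_ty h (\<alpha> n) (\<alpha> n))"
  by (auto simp: inc_S_def)

text \<open>Boundaries in \<open>inc_S X\<close> are truncations, hence so are iterated boundaries.\<close>

lemma inc_S_iter_boundary:
  assumes \<beta>: "\<beta> \<in> Inc m" and h: "h \<in> psh_hom (inc_psh m \<beta>) X"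
    and H: "H m = (\<beta>, h)" and bd: "\<And>j. \<lbrakk>1 \<le> j; j < m\<rbrakk> \<Longrightarrow> bd_ty (inc_S X) j (H (Suc j)) = H j"
    and j: "1 \<le> j" "j \<le> m"
  shows "H j = (restrict \<beta> {0..j}, psh_restrict h (inc_psh j (restrict \<beta> {0..j})))"
  using j(2,1)
proof (induction j rule: inc_induct)
  case base
  have "restrict \<beta> {0..m} = \<beta>" using \<beta> by (simp add: Inc_def extensional_restrict)
  then show ?case using H psh_restrict_ident[OF h] by simp
next
  case (step j)
  let ?P = "\<lambda>j. inc_psh j (restrict \<beta> {0..j})"
  have rr: "restrict (restrict \<beta> {0..Suc j}) {0..j} = restrict \<beta> {0..j}"
    by (simp add: Int_absorb1)
  have lt: "\<beta> j < \<beta> (Suc j)" using Inc_less[OF \<beta>, of j "Suc j"] step.hyps by simp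
  have "restrict \<beta> {0..i} ` {0..i} = \<beta> ` {0..i}" for i by simp
  moreover have "\<beta> ` {0..Suc j} = insert (\<beta> (Suc j)) (\<beta> ` {0..j})" by (simp add: atLeast0_atMost_Suc)
  ultimately have pr: "psh_restrict (psh_restrict h (?P (Suc j))) (?P j) = psh_restrict h (?P j)"
    using lt by (intro psh_restrict_restrict) (auto simp: inc_psh_def)
  have "bd_ty (inc_S X) j (restrict \<beta> {0..Suc j}, psh_restrict h (?P (Suc j)))
      = (restrict \<beta> {0..j}, psh_restrict h (?P j))"
    by (simp only: inc_S_def psh.select_convs prod.case rr pr)
  moreover have "H (Suc j) = (restrict \<beta> {0..Suc j}, psh_restrict h (?P (Suc j)))"
    by (rule step.IH) simp
  ultimately show ?case using bd[OF step.prems step.hyps(2)] by metis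
qed

lemma std_standard:
  assumes "map fst \<Gamma> = [1..<n]" "fv e \<subseteq> {1..<n}"
  shows "std \<Gamma> e = e"
  unfolding assms(1) using assms(2) posn_upt[of _ n] by (intro subst_ident) auto

lemma map_fst_inc_ctx [simp]: "map fst (inc_ctx n \<alpha> h) = [1..<n]"
  by (simp add: inc_ctx_def comp_def)

definition inc_ty_judg :: "nat \<Rightarrow> (nat \<Rightarrow> nat) \<Rightarrow> (nat, nat, 'a, 'b) psh_mor \<Rightarrow> ('a, 'b) free_const judg" where
  "inc_ty_judg n \<alpha> h = (inc_ctx n \<alpha> h, IsType (inc_type n \<alpha> h n))"

definition inc_term :: "nat \<Rightarrow> (nat \<Rightarrow> nat) \<Rightarrow> (nat, nat, 'a, 'b) psh_mor \<Rightarrow> 'b \<Rightarrow> ('a, 'b) free_const exp" where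
  "inc_term n \<alpha> h a = App (Inr (\<alpha> n, a)) (map (inc_exp n \<alpha> h) [1..<\<alpha> n])"

definition inc_tm_judg :: "nat \<Rightarrow> (nat \<Rightarrow> nat) \<Rightarrow> (nat, nat, 'a, 'b) psh_mor \<Rightarrow> 'b \<Rightarrow> ('a, 'b) free_const judg" where
  "inc_tm_judg n \<alpha> h a = (inc_ctx n \<alpha> h, HasType (inc_term n \<alpha> h a) (inc_type n \<alpha> h n))"

lemma inc_ty_judg_eqfree: "\<lbrakk>is_psh Y; (\<alpha>, h) \<in> ty_el (inc_S Y) n\<rbrakk> \<Longrightarrow> inc_ty_judg n \<alpha> h \<in> eqfree Y"
  using inc_judg_eqfree(1) by (auto simp: inc_S_ty_iff inc_ty_judg_def)

lemma inc_tm_judg_eqfree: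
  "\<lbrakk>is_psh Y; ((\<alpha>, h), a) \<in> tm_el (inc_S Y) n\<rbrakk> \<Longrightarrow> inc_tm_judg n \<alpha> h a \<in> eqfree Y"
  using inc_judg_eqfree(2) by (fastforce simp: inc_S_ty_iff inc_S_tm_iff inc_tm_judg_def inc_term_def)

lemma length_inc_ctx [simp]: "length (inc_ctx n \<alpha> h) = n - 1"
  by (simp add: inc_ctx_def)

lemma inc_S_boundary_in:
  assumes "(\<beta>, h) \<in> ty_el (inc_S X) m" "1 \<le> j" "j \<le> m"
  shows "(restrict \<beta> {0..j}, psh_restrict h (inc_psh j (restrict \<beta> {0..j}))) \<in> ty_el (inc_S X) j"
proof -
  have \<beta>: "\<beta> \<in> Inc m" and h: "h \<in> psh_hom (inc_psh m \<beta>) X" using assms(1) by (auto simp: inc_S_ty_iff)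
  have le: "\<beta> j \<le> \<beta> m" using Inc_le[OF \<beta> assms(3)] by simp
  have image: "i \<notin> \<beta> ` {0..m}" if "i \<le> \<beta> j" "i \<notin> \<beta> ` {0..j}" for i
  proof
    assume "i \<in> \<beta> ` {0..m}"
    then obtain l where l: "l \<le> m" "i = \<beta> l" by auto
    then have "j < l" using that(2) by (cases "l \<le> j") auto
    then show False using Inc_less[OF \<beta> _ l(1)] that(1) l(2) by fastforce
  qed
  have "psh_restrict h (inc_psh j (restrict \<beta> {0..j})) \<in> psh_hom (inc_psh j (restrict \<beta> {0..j})) X"
    using inc_homD[OF h] le image by (intro inc_homI) auto
  then show ?thesis using Inc_restrict[OF \<beta> assms(3)] assms(2) by (simp add: inc_S_ty_iff)
qed

lemma inc_ctx_boundary: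
  assumes \<beta>: "\<beta> \<in> Inc m" and j: "j \<le> m"
  defines "\<beta>j \<equiv> restrict \<beta> {0..j}"
  shows "inc_ctx j \<beta>j (psh_restrict h (inc_psh j \<beta>j)) = map (\<lambda>i. (i, inc_type m \<beta> h i)) [1..<j]"
  unfolding inc_ctx_def \<beta>j_def using inc_type_restrict[OF \<beta> _ _ j, of _ h] by auto

lemma ident_ty:
  "c \<in> ty_el (inc_S X) n \<Longrightarrow> at_ty (ident X) n c = judg_class (G X) (inc_ty_judg n (fst c) (snd c))"
  by (cases c) (simp add: ident_def psh_restrict_def inc_ty_judg_def)

lemma ident_tm:
  "c \<in> tm_el (inc_S X) n \<Longrightarrow>
    at_tm (ident X) n c = judg_class (G X) (inc_tm_judg n (fst (fst c)) (snd (fst c)) (snd c))"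
  by (cases c) (auto simp: ident_def psh_restrict_def inc_tm_judg_def inc_term_def)

lemma ident_ty_in:
  assumes "is_psh X" "c \<in> ty_el (inc_S X) n"
  shows "at_ty (ident X) n c \<in> ty_el (V (G X)) n"
proof -
  obtain \<beta> h where c: "c = (\<beta>, h)" by (cases c)
  have "1 \<le> n" using assms(2) by (simp add: c inc_S_ty_iff)
  then show ?thesis
    using ident_ty[OF assms(2)] inc_ty_judg_eqfree[OF assms(1) assms(2)[unfolded c]]
    by (auto simp: c V_G_ty[OF assms(1)] inc_ty_judg_def intro!: exI)
qed

text \<open>Together with the next lemma on terms, this makes the identification a morphism \<open>inc_S X \<rightarrow> SX\<close>, so
  that composing with it turns a map \<open>[\<alpha>] \<rightarrow> inc_S X\<close> into a map \<open>[\<alpha>] \<rightarrow> SX\<close>.\<close>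

lemma ident_bd_ty:
  assumes X: "is_psh X" and c: "c \<in> ty_el (inc_S X) (Suc n)" and n: "1 \<le> n"
  shows "bd_ty (V (G X)) n (at_ty (ident X) (Suc n) c) = at_ty (ident X) n (bd_ty (inc_S X) n c)"
proof -
  obtain \<beta> h where \<beta>h: "c = (\<beta>, h)" by (cases c)
  have \<beta>: "\<beta> \<in> Inc (Suc n)" using c by (simp add: \<beta>h inc_S_ty_iff)
  define \<beta>' where "\<beta>' = restrict \<beta> {0..n}"
  define h' where "h' = psh_restrict h (inc_psh n \<beta>')"
  have c': "(\<beta>', h') \<in> ty_el (inc_S X) n"
    using inc_S_boundary_in[OF c[unfolded \<beta>h] n] by (simp add: \<beta>'_def h'_def)
  have "inc_ctx (Suc n) \<beta> h = inc_ctx n \<beta>' h' @ [(n, inc_type n \<beta>' h' n)]"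
    using inc_ctx_boundary[OF \<beta>, of n h] inc_type_restrict[OF \<beta> n, of n h] n
    by (simp add: \<beta>'_def h'_def inc_ctx_def[of "Suc n"])
  then have "bd_ty (V (G X)) n (judg_class (G X) (inc_ty_judg (Suc n) \<beta> h)) = judg_class (G X) (inc_ty_judg n \<beta>' h')"
    using bd_ty_V[OF X] inc_ty_judg_eqfree[OF X c[unfolded \<beta>h]] by (simp add: inc_ty_judg_def)
  moreover have "bd_ty (inc_S X) n c = (\<beta>', h')" by (simp add: inc_S_def \<beta>h \<beta>'_def h'_def)
  ultimately show ?thesis using ident_ty[OF c] ident_ty[OF c'] by (simp add: \<beta>h)
qed

lemma ident_tm_in:
  assumes X: "is_psh X" and c: "c \<in> tm_el (inc_S X) n"
  shows "at_tm (ident X) n c \<in> Tm (V (G X)) n (at_ty (ident X) n (fst c))"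
proof -
  obtain \<beta> h a where \<beta>h: "c = ((\<beta>, h), a)" by (metis prod.collapse)
  have c': "(\<beta>, h) \<in> ty_el (inc_S X) n" using c by (simp add: \<beta>h inc_S_tm_iff)
  then have "1 \<le> n" by (simp add: inc_S_ty_iff)
  have J: "inc_tm_judg n \<beta> h a \<in> eqfree X" using inc_tm_judg_eqfree[OF X c[unfolded \<beta>h]] .
  have "judg_class (G X) (inc_tm_judg n \<beta> h a) \<in> tm_el (V (G X)) n"
    using J \<open>1 \<le> n\<close> by (auto simp: V_G_tm[OF X] inc_tm_judg_def intro!: exI)
  moreover have "bd_tm (V (G X)) n (judg_class (G X) (inc_tm_judg n \<beta> h a)) = judg_class (G X) (inc_ty_judg n \<beta> h)"
    using bd_tm_V[OF X] J by (simp add: inc_tm_judg_def inc_ty_judg_def)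
  ultimately show ?thesis using ident_ty[OF c'] ident_tm[OF c] by (simp add: \<beta>h Tm_def)
qed

lemma tm_el_inc_S: "c \<in> Tm (inc_S X) n A \<longleftrightarrow> c \<in> tm_el (inc_S X) n \<and> fst c = A"
  by (simp add: Tm_def inc_S_def)

lemma ident_comp:
  assumes X: "is_psh X" and H: "H \<in> psh_hom (inc_psh n \<alpha>) (inc_S X)"
  defines "H' \<equiv> psh_comp (inc_psh n \<alpha>) (ident X) H"
  shows "\<lbrakk>1 \<le> i; i \<le> \<alpha> n\<rbrakk> \<Longrightarrow> at_ty H' i i = at_ty (ident X) i (at_ty H i i)"
    and "\<lbrakk>1 \<le> i; i \<le> \<alpha> n; i \<notin> \<alpha> ` {0..n}\<rbrakk> \<Longrightarrow> at_tm H' i i = at_tm (ident X) i (at_tm H i i)"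
    and "H' \<in> psh_hom (inc_psh n \<alpha>) (V (G X))"
proof -
  show ty: "at_ty H' i i = at_ty (ident X) i (at_ty H i i)" if "1 \<le> i" "i \<le> \<alpha> n" for i
    using that by (simp add: H'_def psh_comp_def psh_restrict_at)
  show tm: "at_tm H' i i = at_tm (ident X) i (at_tm H i i)" if "1 \<le> i" "i \<le> \<alpha> n" "i \<notin> \<alpha> ` {0..n}" for i
    using that by (simp add: H'_def psh_comp_def psh_restrict_at)
  let ?H = "\<lparr>at_ty = \<lambda>i. at_ty (ident X) i \<circ> at_ty H i, at_tm = \<lambda>i. at_tm (ident X) i \<circ> at_tm H i\<rparr>"
  have "psh_restrict ?H (inc_psh n \<alpha>) \<in> psh_hom (inc_psh n \<alpha>) (V (G X))"
  proof (rule inc_homI; simp only: psh_mor.simps comp_apply)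
    fix i assume i: "1 \<le> i" "i \<le> \<alpha> n"
    show "at_ty (ident X) i (at_ty H i i) \<in> ty_el (V (G X)) i"
      using ident_ty_in[OF X inc_homD(1)[OF H i]] .
  next
    fix i assume i: "1 \<le> i" "i < \<alpha> n"
    have "at_ty H (Suc i) (Suc i) \<in> ty_el (inc_S X) (Suc i)" using inc_homD(1)[OF H, of "Suc i"] i by simp
    then show "bd_ty (V (G X)) i (at_ty (ident X) (Suc i) (at_ty H (Suc i) (Suc i))) = at_ty (ident X) i (at_ty H i i)"
      using ident_bd_ty[OF X _ i(1)] inc_homD(2)[OF H i] by simp
  next
    fix i assume i: "1 \<le> i" "i \<le> \<alpha> n" "i \<notin> \<alpha> ` {0..n}"
    show "at_tm (ident X) i (at_tm H i i) \<in> Tm (V (G X)) i (at_ty (ident X) i (at_ty H i i))"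
      using inc_homD(3)[OF H i] ident_tm_in[OF X, of "at_tm H i i" i] by (simp add: tm_el_inc_S)
  qed
  then show "H' \<in> psh_hom (inc_psh n \<alpha>) (V (G X))" by (simp add: H'_def psh_comp_def)
qed

text \<open>The judgement of an inc-list is already on the standard variables and is its own representative.\<close>

lemma body_type:
  assumes X: "is_psh X" and c: "(\<beta>, h) \<in> ty_el (inc_S X) j"
  shows "body (Inl (j, judg_class (G X) (inc_ty_judg j \<beta> h))) = inc_type j \<beta> h j"
proof -
  note J = inc_ty_judg_eqfree[OF X c]
  have "fv (inc_type j \<beta> h j) \<subseteq> {1..<j}" using scoped_rhs[OF J[unfolded inc_ty_judg_def]] by simp
  then show ?thesis
    using std_standard[of "inc_ctx j \<beta> h" j] class_nf_judg_class[OF X J] by (simp add: inc_ty_judg_def nf_simp)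
qed

lemma body_term:
  assumes X: "is_psh X" and c: "((\<beta>, h), a) \<in> tm_el (inc_S X) j"
  shows "body (Inr (j, judg_class (G X) (inc_tm_judg j \<beta> h a))) = inc_term j \<beta> h a"
proof -
  note J = inc_tm_judg_eqfree[OF X c]
  have "fv (inc_term j \<beta> h a) \<subseteq> {1..<j}" using scoped_rhs[OF J[unfolded inc_tm_judg_def]] by simp
  then show ?thesis
    using std_standard[of "inc_ctx j \<beta> h" j] class_nf_judg_class[OF X J] by (simp add: inc_tm_judg_def nf_simp)
qed

section \<open>Translating the judgement of a nested inc-list\<close>

lemma arg_subst_map_upt: "\<lbrakk>1 \<le> i; i < j\<rbrakk> \<Longrightarrow> arg_subst (map f [1..<j]) i = f i"
  by (auto simp: arg_subst_def)

text \<open>Substituting \<open>e (\<beta> i)\<close> for \<open>x\<^sub>i\<close> in the expressions of \<open>(\<beta>, h)\<close> gives those of \<open>(\<beta>\<alpha>, h \<union> k)\<close>. At an index in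
  the image of \<open>\<beta>\<close> there is a variable to be replaced; at all other indices \<open>h\<close> and \<open>h \<union> k\<close> apply the
  same term-constant.\<close>

lemma arg_subst_inc_exp:
  fixes h :: "(nat, nat, 'a, 'b) psh_mor" and k :: "nat \<Rightarrow> 'b"
  assumes \<alpha>: "\<alpha> \<in> Inc n" and \<beta>: "\<beta> \<in> Inc (\<alpha> n)" and j: "j \<le> \<alpha> n"
  defines "e \<equiv> inc_exp n (inc_comp n \<beta> \<alpha>) (glue n \<alpha> \<beta> h k)"
  shows "\<lbrakk>1 \<le> l; l < \<beta> j\<rbrakk> \<Longrightarrow>
    subst (arg_subst (map (\<lambda>i. e (\<beta> i)) [1..<j])) (inc_exp (\<alpha> n) \<beta> h l) = e l"
proof (induction l rule: less_induct)
  case (less l)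
  have l: "l < \<beta> (\<alpha> n)" using less.prems Inc_le[OF \<beta> j] by simp
  show ?case
  proof (cases "l \<in> \<beta> ` {0..\<alpha> n}")
    case True
    then obtain i where i: "i \<le> \<alpha> n" "l = \<beta> i" by auto
    then have "i < j" using Inc_reflect_less[OF \<beta>] less.prems by blast
    moreover have "1 \<le> i" using i less.prems Inc_0[OF \<beta>] by (cases i) auto
    moreover have "inc_exp (\<alpha> n) \<beta> h l = Var i" using True i Inc_inv[OF \<beta>] by (simp add: inc_exp.simps)
    ultimately show ?thesis using i(2) arg_subst_map_upt[of i j "\<lambda>i. e (\<beta> i)"] by simp
  next
    case False
    then have "l \<notin> inc_comp n \<beta> \<alpha> ` {0..n}" using Inc_le[OF \<alpha>] by (auto simp: inc_comp_def)
    moreover from this have "at_tm (glue n \<alpha> \<beta> h k) l l = at_tm h l l"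
      using False less.prems l unfolding glue_def
      by (subst psh_restrict_at(2)) (simp_all add: inc_comp_def)
    ultimately have "e l = App (Inr (l, at_tm h l l)) (map e [1..<l])"
      unfolding e_def by (subst inc_exp.simps) simp
    moreover have "inc_exp (\<alpha> n) \<beta> h l = App (Inr (l, at_tm h l l)) (map (inc_exp (\<alpha> n) \<beta> h) [1..<l])"
      using False by (subst inc_exp.simps) simp
    ultimately show ?thesis using less by simp
  qed
qed

text \<open>A type-element \<open>(\<alpha>, (\<beta>, h, k))\<close> of the iterated description: \<open>H\<close> is the map \<open>[\<alpha>] \<rightarrow> inc_S X\<close> that \<open>(\<beta>, h)\<close>
  and \<open>k\<close> determine.\<close>

locale nested =
  fixes X :: "('a, 'b) psh"
    and H :: "(nat, nat, ('a, 'b) inc_ty, ('a, 'b) inc_ty \<times> 'b) psh_mor"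
    and \<alpha> \<beta> :: "nat \<Rightarrow> nat" and h :: "(nat, nat, 'a, 'b) psh_mor" and k :: "nat \<Rightarrow> 'b" and n :: nat
  assumes X: "is_psh X"
    and el: "(\<alpha>, H) \<in> ty_el (inc_S (inc_S X)) n"
    and top: "at_ty H (\<alpha> n) (\<alpha> n) = (\<beta>, h)"
    and k: "i \<in> {1..\<alpha> n} - \<alpha> ` {0..n} \<Longrightarrow> snd (at_tm H i i) = k i"
begin

abbreviation (input) "\<gamma> \<equiv> inc_comp n \<beta> \<alpha>"
abbreviation (input) "g \<equiv> glue n \<alpha> \<beta> h k"
abbreviation (input) "\<beta>_at j \<equiv> restrict \<beta> {0..j}"
abbreviation (input) "h_at j \<equiv> psh_restrict h (inc_psh j (\<beta>_at j))"
abbreviation (input) "H' \<equiv> psh_comp (inc_psh n \<alpha>) (ident X) H"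

lemma n: "1 \<le> n" and \<alpha>: "\<alpha> \<in> Inc n" and H: "H \<in> psh_hom (inc_psh n \<alpha>) (inc_S X)"
  using el by (auto simp: inc_S_ty_iff)

lemma \<alpha>n: "1 \<le> \<alpha> n" using Inc_pos[OF \<alpha> n] by simp

lemma \<beta>h: "(\<beta>, h) \<in> ty_el (inc_S X) (\<alpha> n)"
  using inc_homD(1)[OF H \<alpha>n] top by simp

lemma \<beta>: "\<beta> \<in> Inc (\<alpha> n)" and h: "h \<in> psh_hom (inc_psh (\<alpha> n) \<beta>) X"
  using \<beta>h by (auto simp: inc_S_ty_iff)

lemma \<gamma>: "\<gamma> \<in> Inc n" using Inc_comp[OF \<alpha> \<beta>] .

lemma \<gamma>_at: "i \<le> n \<Longrightarrow> \<gamma> i = \<beta> (\<alpha> i)" by (simp add: inc_comp_def)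

lemma H_ty: "\<lbrakk>1 \<le> j; j \<le> \<alpha> n\<rbrakk> \<Longrightarrow> at_ty H j j = (\<beta>_at j, h_at j)"
  using inc_S_iter_boundary[OF \<beta> h, of "\<lambda>j. at_ty H j j" j] inc_homD(2)[OF H] top by simp

lemma H_ty_in: "\<lbrakk>1 \<le> j; j \<le> \<alpha> n\<rbrakk> \<Longrightarrow> (\<beta>_at j, h_at j) \<in> ty_el (inc_S X) j"
  using inc_S_boundary_in[OF \<beta>h] .

text \<open>By the boundary condition on \<open>H\<close>, its term at \<open>j\<close> lies over the truncation of \<open>(\<beta>, h)\<close> at \<open>j\<close>, so that
  \<open>k j\<close> is the only information in it.\<close>

lemma H_tm:
  assumes "1 \<le> j" "j \<le> \<alpha> n" "j \<notin> \<alpha> ` {0..n}"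
  shows "at_tm H j j = ((\<beta>_at j, h_at j), k j)" "((\<beta>_at j, h_at j), k j) \<in> tm_el (inc_S X) j"
    "k j \<in> Tm X (\<beta> j) (at_ty h (\<beta> j) (\<beta> j))"
proof -
  have *: "at_tm H j j \<in> tm_el (inc_S X) j" "fst (at_tm H j j) = (\<beta>_at j, h_at j)"
    using inc_homD(3)[OF H assms] H_ty[OF assms(1,2)] by (auto simp: tm_el_inc_S)
  moreover have "snd (at_tm H j j) = k j" using k assms by simp
  ultimately show **: "at_tm H j j = ((\<beta>_at j, h_at j), k j)" by (metis prod.collapse)
  then show tm: "((\<beta>_at j, h_at j), k j) \<in> tm_el (inc_S X) j" using * by simp
  have "1 \<le> \<beta> j" using Inc_pos[OF \<beta>] assms by simp
  then show "k j \<in> Tm X (\<beta> j) (at_ty h (\<beta> j) (\<beta> j))"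
    using tm psh_restrict_at(1)[of "\<beta> j" "\<beta>_at j" j h] by (simp add: inc_S_tm_iff)
qed

lemma g_ty: "\<lbrakk>1 \<le> i; i \<le> \<beta> (\<alpha> n)\<rbrakk> \<Longrightarrow> at_ty g i i = at_ty h i i"
  unfolding glue_def using \<gamma>_at[of n] by (subst psh_restrict_at(1)) simp_all

lemma g_tm:
  assumes "1 \<le> j" "j \<le> \<alpha> n" "j \<notin> \<alpha> ` {0..n}"
  shows "\<beta> j \<notin> \<gamma> ` {0..n}" "at_tm g (\<beta> j) (\<beta> j) = k j"
proof -
  show notin: "\<beta> j \<notin> \<gamma> ` {0..n}"
  proof
    assume "\<beta> j \<in> \<gamma> ` {0..n}"
    then obtain i where "i \<le> n" "\<beta> j = \<beta> (\<alpha> i)" using \<gamma>_at by auto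
    then have "j = \<alpha> i" using inj_onD[OF Inc_inj[OF \<beta>]] Inc_le[OF \<alpha> \<open>i \<le> n\<close>] assms(2) by simp
    then show False using assms(3) \<open>i \<le> n\<close> by simp
  qed
  have "1 \<le> \<beta> j" "\<beta> j \<le> \<gamma> n" using Inc_pos[OF \<beta>] Inc_le[OF \<beta>] assms \<gamma>_at[of n] by simp_all
  moreover have "\<beta> j \<in> \<beta> ` {0..\<alpha> n}" using assms by simp
  ultimately show "at_tm g (\<beta> j) (\<beta> j) = k j"
    unfolding glue_def using notin Inc_inv[OF \<beta> assms(2)] by (subst psh_restrict_at(2)) simp_all
qed

text \<open>An index \<open>i = \<beta>(j)\<close> outside the image of \<open>\<beta>\<alpha>\<close> has \<open>j\<close> outside the image of \<open>\<alpha>\<close>, and then \<open>k j\<close> is a term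
  over \<open>h(i)\<close>; at the remaining indices the term comes from \<open>h\<close>.\<close>

lemma glue_in: "(\<gamma>, g) \<in> ty_el (inc_S X) n"
proof -
  have "g \<in> psh_hom (inc_psh n \<gamma>) X"
    unfolding glue_def
  proof (rule inc_homI; simp only: psh_mor.simps)
    fix i assume "1 \<le> i" "i \<le> \<gamma> n"
    then show "at_ty h i i \<in> ty_el X i" using inc_homD(1)[OF h] \<gamma>_at[of n] by simp
  next
    fix i assume "1 \<le> i" "i < \<gamma> n"
    then show "bd_ty X i (at_ty h (Suc i) (Suc i)) = at_ty h i i" using inc_homD(2)[OF h] \<gamma>_at[of n] by simp
  next
    fix i assume i: "1 \<le> i" "i \<le> \<gamma> n" "i \<notin> \<gamma> ` {0..n}"
    show "(if i \<notin> \<beta> ` {0..\<alpha> n} then at_tm h i i else k (inv_into {0..\<alpha> n} \<beta> i)) \<in> Tm X i (at_ty h i i)"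
    proof (cases "i \<in> \<beta> ` {0..\<alpha> n}")
      case True
      then obtain j where j: "j \<le> \<alpha> n" "i = \<beta> j" by auto
      have "1 \<le> j" using j i(1) Inc_0[OF \<beta>] by (cases j) auto
      moreover have "j \<notin> \<alpha> ` {0..n}"
      proof
        assume "j \<in> \<alpha> ` {0..n}"
        then obtain l where "l \<le> n" "j = \<alpha> l" by auto
        then have "i = \<gamma> l" using j(2) \<gamma>_at by simp
        then show False using i(3) \<open>l \<le> n\<close> by simp
      qed
      ultimately show ?thesis using H_tm(3)[of j] j True Inc_inv[OF \<beta> j(1)] by simp
    next
      case False
      then show ?thesis using inc_homD(3)[OF h] i \<gamma>_at[of n] by simp
    qed
  qed
  then show ?thesis using n \<gamma> by (simp add: inc_S_ty_iff)
qed

lemma H_ident_in: "(\<alpha>, H') \<in> ty_el (inc_S (V (G X))) n"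
  using ident_comp(3)[OF X H] n \<alpha> by (simp add: inc_S_ty_iff)

lemma body_H_ident_ty:
  assumes "1 \<le> j" "j \<le> \<alpha> n"
  shows "body (Inl (j, at_ty H' j j)) = inc_type (\<alpha> n) \<beta> h j"
  using ident_comp(1)[OF X H assms] H_ty[OF assms] ident_ty[OF H_ty_in[OF assms]]
    body_type[OF X H_ty_in[OF assms]] inc_type_restrict[OF \<beta> assms(1) order_refl assms(2), of h] by simp

lemma inc_term_restrict:
  assumes "j \<le> \<alpha> n"
  shows "inc_term j (\<beta>_at j) (h_at j) a = App (Inr (\<beta> j, a)) (map (inc_exp (\<alpha> n) \<beta> h) [1..<\<beta> j])"
  using inc_exp_restrict[OF \<beta> assms, of _ h] by (auto simp: inc_term_def)

lemma body_H_ident_tm: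
  assumes "1 \<le> j" "j \<le> \<alpha> n" "j \<notin> \<alpha> ` {0..n}"
  shows "body (Inr (j, at_tm H' j j)) = App (Inr (\<beta> j, k j)) (map (inc_exp (\<alpha> n) \<beta> h) [1..<\<beta> j])"
  using ident_comp(2)[OF X H assms] H_tm[OF assms] ident_tm[OF H_tm(2)[OF assms]]
    body_term[OF X H_tm(2)[OF assms]] inc_term_restrict[OF assms(2)] by simp

text \<open>The heart of the computation: the two-stage filling of positions by \<open>k\<close> and \<open>h\<close> is unfolded by the
  translation into the single filling by \<open>h \<union> k\<close>.\<close>

lemma tr_body_inc_exp:
  "\<lbrakk>1 \<le> j; j \<le> \<alpha> n\<rbrakk> \<Longrightarrow> tr body (inc_exp n \<alpha> H' j) = inc_exp n \<gamma> g (\<beta> j)"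
proof (induction j rule: less_induct)
  case (less j)
  show ?case
  proof (cases "j \<in> \<alpha> ` {0..n}")
    case True
    then obtain i where i: "i \<le> n" "j = \<alpha> i" by auto
    then have "\<beta> j = \<gamma> i" using \<gamma>_at by simp
    moreover have "\<gamma> i \<in> \<gamma> ` {0..n}" using i(1) by simp
    ultimately have "inc_exp n \<gamma> g (\<beta> j) = Var i"
      using Inc_inv[OF \<gamma> i(1)] by (subst inc_exp.simps) simp
    moreover have "inc_exp n \<alpha> H' j = Var i"
      using True Inc_inv[OF \<alpha> i(1)] i(2) by (subst inc_exp.simps) simp
    ultimately show ?thesis by simp
  next
    case False
    have "inc_exp n \<alpha> H' j = App (Inr (j, at_tm H' j j)) (map (inc_exp n \<alpha> H') [1..<j])"
      using False by (subst inc_exp.simps) simp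
    moreover have "map (tr body) (map (inc_exp n \<alpha> H') [1..<j]) = map (\<lambda>i. inc_exp n \<gamma> g (\<beta> i)) [1..<j]"
      using less by simp
    ultimately have "tr body (inc_exp n \<alpha> H' j) = subst (arg_subst (map (\<lambda>i. inc_exp n \<gamma> g (\<beta> i)) [1..<j]))
        (App (Inr (\<beta> j, k j)) (map (inc_exp (\<alpha> n) \<beta> h) [1..<\<beta> j]))"
      by (simp only: tr.simps body_H_ident_tm[OF less.prems False])
    also have "\<dots> = App (Inr (\<beta> j, k j)) (map (inc_exp n \<gamma> g) [1..<\<beta> j])"
      by (simp add: arg_subst_inc_exp[OF \<alpha> \<beta> less.prems(2)] del: One_nat_def)
    also have "\<dots> = inc_exp n \<gamma> g (\<beta> j)"
      using g_tm[OF less.prems False] by (subst inc_exp.simps) simp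
    finally show ?thesis .
  qed
qed

lemma map_tr_body_inc_exp:
  "j \<le> \<alpha> n \<Longrightarrow> map (tr body) (map (inc_exp n \<alpha> H') [1..<j]) = map (\<lambda>i. inc_exp n \<gamma> g (\<beta> i)) [1..<j]"
  using tr_body_inc_exp by simp

lemma tr_body_inc_type:
  assumes i: "1 \<le> i" "i \<le> n"
  shows "tr body (inc_type n \<alpha> H' i) = inc_type n \<gamma> g i"
proof -
  have \<alpha>i: "1 \<le> \<alpha> i" "\<alpha> i \<le> \<alpha> n" using Inc_pos[OF \<alpha> i] Inc_le[OF \<alpha> i(2)] by simp_all
  have "tr body (inc_type n \<alpha> H' i)
      = subst (arg_subst (map (\<lambda>i. inc_exp n \<gamma> g (\<beta> i)) [1..<\<alpha> i])) (inc_type (\<alpha> n) \<beta> h (\<alpha> i))"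
    unfolding inc_type_def[of n \<alpha>] tr.simps body_H_ident_ty[OF \<alpha>i] map_tr_body_inc_exp[OF \<alpha>i(2)] ..
  also have "\<dots> = inc_type n \<gamma> g i"
    using g_ty[of "\<beta> (\<alpha> i)"] Inc_pos[OF \<beta> \<alpha>i] Inc_le[OF \<beta> \<alpha>i(2)] \<gamma>_at[OF i(2)]
    by (simp add: inc_type_def arg_subst_inc_exp[OF \<alpha> \<beta> \<alpha>i(2)] del: One_nat_def)
  finally show ?thesis .
qed

lemma tr_body_inc_ctx: "tr_ctx body (inc_ctx n \<alpha> H') = inc_ctx n \<gamma> g"
  using tr_body_inc_type by (simp add: tr_ctx_def inc_ctx_def)

lemma ident2_ty: "at_ty (ident2 X) n (\<alpha>, H) = judg_class (G (V (G X))) (inc_ty_judg n \<alpha> H')"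
  using el ident_ty[OF H_ident_in]
  by (simp add: ident2_def psh_comp_def psh_restrict_def inc_S_map_def S_def)

lemma mu_ident2_ty: "at_ty (mu X) n (at_ty (ident2 X) n (\<alpha>, H)) = at_ty (ident X) n (\<gamma>, g)"
proof -
  have J: "inc_ty_judg n \<alpha> H' \<in> eqfree (V (G X))" using inc_ty_judg_eqfree[OF is_psh_V[OF X] H_ident_in] .
  have "at_ty (mu X) n (at_ty (ident2 X) n (\<alpha>, H)) = judg_class (G X) (tr_judg body (inc_ty_judg n \<alpha> H'))"
    unfolding ident2_ty inc_ty_judg_def using n by (intro mu_type[OF X J[unfolded inc_ty_judg_def]]) simp
  also have "tr_judg body (inc_ty_judg n \<alpha> H') = inc_ty_judg n \<gamma> g"
    using tr_body_inc_ctx tr_body_inc_type[OF n] by (simp add: inc_ty_judg_def)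
  finally show ?thesis using ident_ty[OF glue_in] by simp
qed

context
  fixes a
  assumes a: "((\<alpha>, H), ((\<beta>, h), a)) \<in> tm_el (inc_S (inc_S X)) n"
begin

lemma a_in: "((\<beta>, h), a) \<in> tm_el (inc_S X) (\<alpha> n)"
  using a by (auto simp: inc_S_tm_iff[of \<alpha> H] tm_el_inc_S)

lemma a_Tm: "a \<in> Tm X (\<beta> (\<alpha> n)) (at_ty h (\<beta> (\<alpha> n)) (\<beta> (\<alpha> n)))"
  using a_in by (simp add: inc_S_tm_iff)

lemma glue_tm_in: "((\<gamma>, g), a) \<in> tm_el (inc_S X) n"
  using glue_in a_Tm g_ty[of "\<beta> (\<alpha> n)"] Inc_pos[OF \<beta> \<alpha>n order_refl] \<gamma>_at[of n] by (simp add: inc_S_tm_iff)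

lemma ident_a_in: "((\<alpha>, H'), at_tm (ident X) (\<alpha> n) ((\<beta>, h), a)) \<in> tm_el (inc_S (V (G X))) n"
  using H_ident_in ident_tm_in[OF X a_in] ident_comp(1)[OF X H \<alpha>n order_refl] top by (simp add: inc_S_tm_iff)

lemma mu_ident2_tm:
  "at_tm (mu X) n (at_tm (ident2 X) n ((\<alpha>, H), ((\<beta>, h), a))) = at_tm (ident X) n ((\<gamma>, g), a)"
proof -
  let ?c = "judg_class (G X) (inc_tm_judg (\<alpha> n) \<beta> h a)"
  have J: "inc_tm_judg n \<alpha> H' ?c \<in> eqfree (V (G X))"
    using inc_tm_judg_eqfree[OF is_psh_V[OF X] ident_a_in] ident_tm[OF a_in] by simp
  have "at_tm (ident2 X) n ((\<alpha>, H), ((\<beta>, h), a)) = judg_class (G (V (G X))) (inc_tm_judg n \<alpha> H' ?c)"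
    using a ident_tm[OF ident_a_in] ident_tm[OF a_in]
    by (simp add: ident2_def psh_comp_def psh_restrict_def inc_S_map_def S_def)
  then have "at_tm (mu X) n (at_tm (ident2 X) n ((\<alpha>, H), ((\<beta>, h), a)))
      = judg_class (G X) (tr_judg body (inc_tm_judg n \<alpha> H' ?c))"
    unfolding inc_tm_judg_def[of n] using mu_term[OF X J[unfolded inc_tm_judg_def[of n]], of n] n by simp
  also have "tr body (inc_term n \<alpha> H' ?c) = inc_term n \<gamma> g a"
  proof -
    have "tr body (inc_term n \<alpha> H' ?c)
        = subst (arg_subst (map (\<lambda>i. inc_exp n \<gamma> g (\<beta> i)) [1..<\<alpha> n])) (inc_term (\<alpha> n) \<beta> h a)"
      unfolding inc_term_def[of n \<alpha>] tr.simps body_term[OF X a_in] map_tr_body_inc_exp[OF order_refl] ..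
    also have "\<dots> = inc_term n \<gamma> g a"
      using \<gamma>_at[of n] by (simp add: inc_term_def arg_subst_inc_exp[OF \<alpha> \<beta> order_refl] del: One_nat_def)
    finally show ?thesis .
  qed
  then have "tr_judg body (inc_tm_judg n \<alpha> H' ?c) = inc_tm_judg n \<gamma> g a"
    using tr_body_inc_ctx tr_body_inc_type[OF n] by (simp add: inc_tm_judg_def)
  finally show ?thesis using ident_tm[OF glue_tm_in] by simp
qed

end

end

theorem proposition34:
  fixes X :: "('a, 'b) psh"
    and H :: "(nat, nat, ('a, 'b) inc_ty, ('a, 'b) inc_ty \<times> 'b) psh_mor"
    and \<alpha> \<beta> :: "nat \<Rightarrow> nat" and h :: "(nat, nat, 'a, 'b) psh_mor" and k :: "nat \<Rightarrow> 'b" and n :: nat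
  assumes "is_psh X"
    and "(\<alpha>, H) \<in> ty_el (inc_S (inc_S X)) n"
    and "at_ty H (\<alpha> n) (\<alpha> n) = (\<beta>, h)"
    and "\<And>i. i \<in> {1..\<alpha> n} - \<alpha> ` {0..n} \<Longrightarrow> snd (at_tm H i i) = k i"
  shows "(inc_comp n \<beta> \<alpha>, glue n \<alpha> \<beta> h k) \<in> ty_el (inc_S X) n
       \<and> at_ty (mu X) n (at_ty (ident2 X) n (\<alpha>, H))
           = at_ty (ident X) n (inc_comp n \<beta> \<alpha>, glue n \<alpha> \<beta> h k)
       \<and> (\<forall>a. ((\<alpha>, H), ((\<beta>, h), a)) \<in> tm_el (inc_S (inc_S X)) n \<longrightarrow>
             ((inc_comp n \<beta> \<alpha>, glue n \<alpha> \<beta> h k), a) \<in> tm_el (inc_S X) n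
           \<and> at_tm (mu X) n (at_tm (ident2 X) n ((\<alpha>, H), ((\<beta>, h), a)))
               = at_tm (ident X) n ((inc_comp n \<beta> \<alpha>, glue n \<alpha> \<beta> h k), a))"
proof -
  interpret nested X H \<alpha> \<beta> h k n using assms by unfold_locales
  show ?thesis using glue_in mu_ident2_ty glue_tm_in mu_ident2_tm by blast
qed

end
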